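(* Let $K\subset\mathbb{R}^d$ be the invariant set of an iterated function system $\Phi=\{\phi_1,\dots,\phi_N\}$ ($N\ge 2$) of contracting similarities of $\mathbb{R}^d$ with contraction ratios $r_1,\dots,r_N\in(0,1)$ satisfying the strong separation condition. Let $g\colon\mathcal{U}\to\mathbb{R}^d$ be a conformal diffeomorphism on an open domain $\mathcal{U}\supseteq K_{1/2}$ such that $|g'|$ is $\alpha$-H\"older continuous for some $\alpha>0$, and let $F:=g(K)$. Let $\delta$ denote the Minkowski dimension of $K$ (and hence of $F$). Then the following hold. (i) The local average Minkowski contents $\widetilde{\mathcal{M}}(K,\cdot)$ and $\widetilde{\mathcal{M}}(F,\cdot)$ always exist. Moreover, $\widetilde{\mathcal{M}}(F,\cdot)$ is absolutely continuous with respect to the push-forward measure $g_\star\widetilde{\mathcal{M}}(K,\cdot)$ and their Radon--Nikodym derivative is $$\frac{\mathrm{d}\widetilde{\mathcal{M}}(F,\cdot)}{\mathrm{d}\left(g_\star\widetilde{\mathcal{M}}(K,\cdot)\right)}=|g'\circ g^{-1}|^\delta.$$ (ii) If the local Minkowski content $\mathcal{M}(K,\cdot)$ of $K$ exists, then the local Minkowski content $\mathcal{M}(F,\cdot)$ of $F$ exists. Moreover, in this case, $\mathcal{M}(K,\cdot)=\widetilde{\mathcal{M}}(K,\cdot)$ and $\mathcal{M}(F,\cdot)=\widetilde{\mathcal{M}}(F,\cdot)$.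
   Context: Setting. $\mathbb{R}^d$ carries the Euclidean metric $\rho$ and $\lambda^d$ is $d$-dimensional Lebesgue measure. For a nonempty compact $Y\subset\mathbb{R}^d$ and $\varepsilon>0$, $Y_\varepsilon:=\{x\in\mathbb{R}^d\mid\rho(Y,x)\le\varepsilon\}$ is the $\varepsilon$-parallel neighbourhood of $Y$. The invariant set $K$ of $\Phi$ is the unique nonempty compact set with $K=\bigcup_{i=1}^N\phi_iK$. The strong separation condition means $\phi_iK\cap\phi_jK=\emptyset$ for all $i\ne j$. Conformal means angle preserving: the Jacobian decomposes as $\mathrm{D}g(x)=f(x)\cdot O(x)$ with $O(x)$ an orthogonal matrix and $f(x)$ a scalar; $|g'(x)|:=|f(x)|$ is the length scaling ratio of $g$ at $x$. The diffeomorphism $g$ is understood as a diffeomorphism onto its image. Minkowski dimension. For nonempty compact $Y$, the upper and lower Minkowski dimensions are $\overline{\dim}_M(Y):=d-\liminf_{\varepsilon\searrow0}\frac{\ln\lambda^d(Y_\varepsilon)}{\ln\varepsilon}$ and $\underline{\dim}_M(Y):=d-\limsup_{\varepsilon\searrow0}\frac{\ln\lambda^d(Y_\varepsilon)}{\ln\varepsilon}$; if they coincide the common value is the Minkowski dimension. It is known that the Minkowski dimensions of $K$ and $F$ exist, are equal, and equal the unique $\delta$ with $\sum_{i=1}^N r_i^\delta=1$. Local contents. Let $Y$ be nonempty compact with Minkowski dimension $\delta$. The local average Minkowski content of $Y$ is the weak limit of finite Borel measures on $\mathbb{R}^d$, $\widetilde{\mathcal{M}}(Y,\cdot):=\operatorname{w-lim}_{T\searrow0}|\ln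 T|^{-1}\int_T^1\varepsilon^{\delta-d-1}\lambda^d(Y_\varepsilon\cap\cdot)\,\mathrm{d}\varepsilon$, provided it exists. The local Minkowski content of $Y$ is the weak limit of finite Borel measures $\mathcal{M}(Y,\cdot):=\operatorname{w-lim}_{\varepsilon\searrow0}\varepsilon^{\delta-d}\lambda^d(Y_\varepsilon\cap\cdot)$, whenever it exists. These limit measures are concentrated on $Y$, so the push-forward under $g$ of the (average) local content of $K$ is well defined as a Borel measure on $\mathbb{R}^d$ concentrated on $F$. *)

theory Defs
  imports "HOL-Analysis.Analysis"
begin

section \<open>Parallel neighbourhoods and Minkowski dimension\<close>

definition parallel_nbhd :: "'a::metric_space set \<Rightarrow> real \<Rightarrow> 'a set" where
  "parallel_nbhd Y \<epsilon> = {x. infdist x Y \<le> \<epsilon>}"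

text \<open>The dimensions are extended reals, since they are defined by a \<open>Liminf\<close> and a \<open>Limsup\<close>.
  For nonempty compact \<open>Y\<close> and positive \<open>\<epsilon>\<close> the Lebesgue measure of the parallel neighbourhood
  is positive and finite, so \<open>measure\<close> and \<open>ln\<close> take no junk values.\<close>

definition upper_minkowski_dim :: "'a::euclidean_space set \<Rightarrow> ereal" where
  "upper_minkowski_dim Y =
     ereal (real DIM('a)) -
     Liminf (at_right 0) (\<lambda>\<epsilon>. ereal (ln (measure lborel (parallel_nbhd Y \<epsilon>)) / ln \<epsilon>))"

definition lower_minkowski_dim :: "'a::euclidean_space set \<Rightarrow> ereal" where
  "lower_minkowski_dim Y =
     ereal (real DIM('a)) -
     Limsup (at_right 0) (\<lambda>\<epsilon>. ereal (ln (measure lborel (parallel_nbhd Y \<epsilon>)) / ln \<epsilon>))"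

definition has_minkowski_dim :: "'a::euclidean_space set \<Rightarrow> real \<Rightarrow> bool" where
  "has_minkowski_dim Y \<delta> \<longleftrightarrow>
     upper_minkowski_dim Y = ereal \<delta> \<and> lower_minkowski_dim Y = ereal \<delta>"

definition minkowski_dim :: "'a::euclidean_space set \<Rightarrow> real" where
  "minkowski_dim Y = (THE \<delta>. has_minkowski_dim Y \<delta>)"

lemma has_minkowski_dim_unique:
  "has_minkowski_dim Y \<delta> \<Longrightarrow> has_minkowski_dim Y \<delta>' \<Longrightarrow> \<delta> = \<delta>'"
  by (simp add: has_minkowski_dim_def)

lemma minkowski_dim_eqI: "has_minkowski_dim Y \<delta> \<Longrightarrow> minkowski_dim Y = \<delta>"
  unfolding minkowski_dim_def by (blast intro: the_equality has_minkowski_dim_unique)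

section \<open>Weak limits of finite Borel measures\<close>

definition finite_borel_measure :: "'a::topological_space measure \<Rightarrow> bool" where
  "finite_borel_measure \<mu> \<longleftrightarrow> finite_measure \<mu> \<and> sets \<mu> = sets borel"

definition weak_limit ::
  "'b filter \<Rightarrow> ('b \<Rightarrow> 'a::metric_space measure) \<Rightarrow> 'a measure \<Rightarrow> bool" where
  "weak_limit \<F> \<mu> \<nu> \<longleftrightarrow>
     finite_borel_measure \<nu> \<and>
     (\<forall>\<^sub>F t in \<F>. finite_borel_measure (\<mu> t)) \<and>
     (\<forall>h::'a \<Rightarrow> real. continuous_on UNIV h \<longrightarrow> bounded (range h) \<longrightarrow>
        ((\<lambda>t. integral\<^sup>L (\<mu> t) h) \<longlongrightarrow> integral\<^sup>L \<nu> h) \<F>)"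

lemma measure_closed_eq_limit:
  fixes \<nu> :: "'a::metric_space measure" and C :: "'a set"
  assumes \<nu>: "finite_borel_measure \<nu>" and C: "closed C" "C \<noteq> {}"
  shows "(\<lambda>n. \<integral>x. max 0 (1 - real n * infdist x C) \<partial>\<nu>) \<longlonglongrightarrow> measure \<nu> C"
proof -
  interpret finite_measure \<nu> using \<nu> by (simp add: finite_borel_measure_def)
  have sets: "sets \<nu> = sets borel" using \<nu> by (simp add: finite_borel_measure_def)
  have Cm: "C \<in> sets \<nu>" using C sets by simp
  have meas: "(\<lambda>x. max 0 (1 - real n * infdist x C)) \<in> borel_measurable \<nu>" for n
    unfolding measurable_cong_sets[OF sets refl]
    by (intro borel_measurable_continuous_onI continuous_intros)
  have "(\<lambda>n. \<integral>x. max 0 (1 - real n * infdist x C) \<partial>\<nu>) \<longlonglongrightarrow> (\<integral>x. indicator C x \<partial>\<nu>)"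
  proof (rule integral_dominated_convergence[where w="\<lambda>_. 1"])
    show "AE x in \<nu>. (\<lambda>n. max 0 (1 - real n * infdist x C)) \<longlonglongrightarrow> indicator C x"
    proof (rule AE_I2)
      fix x
      show "(\<lambda>n. max 0 (1 - real n * infdist x C)) \<longlonglongrightarrow> indicator C x"
      proof (cases "x \<in> C")
        case True
        then show ?thesis by simp
      next
        case False
        then have pos: "infdist x C > 0"
          using C in_closed_iff_infdist_zero[of C x] infdist_nonneg[of x C] by force
        obtain m where m: "1 < real m * infdist x C"
          using pos reals_Archimedean3 by blast
        have "max 0 (1 - real n * infdist x C) = 0" if "n \<ge> m" for n
        proof -
          have "real m * infdist x C \<le> real n * infdist x C"
            using that pos by (intro mult_right_mono) auto
          then show ?thesis using m by linarith
        qed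
        then have "\<forall>\<^sub>F n in sequentially. max 0 (1 - real n * infdist x C) = 0"
          unfolding eventually_sequentially by blast
        then show ?thesis using False by (simp add: tendsto_eventually)
      qed
    qed
  qed (use meas Cm in \<open>auto simp: infdist_nonneg\<close>)
  then show ?thesis
    using C sets sets_eq_imp_space_eq[OF sets] by simp
qed

lemma weak_limit_unique:
  fixes \<nu> \<nu>' :: "'a::metric_space measure"
  assumes "weak_limit \<F> \<mu> \<nu>" "weak_limit \<F> \<mu> \<nu>'" "\<F> \<noteq> bot"
  shows "\<nu> = \<nu>'"
proof -
  have fin: "finite_borel_measure \<nu>" "finite_borel_measure \<nu>'"
    using assms by (auto simp: weak_limit_def)
  have int_eq: "integral\<^sup>L \<nu> h = integral\<^sup>L \<nu>' h"
    if "continuous_on UNIV h" "bounded (range h)" for h :: "'a \<Rightarrow> real"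
    using assms that tendsto_unique unfolding weak_limit_def by blast
  have "measure \<nu> C = measure \<nu>' C" if C: "closed C" for C
  proof (cases "C = {}")
    case False
    have "integral\<^sup>L \<nu> (\<lambda>x. max 0 (1 - real n * infdist x C)) =
          integral\<^sup>L \<nu>' (\<lambda>x. max 0 (1 - real n * infdist x C))" for n
    proof (rule int_eq)
      show "bounded (range (\<lambda>x. max 0 (1 - real n * infdist x C)))"
        by (rule boundedI[where B=1]) (auto simp: infdist_nonneg)
    qed (intro continuous_intros)
    then show ?thesis
      using measure_closed_eq_limit[OF fin(1) C False] measure_closed_eq_limit[OF fin(2) C False]
      by (simp add: LIMSEQ_unique)
  qed simp
  then have emeq: "emeasure \<nu> C = emeasure \<nu>' C" if "closed C" for C
    using that fin by (simp add: finite_borel_measure_def finite_measure.emeasure_eq_measure)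
  show ?thesis
  proof (rule measure_eqI_generator_eq[where E="Collect closed" and \<Omega>=UNIV and A="\<lambda>_. UNIV"])
    show "Int_stable (Collect (closed :: 'a set \<Rightarrow> bool))"
      by (auto simp: Int_stable_def)
    show "sets \<nu> = sigma_sets UNIV (Collect closed)"
      "sets \<nu>' = sigma_sets UNIV (Collect closed)"
      using fin by (simp_all add: finite_borel_measure_def borel_eq_closed)
    show "emeasure \<nu> UNIV \<noteq> \<infinity>"
      using fin by (simp add: finite_borel_measure_def finite_measure.emeasure_finite)
  qed (use emeq in auto)
qed

section \<open>Local Minkowski contents\<close>

definition rescaled_parallel_measure ::
  "'a::euclidean_space set \<Rightarrow> real \<Rightarrow> real \<Rightarrow> 'a measure" where
  "rescaled_parallel_measure Y \<delta> \<epsilon> =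
     measure_of UNIV (sets borel)
       (\<lambda>B. ennreal (\<epsilon> powr (\<delta> - real DIM('a))) * emeasure lborel (parallel_nbhd Y \<epsilon> \<inter> B))"

definition averaged_parallel_measure ::
  "'a::euclidean_space set \<Rightarrow> real \<Rightarrow> real \<Rightarrow> 'a measure" where
  "averaged_parallel_measure Y \<delta> T =
     measure_of UNIV (sets borel)
       (\<lambda>B. ennreal (inverse \<bar>ln T\<bar>) *
            (\<integral>\<^sup>+ \<epsilon> \<in> {T..1}. ennreal (\<epsilon> powr (\<delta> - real DIM('a) - 1)) *
               emeasure lborel (parallel_nbhd Y \<epsilon> \<inter> B) \<partial>lborel))"

definition is_local_minkowski_content :: "'a::euclidean_space set \<Rightarrow> 'a measure \<Rightarrow> bool" where
  "is_local_minkowski_content Y \<mu> \<longleftrightarrow>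
     (\<exists>\<delta>. has_minkowski_dim Y \<delta> \<and>
          weak_limit (at_right 0) (rescaled_parallel_measure Y \<delta>) \<mu>)"

definition is_local_average_minkowski_content ::
  "'a::euclidean_space set \<Rightarrow> 'a measure \<Rightarrow> bool" where
  "is_local_average_minkowski_content Y \<mu> \<longleftrightarrow>
     (\<exists>\<delta>. has_minkowski_dim Y \<delta> \<and>
          weak_limit (at_right 0) (averaged_parallel_measure Y \<delta>) \<mu>)"

definition local_minkowski_content_exists :: "'a::euclidean_space set \<Rightarrow> bool" where
  "local_minkowski_content_exists Y \<longleftrightarrow> (\<exists>\<mu>. is_local_minkowski_content Y \<mu>)"

definition local_average_minkowski_content_exists :: "'a::euclidean_space set \<Rightarrow> bool" where
  "local_average_minkowski_content_exists Y \<longleftrightarrow>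
     (\<exists>\<mu>. is_local_average_minkowski_content Y \<mu>)"

definition local_minkowski_content :: "'a::euclidean_space set \<Rightarrow> 'a measure" where
  "local_minkowski_content Y = (THE \<mu>. is_local_minkowski_content Y \<mu>)"

definition local_average_minkowski_content :: "'a::euclidean_space set \<Rightarrow> 'a measure" where
  "local_average_minkowski_content Y = (THE \<mu>. is_local_average_minkowski_content Y \<mu>)"

lemma local_minkowski_content_eqI:
  assumes "is_local_minkowski_content Y \<mu>"
  shows "local_minkowski_content Y = \<mu>"
  unfolding local_minkowski_content_def
proof (rule the_equality)
  show "is_local_minkowski_content Y \<mu>" by (fact assms)
next
  fix \<nu> assume "is_local_minkowski_content Y \<nu>"
  then show "\<nu> = \<mu>"
    using assms unfolding is_local_minkowski_content_def
    by (metis has_minkowski_dim_unique weak_limit_unique trivial_limit_at_right_real)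
qed

lemma local_average_minkowski_content_eqI:
  assumes "is_local_average_minkowski_content Y \<mu>"
  shows "local_average_minkowski_content Y = \<mu>"
  unfolding local_average_minkowski_content_def
proof (rule the_equality)
  show "is_local_average_minkowski_content Y \<mu>" by (fact assms)
next
  fix \<nu> assume "is_local_average_minkowski_content Y \<nu>"
  then show "\<nu> = \<mu>"
    using assms unfolding is_local_average_minkowski_content_def
    by (metis has_minkowski_dim_unique weak_limit_unique trivial_limit_at_right_real)
qed

section \<open>Iterated function systems of similarities\<close>

definition contracting_similarity :: "real \<Rightarrow> ('a::metric_space \<Rightarrow> 'a) \<Rightarrow> bool" where
  "contracting_similarity r \<phi> \<longleftrightarrow>
     0 < r \<and> r < 1 \<and> (\<forall>x y. dist (\<phi> x) (\<phi> y) = r * dist x y)"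

definition invariant_set :: "nat \<Rightarrow> (nat \<Rightarrow> 'a::metric_space \<Rightarrow> 'a) \<Rightarrow> 'a set \<Rightarrow> bool" where
  "invariant_set N \<phi> K \<longleftrightarrow> K \<noteq> {} \<and> compact K \<and> K = (\<Union>i\<in>{1..N}. \<phi> i ` K)"

definition strong_separation :: "nat \<Rightarrow> (nat \<Rightarrow> 'a::metric_space \<Rightarrow> 'a) \<Rightarrow> 'a set \<Rightarrow> bool" where
  "strong_separation N \<phi> K \<longleftrightarrow>
     (\<forall>i\<in>{1..N}. \<forall>j\<in>{1..N}. i \<noteq> j \<longrightarrow> \<phi> i ` K \<inter> \<phi> j ` K = {})"

section \<open>Conformal diffeomorphisms\<close>

definition C1_on :: "(real^'n) set \<Rightarrow> (real^'n \<Rightarrow> real^'n) \<Rightarrow> bool" where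
  "C1_on S g \<longleftrightarrow>
     (\<exists>J :: real^'n \<Rightarrow> real^'n^'n. continuous_on S J \<and>
        (\<forall>x\<in>S. (g has_derivative (\<lambda>h. J x *v h)) (at x)))"

definition C1_diffeomorphism_on :: "(real^'n) set \<Rightarrow> (real^'n \<Rightarrow> real^'n) \<Rightarrow> bool" where
  "C1_diffeomorphism_on U g \<longleftrightarrow>
     open U \<and> open (g ` U) \<and> inj_on g U \<and> C1_on U g \<and> C1_on (g ` U) (inv_into U g)"

text \<open>The factor \<open>f\<close> is an explicit argument; on \<open>U\<close> its absolute value is determined by \<open>g\<close>
  and is the length scaling ratio \<open>|g'|\<close>.\<close>

definition conformal_on ::
  "(real^'n) set \<Rightarrow> (real^'n \<Rightarrow> real^'n) \<Rightarrow> (real^'n \<Rightarrow> real) \<Rightarrow> bool" where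
  "conformal_on U g f \<longleftrightarrow>
     (\<forall>x\<in>U. \<exists>Q :: real^'n^'n. orthogonal_matrix Q \<and>
        (g has_derivative (\<lambda>h. (f x *\<^sub>R Q) *v h)) (at x))"

definition holder_continuous_on ::
  "real \<Rightarrow> 'a::metric_space set \<Rightarrow> ('a \<Rightarrow> real) \<Rightarrow> bool" where
  "holder_continuous_on \<alpha> S h \<longleftrightarrow>
     (\<exists>C. \<forall>x\<in>S. \<forall>y\<in>S. \<bar>h x - h y\<bar> \<le> C * dist x y powr \<alpha>)"

text \<open>\<open>g\<close> is only constrained on \<open>U\<close>, hence need not be measurable on the whole space;
  restricting \<open>\<mu>\<close> to \<open>U\<close> loses nothing when \<open>\<mu>\<close> is concentrated on \<open>U\<close>.\<close>

definition pushforward_on ::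
  "'a::topological_space set \<Rightarrow> ('a \<Rightarrow> 'b::topological_space) \<Rightarrow> 'a measure \<Rightarrow> 'b measure" where
  "pushforward_on U g \<mu> = distr (restrict_space \<mu> U) borel g"

end

theory Submission
  imports Defs "HOL-Probability.Stream_Space"
begin

text \<open>
  Write \<open>d\<close> for the dimension of the space and \<open>V h \<epsilon>\<close> for the integral of \<open>h\<close> over the
  \<open>\<epsilon>\<close>-neighbourhood, multiplied by \<open>\<epsilon> powr (\<delta> - d)\<close>. A local content is a
  measure \<open>\<nu>\<close> such that \<open>V h\<close> tends to the integral of \<open>h\<close> against \<open>\<nu>\<close> for all bounded continuous
  \<open>h\<close>, and a local average content is the same with logarithmic means of \<open>V h\<close>.

  Average content of \<open>K\<close>. Strong separation makes small neighbourhoods of \<open>K\<close> disjoint unions of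
  similar copies of larger ones, so \<open>V h \<epsilon>\<close> is the average, with weights \<open>r i powr \<delta>\<close>, of the
  values \<open>V (h \<circ> \<phi> i) (\<epsilon> / r i)\<close> (\<open>nbhd_integral_functional_equation\<close>). For \<open>h = 1\<close> this
  traps the rescaled volume between positive constants, which settles the Minkowski dimension. Integrated,
  it shows that the logarithmic integral of the volume is a multiple of \<open>ln T\<close> up to a bounded error;
  hence the logarithmic means converge to some \<open>M\<close>, without any appeal to a renewal theorem
  (\<open>log_mean_volume_converges\<close>). For general \<open>h\<close>, the equation shows that the limiting mean does not
  change if \<open>h\<close> is replaced by the weighted average of the functions \<open>h \<circ> \<phi> i\<close>. Iterating
  this makes \<open>h\<close> almost constant near \<open>K\<close>, the constant being the integral of \<open>h\<close> against
  the self-similar probability measure, so \<open>M\<close> times that measure is the average content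
  (\<open>log_mean_nbhd_integral_converges\<close>).

  Passing to \<open>g ` K\<close>. Near \<open>K\<close> a conformal map multiplies distances to the set by its scaling ratio
  \<open>\<bar>f\<bar>\<close>, up to a factor close to one (\<open>distance_comparison\<close>). So \<open>g\<close> pulls
  the \<open>\<epsilon>\<close>-neighbourhood of the image back to the neighbourhood of \<open>K\<close> with the variable radius
  \<open>\<epsilon> / \<bar>f x\<bar>\<close>, and the substitution rule contributes \<open>\<bar>f x\<bar> ^ d\<close>. A partition of unity in the
  variable \<open>ln \<bar>f\<bar>\<close> reduces variable radii to constant ones, where rescaling contributes
  \<open>\<bar>f x\<bar> powr (\<delta> - d)\<close> (\<open>variable_gauge_limit\<close>). The product is the density
  \<open>\<bar>f x\<bar> powr \<delta>\<close> of the theorem. Apart from the convergence of \<open>V h\<close> for \<open>K\<close>, this step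
  only uses linearity, monotonicity and scale invariance of the passage to the limit. It is therefore
  carried out once in the locale \<open>limit_mode\<close>, and yields both the average content and, if that of
  \<open>K\<close> exists, the content of the image. Contents agree with average contents because convergence
  implies convergence of logarithmic means (\<open>cesaro_log_mean\<close>).
\<close>

section \<open>Logarithmic means and two ways of passing to the limit\<close>

text \<open>A function of the radius is tame if it is Borel and bounded near zero. These are the functions
  for which the logarithmic means below are defined and insensitive to a change of scale; scaled
  volumes of parallel neighbourhoods are the examples to keep in mind.\<close>

definition tame :: "(real \<Rightarrow> real) \<Rightarrow> bool" where
  "tame V \<longleftrightarrow> V \<in> borel_measurable borel \<and> (\<forall>b>0. \<exists>C. \<forall>\<epsilon>\<in>{0<..b}. \<bar>V \<epsilon>\<bar> \<le> C)"

text \<open>Integration against the measure \<open>d\<epsilon> / \<epsilon>\<close>, which is invariant under scaling. The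
  Henstock--Kurzweil integral is used because its calculus on intervals (concatenation, stretching)
  is the most convenient; for tame functions it agrees with the Lebesgue integral.\<close>

definition log_integral :: "(real \<Rightarrow> real) \<Rightarrow> real \<Rightarrow> real \<Rightarrow> real" where
  "log_integral V a b = integral {a..b} (\<lambda>\<epsilon>. V \<epsilon> / \<epsilon>)"

definition log_mean :: "(real \<Rightarrow> real) \<Rightarrow> real \<Rightarrow> real" where
  "log_mean V T = inverse \<bar>ln T\<bar> * log_integral V T 1"

lemma tame_measurable [measurable_dest]: "tame V \<Longrightarrow> V \<in> borel_measurable borel"
  by (simp add: tame_def)

lemma tame_bounded:
  assumes "tame V" "b > 0"
  obtains C where "C > 0" "\<And>\<epsilon>. 0 < \<epsilon> \<Longrightarrow> \<epsilon> \<le> b \<Longrightarrow> \<bar>V \<epsilon>\<bar> \<le> C"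
proof -
  obtain C where C: "\<forall>\<epsilon>\<in>{0<..b}. \<bar>V \<epsilon>\<bar> \<le> C" using assms by (auto simp: tame_def)
  show thesis
  proof (rule that[of "max C 1"])
    show "max C 1 > 0" by simp
    show "\<And>\<epsilon>. 0 < \<epsilon> \<Longrightarrow> \<epsilon> \<le> b \<Longrightarrow> \<bar>V \<epsilon>\<bar> \<le> max C 1" using C by (force simp: le_max_iff_disj)
  qed
qed

lemma tame_const [simp]: "tame (\<lambda>_. c)"
  by (auto simp: tame_def)

lemma tame_add:
  assumes "tame V" "tame W" shows "tame (\<lambda>\<epsilon>. V \<epsilon> + W \<epsilon>)"
  unfolding tame_def
proof (intro conjI allI impI)
  show "(\<lambda>\<epsilon>. V \<epsilon> + W \<epsilon>) \<in> borel_measurable borel"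
    using assms[THEN tame_measurable] by measurable
  fix b :: real assume "b > 0"
  then obtain C D where CD: "\<forall>\<epsilon>\<in>{0<..b}. \<bar>V \<epsilon>\<bar> \<le> C" "\<forall>\<epsilon>\<in>{0<..b}. \<bar>W \<epsilon>\<bar> \<le> D"
    using assms unfolding tame_def by blast
  show "\<exists>C. \<forall>\<epsilon>\<in>{0<..b}. \<bar>V \<epsilon> + W \<epsilon>\<bar> \<le> C"
    by (rule exI[of _ "C + D"]) (use CD in \<open>auto intro: order_trans[OF abs_triangle_ineq] add_mono\<close>)
qed

lemma tame_cmult:
  assumes "tame V" shows "tame (\<lambda>\<epsilon>. c * V \<epsilon>)"
  unfolding tame_def
proof (intro conjI allI impI)
  show "(\<lambda>\<epsilon>. c * V \<epsilon>) \<in> borel_measurable borel"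
    using assms[THEN tame_measurable] by measurable
  fix b :: real assume "b > 0"
  then obtain C where C: "\<forall>\<epsilon>\<in>{0<..b}. \<bar>V \<epsilon>\<bar> \<le> C"
    using assms unfolding tame_def by blast
  show "\<exists>C. \<forall>\<epsilon>\<in>{0<..b}. \<bar>c * V \<epsilon>\<bar> \<le> C"
    by (rule exI[of _ "\<bar>c\<bar> * C"]) (use C in \<open>auto simp: abs_mult intro: mult_left_mono\<close>)
qed

lemma tame_diff: "tame V \<Longrightarrow> tame W \<Longrightarrow> tame (\<lambda>\<epsilon>. V \<epsilon> - W \<epsilon>)"
  using tame_add[of V "\<lambda>\<epsilon>. -1 * W \<epsilon>"] tame_cmult[of W "-1"] by simp

lemma tame_sum: "finite I \<Longrightarrow> (\<And>i. i \<in> I \<Longrightarrow> tame (V i)) \<Longrightarrow> tame (\<lambda>\<epsilon>. \<Sum>i\<in>I. V i \<epsilon>)"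
  by (induction I rule: finite_induct) (auto intro: tame_add)

lemma tame_scale:
  assumes "tame V" "c > 0" shows "tame (\<lambda>\<epsilon>. V (c * \<epsilon>))"
  unfolding tame_def
proof (intro conjI allI impI)
  show "(\<lambda>\<epsilon>. V (c * \<epsilon>)) \<in> borel_measurable borel"
    by (rule measurable_compose[OF _ tame_measurable[OF assms(1)]]) measurable
  fix b :: real assume "b > 0"
  then obtain C where C: "\<forall>\<epsilon>\<in>{0<..c*b}. \<bar>V \<epsilon>\<bar> \<le> C"
    using assms unfolding tame_def by (metis mult_pos_pos)
  show "\<exists>C. \<forall>\<epsilon>\<in>{0<..b}. \<bar>V (c * \<epsilon>)\<bar> \<le> C"
    by (rule exI[of _ "C"]) (use C assms in auto)
qed

lemma tame_absolutely_integrable: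
  assumes "tame V" "0 < a"
  shows "set_integrable lborel {a..b} (\<lambda>\<epsilon>. V \<epsilon> / \<epsilon>)"
proof (cases "a \<le> b")
  case True
  then obtain C where C: "C > 0" "\<And>\<epsilon>. 0 < \<epsilon> \<Longrightarrow> \<epsilon> \<le> b \<Longrightarrow> \<bar>V \<epsilon>\<bar> \<le> C"
    using tame_bounded[OF assms(1), of b] assms(2) by auto
  have [measurable]: "V \<in> borel_measurable borel" using assms by (simp add: tame_def)
  show ?thesis
    unfolding set_integrable_def
  proof (rule Bochner_Integration.integrable_bound)
    show "integrable lborel (\<lambda>x. indicator {a..b} x *\<^sub>R (C / a))"
      by (intro integrable_scaleR_left) (auto simp: integrable_indicator_iff emeasure_lborel_Icc_eq)
    show "AE x in lborel. norm (indicator {a..b} x *\<^sub>R (V x / x)) \<le> norm (indicator {a..b} x *\<^sub>R (C / a))"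
      using C assms by (intro AE_I2) (auto simp: indicator_def intro!: frac_le)
  qed measurable
qed (simp add: set_integrable_def)

lemma tame_integrable:
  "tame V \<Longrightarrow> 0 < a \<Longrightarrow> (\<lambda>\<epsilon>. V \<epsilon> / \<epsilon>) integrable_on {a..b}"
  by (rule set_borel_integral_eq_integral(1)[OF tame_absolutely_integrable])

lemma log_integral_eq_lebesgue:
  "tame V \<Longrightarrow> 0 < a \<Longrightarrow> log_integral V a b = (LINT \<epsilon>:{a..b}|lborel. V \<epsilon> / \<epsilon>)"
  unfolding log_integral_def
  by (rule set_borel_integral_eq_integral(2)[OF tame_absolutely_integrable, symmetric])

lemma log_integral_add:
  "tame V \<Longrightarrow> tame W \<Longrightarrow> 0 < a \<Longrightarrow>
    log_integral (\<lambda>\<epsilon>. V \<epsilon> + W \<epsilon>) a b = log_integral V a b + log_integral W a b"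
  unfolding log_integral_def add_divide_distrib
  by (rule Henstock_Kurzweil_Integration.integral_add) (auto intro: tame_integrable)

lemma log_integral_cmult: "log_integral (\<lambda>\<epsilon>. c * V \<epsilon>) a b = c * log_integral V a b"
  unfolding log_integral_def times_divide_eq_right[symmetric]
  by (rule Henstock_Kurzweil_Integration.integral_mult_right)

lemma log_integral_sum:
  "finite I \<Longrightarrow> (\<And>i. i \<in> I \<Longrightarrow> tame (V i)) \<Longrightarrow> 0 < a \<Longrightarrow>
    log_integral (\<lambda>\<epsilon>. \<Sum>i\<in>I. V i \<epsilon>) a b = (\<Sum>i\<in>I. log_integral (V i) a b)"
proof (induction I rule: finite_induct)
  case empty
  then show ?case by (simp add: log_integral_def)
next
  case (insert i I)
  then show ?case by (simp add: log_integral_add tame_sum)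
qed

lemma log_integral_combine:
  "tame V \<Longrightarrow> 0 < a \<Longrightarrow> a \<le> b \<Longrightarrow> b \<le> c \<Longrightarrow>
    log_integral V a b + log_integral V b c = log_integral V a c"
  unfolding log_integral_def
  by (rule Henstock_Kurzweil_Integration.integral_combine) (auto intro: tame_integrable)

lemma log_integral_const:
  assumes "0 < a" "a \<le> b"
  shows "log_integral (\<lambda>_. c) a b = c * (ln b - ln a)"
proof -
  have "((\<lambda>\<epsilon>. 1 / \<epsilon>) has_integral (ln b - ln a)) {a..b}"
    using assms
    by (intro fundamental_theorem_of_calculus)
       (auto intro!: derivative_eq_intros simp: has_real_derivative_iff_has_vector_derivative[symmetric])
  then have "((\<lambda>\<epsilon>. c * (1 / \<epsilon>)) has_integral c * (ln b - ln a)) {a..b}"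
    by (rule has_integral_mult_right)
  then show ?thesis unfolding log_integral_def by (simp add: integral_unique)
qed

lemma log_integral_mono:
  assumes "tame V" "tame W" "0 < a" "\<And>\<epsilon>. a \<le> \<epsilon> \<Longrightarrow> \<epsilon> \<le> b \<Longrightarrow> V \<epsilon> \<le> W \<epsilon>"
  shows "log_integral V a b \<le> log_integral W a b"
  unfolding log_integral_def using assms
  by (intro integral_le tame_integrable) (auto intro!: divide_right_mono)

lemma log_integral_cong:
  assumes "\<And>\<epsilon>. a \<le> \<epsilon> \<Longrightarrow> \<epsilon> \<le> b \<Longrightarrow> V \<epsilon> = W \<epsilon>"
  shows "log_integral V a b = log_integral W a b"
  unfolding log_integral_def using assms by (intro Henstock_Kurzweil_Integration.integral_cong) auto

lemma log_integral_abs_le: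
  assumes "tame V" "0 < a" "a \<le> b" "\<And>\<epsilon>. a \<le> \<epsilon> \<Longrightarrow> \<epsilon> \<le> b \<Longrightarrow> \<bar>V \<epsilon>\<bar> \<le> C"
  shows "\<bar>log_integral V a b\<bar> \<le> C * (ln b - ln a)"
proof -
  have "log_integral V a b \<le> log_integral (\<lambda>_. C) a b"
    using assms by (intro log_integral_mono) (auto simp: abs_le_iff)
  moreover have "log_integral (\<lambda>_. - C) a b \<le> log_integral V a b"
  proof (intro log_integral_mono)
    show "- C \<le> V \<epsilon>" if "a \<le> \<epsilon>" "\<epsilon> \<le> b" for \<epsilon> using assms(4)[OF that] by linarith
  qed (use assms in auto)
  ultimately show ?thesis using assms by (simp add: log_integral_const)
qed

lemma log_integral_scale:
  assumes "c > 0"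
  shows "log_integral (\<lambda>\<epsilon>. V (c * \<epsilon>)) a b = log_integral V (c * a) (c * b)"
proof -
  have img: "(\<lambda>x. x / c) ` {c * a..c * b} = {a..b}"
    using assms by simp
  have "(\<lambda>\<epsilon>. V (c * \<epsilon>) / \<epsilon>) = (\<lambda>\<epsilon>. c * ((\<lambda>t. V t / t) (c * \<epsilon>)))"
    using assms by (auto simp: fun_eq_iff field_simps)
  then have "integral {a..b} (\<lambda>\<epsilon>. V (c * \<epsilon>) / \<epsilon>)
      = c * integral {a..b} (\<lambda>\<epsilon>. (\<lambda>t. V t / t) (c * \<epsilon>))"
    by (simp only: Henstock_Kurzweil_Integration.integral_mult_right)
  also have "integral {a..b} (\<lambda>\<epsilon>. (\<lambda>t. V t / t) (c * \<epsilon>)) = (1 / c) * integral {c * a..c * b} (\<lambda>t. V t / t)"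
    using integral_stretch_real[of c "c * a" "c * b" "\<lambda>t. V t / t"] assms unfolding img by simp
  finally show ?thesis using assms by (simp add: log_integral_def)
qed

lemma tendsto_inverse_abs_ln: "((\<lambda>T. inverse \<bar>ln T\<bar>) \<longlongrightarrow> (0::real)) (at_right 0)"
proof -
  have "filterlim abs at_top (at_bot :: real filter)"
    unfolding filterlim_at_top
  proof
    fix Z :: real
    show "\<forall>\<^sub>F x in at_bot. Z \<le> \<bar>x\<bar>"
      using eventually_le_at_bot[of "- Z"] by eventually_elim linarith
  qed
  then show ?thesis
    by (intro tendsto_inverse_0_at_top filterlim_compose[OF _ ln_at_0])
qed

lemma eventually_at_right_0_less: "0 < (e::real) \<Longrightarrow> \<forall>\<^sub>F T in at_right 0. 0 < T \<and> T < e"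
  unfolding eventually_at_right_field by auto

text \<open>Whatever stays bounded before the division by \<open>|ln T|\<close> is invisible in the limit. This is
  the reason why logarithmic means depend neither on the upper integration limit nor on the scale.\<close>

lemma log_mean_bounded_remainder:
  assumes "0 < e" "\<And>T. 0 < T \<Longrightarrow> T < e \<Longrightarrow> \<bar>R T\<bar> \<le> C"
  shows "((\<lambda>T. inverse \<bar>ln T\<bar> * R T) \<longlongrightarrow> (0::real)) (at_right 0)"
proof (rule Lim_null_comparison)
  show "\<forall>\<^sub>F T in at_right 0. norm (inverse \<bar>ln T\<bar> * R T) \<le> inverse \<bar>ln T\<bar> * C"
    using eventually_at_right_0_less[OF assms(1)]
    by eventually_elim (use assms in \<open>auto simp: abs_mult intro!: mult_left_mono\<close>)
  show "((\<lambda>T. inverse \<bar>ln T\<bar> * C) \<longlongrightarrow> 0) (at_right 0)"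
    using tendsto_mult_left_zero[OF tendsto_inverse_abs_ln] .
qed

lemma log_mean_add:
  "tame V \<Longrightarrow> tame W \<Longrightarrow> 0 < T \<Longrightarrow>
    log_mean (\<lambda>\<epsilon>. V \<epsilon> + W \<epsilon>) T = log_mean V T + log_mean W T"
  by (simp add: log_mean_def log_integral_add ring_distribs)

lemma log_mean_cmult: "log_mean (\<lambda>\<epsilon>. c * V \<epsilon>) T = c * log_mean V T"
  by (simp add: log_mean_def log_integral_cmult)

text \<open>The inequality is only required near zero: the integrals over the remaining radii are constants,
  so their contribution to the means eventually drops below \<open>\<eta>\<close>.\<close>

lemma log_mean_asymptotic_mono:
  assumes "tame V" "tame W" "0 < e" "\<And>\<epsilon>. 0 < \<epsilon> \<Longrightarrow> \<epsilon> \<le> e \<Longrightarrow> V \<epsilon> \<le> W \<epsilon>" "0 < \<eta>"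
  shows "\<forall>\<^sub>F T in at_right 0. log_mean V T \<le> log_mean W T + \<eta>"
proof -
  define a where "a = min e 1"
  have a: "0 < a" "a \<le> e" "a \<le> 1" using assms by (auto simp: a_def)
  have "((\<lambda>T. inverse \<bar>ln T\<bar> * (log_integral V a 1 - log_integral W a 1)) \<longlongrightarrow> 0) (at_right 0)"
    by (rule log_mean_bounded_remainder[where e=1]) auto
  then have "\<forall>\<^sub>F T in at_right 0. inverse \<bar>ln T\<bar> * (log_integral V a 1 - log_integral W a 1) < \<eta>"
    using assms(5) by (rule order_tendstoD(2))
  then show ?thesis
    using eventually_at_right_0_less[OF a(1)]
  proof eventually_elim
    case (elim T)
    have "log_integral V T a \<le> log_integral W T a"
      using assms a elim by (intro log_integral_mono) auto
    then have "log_integral V T 1 \<le> log_integral W T 1 + (log_integral V a 1 - log_integral W a 1)"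
      using log_integral_combine[OF assms(1), of T a 1] log_integral_combine[OF assms(2), of T a 1] a elim
      by simp
    then have "log_mean V T \<le> inverse \<bar>ln T\<bar> * (log_integral W T 1 + (log_integral V a 1 - log_integral W a 1))"
      unfolding log_mean_def by (rule mult_left_mono) simp
    then show ?case using elim by (simp add: log_mean_def ring_distribs)
  qed
qed

text \<open>After substitution the two integrals run over \<open>[c T, c]\<close> and \<open>[T, 1]\<close>. They differ
  by integrals over \<open>[c T, T]\<close> and \<open>[c, 1]\<close>, both of which have the fixed logarithmic
  length \<open>|ln c|\<close>.\<close>

lemma log_mean_scale_diff:
  assumes V: "tame V" and c: "0 < c"
  shows "((\<lambda>T. log_mean (\<lambda>\<epsilon>. V (c * \<epsilon>)) T - log_mean V T) \<longlongrightarrow> 0) (at_right 0)"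
proof -
  have shrink: "((\<lambda>T. log_mean (\<lambda>\<epsilon>. V (c * \<epsilon>)) T - log_mean V T) \<longlongrightarrow> 0) (at_right 0)"
    if V: "tame V" and c: "0 < c" "c \<le> 1" for V c
  proof -
    obtain C where C: "C > 0" "\<And>\<epsilon>. 0 < \<epsilon> \<Longrightarrow> \<epsilon> \<le> 1 \<Longrightarrow> \<bar>V \<epsilon>\<bar> \<le> C"
      using tame_bounded[OF V, of 1] by auto
    have "((\<lambda>T. inverse \<bar>ln T\<bar> * (log_integral V (c * T) c - log_integral V T 1)) \<longlongrightarrow> 0) (at_right 0)"
    proof (rule log_mean_bounded_remainder[OF c(1), where C = "2 * (C * - ln c)"])
      fix T assume T: "0 < T" "T < c"
      have ct: "0 < c * T" "c * T \<le> T" "c * T \<le> c" using c T by (auto simp: mult_le_cancel_right2 mult_le_cancel_left2)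
      have "\<bar>log_integral V (c * T) T\<bar> \<le> C * (ln T - ln (c * T))"
        using ct T c by (intro log_integral_abs_le V C(2)) linarith+
      moreover have "\<bar>log_integral V c 1\<bar> \<le> C * (ln 1 - ln c)"
        using C c by (intro log_integral_abs_le V) auto
      moreover have "log_integral V (c * T) T + log_integral V T c = log_integral V (c * T) c"
        using ct T by (intro log_integral_combine V) auto
      moreover have "log_integral V T c + log_integral V c 1 = log_integral V T 1"
        using c T by (intro log_integral_combine V) auto
      ultimately show "\<bar>log_integral V (c * T) c - log_integral V T 1\<bar> \<le> 2 * (C * - ln c)"
        using c T by (simp add: ln_mult algebra_simps)
    qed
    then show ?thesis
      by (simp add: log_mean_def log_integral_scale[OF c(1)] right_diff_distrib)
  qed
  show ?thesis
  proof (cases "c \<le> 1")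
    case True
    then show ?thesis using shrink[OF V c] by simp
  next
    case False
    then have "((\<lambda>T. log_mean (\<lambda>\<epsilon>. V (c * (1 / c * \<epsilon>))) T - log_mean (\<lambda>\<epsilon>. V (c * \<epsilon>)) T) \<longlongrightarrow> 0) (at_right 0)"
      using shrink[OF tame_scale[OF V c], of "1 / c"] by simp
    then show ?thesis using tendsto_minus c by fastforce
  qed
qed

lemma log_mean_const: "0 < T \<Longrightarrow> T < 1 \<Longrightarrow> log_mean (\<lambda>_. c) T = c"
  by (simp add: log_mean_def log_integral_const)

text \<open>The two kinds of content arise from two ways of passing to the limit \<open>\<epsilon> \<longrightarrow> 0\<close>: along
  the radii themselves, and along their logarithmic means. The transport of contents by a conformal
  map only uses that the passage is linear, asymptotically monotone and blind to a change of
  scale, so these properties are isolated here and the transport is proved once for both.\<close>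

locale limit_mode =
  fixes A :: "(real \<Rightarrow> real) \<Rightarrow> real \<Rightarrow> real"
  assumes add: "\<And>V W T. tame V \<Longrightarrow> tame W \<Longrightarrow> 0 < T \<Longrightarrow> A (\<lambda>\<epsilon>. V \<epsilon> + W \<epsilon>) T = A V T + A W T"
    and cmult: "\<And>V c T. A (\<lambda>\<epsilon>. c * V \<epsilon>) T = c * A V T"
    and asymptotic_mono: "\<And>V W e \<eta>. tame V \<Longrightarrow> tame W \<Longrightarrow> 0 < e \<Longrightarrow>
      (\<And>\<epsilon>. 0 < \<epsilon> \<Longrightarrow> \<epsilon> \<le> e \<Longrightarrow> V \<epsilon> \<le> W \<epsilon>) \<Longrightarrow> 0 < \<eta> \<Longrightarrow>
      \<forall>\<^sub>F T in at_right 0. A V T \<le> A W T + \<eta>"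
    and scale: "\<And>V c a. tame V \<Longrightarrow> 0 < c \<Longrightarrow> (A V \<longlongrightarrow> a) (at_right 0) \<Longrightarrow>
      (A (\<lambda>\<epsilon>. V (c * \<epsilon>)) \<longlongrightarrow> a) (at_right 0)"

interpretation pointwise: limit_mode "\<lambda>V. V"
proof
  fix V :: "real \<Rightarrow> real" and c a :: real
  assume "0 < c" "(V \<longlongrightarrow> a) (at_right 0)"
  moreover have "filterlim (\<lambda>\<epsilon>. c * \<epsilon>) (at_right 0) (at_right 0)"
    using \<open>0 < c\<close> unfolding filterlim_at
    by (auto intro!: tendsto_eq_intros simp: eventually_at_right_field intro: exI[of _ 1])
  ultimately show "((\<lambda>\<epsilon>. V (c * \<epsilon>)) \<longlongrightarrow> a) (at_right 0)"
    by (auto intro: filterlim_compose)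
next
  fix V W :: "real \<Rightarrow> real" and e \<eta> :: real
  assume *: "0 < e" "\<And>\<epsilon>. 0 < \<epsilon> \<Longrightarrow> \<epsilon> \<le> e \<Longrightarrow> V \<epsilon> \<le> W \<epsilon>" "0 < \<eta>"
  show "\<forall>\<^sub>F T in at_right 0. V T \<le> W T + \<eta>"
    using eventually_at_right_0_less[OF *(1)]
    by eventually_elim (use * in \<open>force intro: add_increasing2\<close>)
qed auto

interpretation logarithmic: limit_mode log_mean
proof
  fix V :: "real \<Rightarrow> real" and c a :: real
  assume "tame V" "0 < c" "(log_mean V \<longlongrightarrow> a) (at_right 0)"
  then show "(log_mean (\<lambda>\<epsilon>. V (c * \<epsilon>)) \<longlongrightarrow> a) (at_right 0)"
    using tendsto_add[OF log_mean_scale_diff] by fastforce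
qed (auto intro: log_mean_add log_mean_cmult log_mean_asymptotic_mono)

text \<open>Near zero the function is squeezed between constants, and the mean of a constant is that constant.\<close>

lemma cesaro_log_mean:
  assumes "tame V" "(V \<longlongrightarrow> a) (at_right 0)"
  shows "(log_mean V \<longlongrightarrow> a) (at_right 0)"
proof (rule tendstoI)
  fix \<eta> :: real assume \<eta>: "\<eta> > 0"
  from assms(2) have "\<forall>\<^sub>F \<epsilon> in at_right 0. dist (V \<epsilon>) a < \<eta> / 3"
    by (rule tendstoD) (use \<eta> in simp)
  then obtain b where b: "b > 0" "\<And>\<epsilon>. 0 < \<epsilon> \<Longrightarrow> \<epsilon> < b \<Longrightarrow> dist (V \<epsilon>) a < \<eta> / 3"
    unfolding eventually_at_right_field by auto
  have V: "V \<epsilon> \<le> a + \<eta> / 3" "a - \<eta> / 3 \<le> V \<epsilon>" if "0 < \<epsilon>" "\<epsilon> \<le> b / 2" for \<epsilon>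
    using b(2)[OF that(1)] that b(1) by (simp, unfold dist_real_def, linarith)+
  have "\<forall>\<^sub>F T in at_right 0. log_mean V T \<le> log_mean (\<lambda>_. a + \<eta> / 3) T + \<eta> / 3"
    by (rule log_mean_asymptotic_mono[OF assms(1) tame_const, where e="b/2"]) (use b V \<eta> in auto)
  moreover have "\<forall>\<^sub>F T in at_right 0. log_mean (\<lambda>_. a - \<eta> / 3) T \<le> log_mean V T + \<eta> / 3"
    by (rule log_mean_asymptotic_mono[OF tame_const assms(1), where e="b/2"]) (use b V \<eta> in auto)
  ultimately show "\<forall>\<^sub>F T in at_right 0. dist (log_mean V T) a < \<eta>"
    using eventually_at_right_0_less[OF zero_less_one]
    by eventually_elim (use \<eta> in \<open>simp add: log_mean_const dist_real_def abs_less_iff\<close>)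
qed

context limit_mode
begin

lemma diff:
  assumes "tame V" "tame W" "0 < T"
  shows "A (\<lambda>\<epsilon>. V \<epsilon> - W \<epsilon>) T = A V T - A W T"
  using add[OF assms(1) tame_cmult[OF assms(2), of "-1"] assms(3)] cmult[of "-1" W T] by simp

lemma eventually_pos: "\<forall>\<^sub>F T in at_right (0::real). 0 < T"
  by (simp add: eventually_at_right_less)

lemma limit_add:
  assumes "tame V" "tame W" "(A V \<longlongrightarrow> a) (at_right 0)" "(A W \<longlongrightarrow> b) (at_right 0)"
  shows "(A (\<lambda>\<epsilon>. V \<epsilon> + W \<epsilon>) \<longlongrightarrow> a + b) (at_right 0)"
  by (rule Lim_transform_eventually[OF tendsto_add[OF assms(3,4)]])
     (use eventually_pos in eventually_elim, simp add: add assms)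

lemma limit_cmult:
  assumes "(A V \<longlongrightarrow> a) (at_right 0)"
  shows "(A (\<lambda>\<epsilon>. c * V \<epsilon>) \<longlongrightarrow> c * a) (at_right 0)"
  unfolding cmult by (intro tendsto_intros assms)

lemma limit_diff:
  assumes "tame V" "tame W" "(A V \<longlongrightarrow> a) (at_right 0)" "(A W \<longlongrightarrow> b) (at_right 0)"
  shows "(A (\<lambda>\<epsilon>. V \<epsilon> - W \<epsilon>) \<longlongrightarrow> a - b) (at_right 0)"
  by (rule Lim_transform_eventually[OF tendsto_diff[OF assms(3,4)]])
     (use eventually_pos in eventually_elim, simp add: diff assms)

lemma limit_sum:
  assumes "finite I" "\<And>i. i \<in> I \<Longrightarrow> tame (V i)" "\<And>i. i \<in> I \<Longrightarrow> (A (V i) \<longlongrightarrow> a i) (at_right 0)"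
  shows "(A (\<lambda>\<epsilon>. \<Sum>i\<in>I. V i \<epsilon>) \<longlongrightarrow> (\<Sum>i\<in>I. a i)) (at_right 0)"
  using assms
proof (induction I rule: finite_induct)
  case empty
  have "A (\<lambda>_. 0) = (\<lambda>_. 0)" using cmult[of 0] by (auto simp: fun_eq_iff)
  then show ?case by simp
next
  case (insert i I)
  then show ?case by (auto intro!: limit_add tame_sum)
qed

text \<open>Bounds by functions whose limits are known only have to be available up to every positive error.\<close>

lemma limit_sandwich:
  assumes V: "tame V"
    and approx: "\<And>\<eta>. 0 < \<eta> \<Longrightarrow> \<exists>W W' a' b' e. tame W \<and> tame W' \<and> 0 < e \<and>
      (\<forall>\<epsilon>. 0 < \<epsilon> \<longrightarrow> \<epsilon> \<le> e \<longrightarrow> W \<epsilon> \<le> V \<epsilon> \<and> V \<epsilon> \<le> W' \<epsilon>) \<and>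
      (A W \<longlongrightarrow> a') (at_right 0) \<and> (A W' \<longlongrightarrow> b') (at_right 0) \<and> a - \<eta> \<le> a' \<and> b' \<le> a + \<eta>"
  shows "(A V \<longlongrightarrow> a) (at_right 0)"
proof (rule tendstoI)
  fix \<eta> :: real assume \<eta>: "\<eta> > 0"
  then have \<eta>3: "\<eta> / 3 > 0" by simp
  obtain W W' a' b' e where *: "tame W" "tame W'" "0 < e"
      "\<And>\<epsilon>. 0 < \<epsilon> \<Longrightarrow> \<epsilon> \<le> e \<Longrightarrow> W \<epsilon> \<le> V \<epsilon>" "\<And>\<epsilon>. 0 < \<epsilon> \<Longrightarrow> \<epsilon> \<le> e \<Longrightarrow> V \<epsilon> \<le> W' \<epsilon>"
      "(A W \<longlongrightarrow> a') (at_right 0)" "(A W' \<longlongrightarrow> b') (at_right 0)" "a - \<eta>/3 \<le> a'" "b' \<le> a + \<eta>/3"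
    using approx[OF \<eta>3] by blast
  have "\<forall>\<^sub>F T in at_right 0. A V T \<le> A W' T + \<eta>/3" "\<forall>\<^sub>F T in at_right 0. A W T \<le> A V T + \<eta>/3"
    using asymptotic_mono[OF V *(2,3,5) \<eta>3] asymptotic_mono[OF *(1) V *(3,4) \<eta>3] by auto
  moreover have "\<forall>\<^sub>F T in at_right 0. dist (A W T) a' < \<eta>/3" "\<forall>\<^sub>F T in at_right 0. dist (A W' T) b' < \<eta>/3"
    using tendstoD[OF *(6) \<eta>3] tendstoD[OF *(7) \<eta>3] by auto
  ultimately show "\<forall>\<^sub>F T in at_right 0. dist (A V T) a < \<eta>"
    by eventually_elim (insert *(8,9), unfold dist_real_def, linarith)
qed

end

section \<open>Integrals over neighbourhoods\<close>

text \<open>A gauge measures how far a point lies from a set, up to distortion: \<open>infdist x K\<close> is one,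
  and so is a multiple of it by a positive function of \<open>x\<close>. Its sublevel sets play
  the part of the parallel neighbourhoods.\<close>

definition proper_gauge :: "('a::euclidean_space \<Rightarrow> real) \<Rightarrow> bool" where
  "proper_gauge D \<longleftrightarrow> D \<in> borel_measurable borel \<and> (\<forall>\<epsilon>. emeasure lborel {x. D x \<le> \<epsilon>} < \<infinity>)"

definition bounded_borel :: "('a::topological_space \<Rightarrow> real) \<Rightarrow> bool" where
  "bounded_borel h \<longleftrightarrow> h \<in> borel_measurable borel \<and> bounded (range h)"

text \<open>For \<open>D x = infdist x Y\<close> this is the integral of \<open>h\<close> with respect to the
  rescaled volume of the \<open>\<epsilon>\<close>-neighbourhood of \<open>Y\<close>. General gauges are admitted in order to
  cover neighbourhoods whose radius varies from point to point.\<close>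

definition sublevel_integral ::
  "real \<Rightarrow> ('a::euclidean_space \<Rightarrow> real) \<Rightarrow> ('a \<Rightarrow> real) \<Rightarrow> real \<Rightarrow> real" where
  "sublevel_integral \<delta> D h \<epsilon> =
     \<epsilon> powr (\<delta> - real DIM('a)) * (\<integral>x. indicator {x. D x \<le> \<epsilon>} x * h x \<partial>lborel)"

lemma bounded_borelI:
  "h \<in> borel_measurable borel \<Longrightarrow> (\<And>x. \<bar>h x\<bar> \<le> B) \<Longrightarrow> bounded_borel h"
  unfolding bounded_borel_def by (auto intro!: boundedI[where B=B])

lemma bounded_borel_continuous:
  "continuous_on UNIV h \<Longrightarrow> bounded (range h) \<Longrightarrow> bounded_borel h"
  by (simp add: bounded_borel_def borel_measurable_continuous_onI)

lemma bounded_borelE: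
  assumes "bounded_borel h"
  obtains B where "B > 0" "\<And>x. \<bar>h x\<bar> \<le> B"
proof -
  obtain B where "\<And>x. \<bar>h x\<bar> \<le> B"
    using assms unfolding bounded_borel_def bounded_iff by auto
  then show thesis by (intro that[of "max B 1"]) (auto simp: le_max_iff_disj)
qed

lemma bounded_borel_measurable [measurable_dest]: "bounded_borel h \<Longrightarrow> h \<in> borel_measurable borel"
  by (simp add: bounded_borel_def)

lemma bounded_borel_const [simp]: "bounded_borel (\<lambda>_. c)"
  by (rule bounded_borelI[of _ "\<bar>c\<bar>"]) auto

lemma bounded_borel_mult:
  assumes "bounded_borel h" "bounded_borel k" shows "bounded_borel (\<lambda>x. h x * k x)"
proof -
  obtain B C where "B > 0" "\<And>x. \<bar>h x\<bar> \<le> B" "C > 0" "\<And>x. \<bar>k x\<bar> \<le> C"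
    using assms by (metis bounded_borelE)
  then have "\<bar>h x * k x\<bar> \<le> B * C" for x by (auto simp: abs_mult intro!: mult_mono)
  with assms[THEN bounded_borel_measurable] show ?thesis by (intro bounded_borelI) auto
qed

lemma bounded_borel_add:
  assumes "bounded_borel h" "bounded_borel k" shows "bounded_borel (\<lambda>x. h x + k x)"
proof -
  obtain B C where "B > 0" "\<And>x. \<bar>h x\<bar> \<le> B" "C > 0" "\<And>x. \<bar>k x\<bar> \<le> C"
    using assms by (metis bounded_borelE)
  then have "\<bar>h x + k x\<bar> \<le> B + C" for x by (intro order_trans[OF abs_triangle_ineq] add_mono)
  with assms[THEN bounded_borel_measurable] show ?thesis by (intro bounded_borelI) auto
qed

lemma bounded_borel_sum:
  "finite I \<Longrightarrow> (\<And>i. i \<in> I \<Longrightarrow> bounded_borel (h i)) \<Longrightarrow> bounded_borel (\<lambda>x. \<Sum>i\<in>I. h i x)"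
  by (induction I rule: finite_induct) (auto intro: bounded_borel_add)

lemma bounded_borel_powr:
  fixes w :: "'a::topological_space \<Rightarrow> real"
  assumes "continuous_on UNIV w" "0 < a" "\<And>x. a \<le> w x" "\<And>x. w x \<le> b"
  shows "bounded_borel (\<lambda>x. w x powr p)"
proof (rule bounded_borelI)
  have pos: "0 < w x" for x using assms(2,3) less_le_trans by blast
  show "(\<lambda>x. w x powr p) \<in> borel_measurable borel"
    using pos by (intro borel_measurable_continuous_onI continuous_intros assms(1)) (auto simp: less_imp_neq[symmetric])
  show "\<bar>w x powr p\<bar> \<le> max (a powr p) (b powr p)" for x
    using assms(2) assms(3,4)[of x] powr_mono2[of p "w x" b] powr_mono2'[of p a "w x"]
    by (cases "0 \<le> p") (auto simp: le_max_iff_disj)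
qed

lemma proper_gauge_measurable [measurable_dest]: "proper_gauge D \<Longrightarrow> D \<in> borel_measurable borel"
  by (simp add: proper_gauge_def)

lemma sublevel_sets [measurable]: 
  "proper_gauge D \<Longrightarrow> {x. D x \<le> \<epsilon>} \<in> sets borel"
  using proper_gauge_measurable[of D] by measurable

lemma integrable_sublevel:
  assumes D: "proper_gauge D" and h: "bounded_borel h"
  shows "integrable lborel (\<lambda>x. indicator {x. D x \<le> \<epsilon>} x * h x)"
proof -
  obtain B where B: "B > 0" "\<And>x. \<bar>h x\<bar> \<le> B" using h by (rule bounded_borelE) blast
  note [measurable] = sublevel_sets[OF D] bounded_borel_measurable[OF h]
  show ?thesis
  proof (rule Bochner_Integration.integrable_bound)
    show "integrable lborel (\<lambda>x. indicator {x. D x \<le> \<epsilon>} x *\<^sub>R B)"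
      using D by (intro integrable_scaleR_left) (auto simp: integrable_indicator_iff proper_gauge_def)
    show "AE x in lborel. norm (indicator {x. D x \<le> \<epsilon>} x * h x) \<le> norm (indicator {x. D x \<le> \<epsilon>} x *\<^sub>R B)"
      using B by (intro AE_I2) (auto simp: indicator_def)
  qed measurable
qed

lemma sublevel_integral_measurable:
  assumes D: "proper_gauge D" and h: "bounded_borel h"
  shows "sublevel_integral \<delta> D h \<in> borel_measurable borel"
proof -
  note [measurable] = proper_gauge_measurable[OF D] bounded_borel_measurable[OF h]
  have "(\<lambda>\<epsilon>. \<integral>x. indicator {x. D x \<le> \<epsilon>} x * h x \<partial>lborel) \<in> borel_measurable borel"
    unfolding indicator_def by measurable
  then show ?thesis unfolding sublevel_integral_def[abs_def] by measurable
qed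

lemma sublevel_integral_add:
  assumes "proper_gauge D" "bounded_borel h" "bounded_borel k"
  shows "sublevel_integral \<delta> D (\<lambda>x. h x + k x) \<epsilon> = sublevel_integral \<delta> D h \<epsilon> + sublevel_integral \<delta> D k \<epsilon>"
  unfolding sublevel_integral_def
  using integrable_sublevel[OF assms(1,2)] integrable_sublevel[OF assms(1,3)]
  by (simp add: ring_distribs)

lemma sublevel_integral_cmult:
  "sublevel_integral \<delta> D (\<lambda>x. c * h x) \<epsilon> = c * sublevel_integral \<delta> D h \<epsilon>"
  unfolding sublevel_integral_def by (simp add: mult.left_commute[of _ c])

lemma sublevel_integral_sum:
  assumes "finite I" "proper_gauge D" "\<And>i. i \<in> I \<Longrightarrow> bounded_borel (h i)"
  shows "sublevel_integral \<delta> D (\<lambda>x. \<Sum>i\<in>I. h i x) \<epsilon> = (\<Sum>i\<in>I. sublevel_integral \<delta> D (h i) \<epsilon>)"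
  using assms(1,3)
proof (induction I rule: finite_induct)
  case empty
  then show ?case by (simp add: sublevel_integral_def)
next
  case (insert i I)
  then show ?case by (simp add: sublevel_integral_add assms(2) bounded_borel_sum)
qed

text \<open>Enlarging the region of integration is only harmless where the larger integrand is nonnegative,
  and only matters where the smaller integrand does not vanish.\<close>

lemma sublevel_integral_mono:
  assumes "proper_gauge D" "proper_gauge D'" "bounded_borel h" "bounded_borel h'"
    and "\<And>x. D x \<le> \<epsilon> \<Longrightarrow> h x \<le> h' x" "\<And>x. D x \<le> \<epsilon> \<Longrightarrow> h x \<noteq> 0 \<Longrightarrow> D' x \<le> \<epsilon>" "\<And>x. D' x \<le> \<epsilon> \<Longrightarrow> 0 \<le> h' x"
  shows "sublevel_integral \<delta> D h \<epsilon> \<le> sublevel_integral \<delta> D' h' \<epsilon>"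
  unfolding sublevel_integral_def
proof (intro mult_left_mono integral_mono integrable_sublevel assms)
  fix x
  show "indicator {x. D x \<le> \<epsilon>} x * h x \<le> indicator {x. D' x \<le> \<epsilon>} x * h' x"
    using assms(5-7)[of x] by (cases "h x = 0") (auto simp: indicator_def)
qed simp

lemma sublevel_integral_abs_le:
  assumes "proper_gauge D" "bounded_borel h" "\<And>x. D x \<le> \<epsilon> \<Longrightarrow> \<bar>h x\<bar> \<le> B"
  shows "\<bar>sublevel_integral \<delta> D h \<epsilon>\<bar> \<le> B * sublevel_integral \<delta> D (\<lambda>_. 1) \<epsilon>"
proof -
  have *: "\<bar>\<integral>x. indicator {x. D x \<le> \<epsilon>} x * h x \<partial>lborel\<bar> \<le> (\<integral>x. indicator {x. D x \<le> \<epsilon>} x * B \<partial>lborel)"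
    using assms
    by (intro order_trans[OF integral_abs_bound] integral_mono integrable_abs integrable_sublevel)
       (auto simp: indicator_def abs_mult)
  then have "\<epsilon> powr (\<delta> - real DIM('a)) * \<bar>\<integral>x. indicator {x. D x \<le> \<epsilon>} x * h x \<partial>lborel\<bar>
      \<le> \<epsilon> powr (\<delta> - real DIM('a)) * (\<integral>x. indicator {x. D x \<le> \<epsilon>} x * B \<partial>lborel)"
    by (intro mult_left_mono) auto
  then show ?thesis
    by (simp add: sublevel_integral_def abs_mult mult.commute mult.left_commute)
qed

lemma sublevel_integral_tame:
  assumes D: "proper_gauge D" and h: "bounded_borel h"
    and bdd: "\<And>b. b > 0 \<Longrightarrow> \<exists>C. \<forall>\<epsilon>\<in>{0<..b}. sublevel_integral \<delta> D (\<lambda>_. 1) \<epsilon> \<le> C"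
  shows "tame (sublevel_integral \<delta> D h)"
  unfolding tame_def
proof (intro conjI allI impI)
  show "sublevel_integral \<delta> D h \<in> borel_measurable borel"
    by (rule sublevel_integral_measurable[OF D h])
  fix b :: real assume "b > 0"
  then obtain C where C: "\<forall>\<epsilon>\<in>{0<..b}. sublevel_integral \<delta> D (\<lambda>_. 1) \<epsilon> \<le> C" using bdd by blast
  obtain B where B: "B > 0" "\<And>x. \<bar>h x\<bar> \<le> B" using h by (rule bounded_borelE) blast
  have "\<bar>sublevel_integral \<delta> D h \<epsilon>\<bar> \<le> B * C" if "\<epsilon> \<in> {0<..b}" for \<epsilon>
    using sublevel_integral_abs_le[OF D h B(2)] C that B(1)
    by (meson mult_left_mono order_less_imp_le order_trans)
  then show "\<exists>C. \<forall>\<epsilon>\<in>{0<..b}. \<bar>sublevel_integral \<delta> D h \<epsilon>\<bar> \<le> C" by blast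
qed

lemma proper_gauge_infdist:
  fixes K :: "'a::euclidean_space set"
  assumes "compact K" "K \<noteq> {}"
  shows "proper_gauge (\<lambda>x. infdist x K)"
  unfolding proper_gauge_def
proof (intro conjI allI)
  show "(\<lambda>x. infdist x K) \<in> borel_measurable borel"
    by (intro borel_measurable_continuous_onI continuous_intros)
  fix \<epsilon> :: real
  have "bounded {x. infdist x K \<le> max \<epsilon> 1}"
    by (rule compact_imp_bounded, rule compact_infdist_le) (use assms in auto)
  then have "bounded {x. infdist x K \<le> \<epsilon>}" by (rule bounded_subset) auto
  then show "emeasure lborel {x. infdist x K \<le> \<epsilon>} < \<infinity>"
    using emeasure_bounded_finite by auto
qed

lemma proper_gauge_mono:
  assumes "proper_gauge D" "D' \<in> borel_measurable borel" "0 < c" "\<And>x. D x \<le> c * D' x"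
  shows "proper_gauge D'"
  unfolding proper_gauge_def
proof (intro conjI allI assms(2))
  fix \<epsilon>
  have "{x. D' x \<le> \<epsilon>} \<subseteq> {x. D x \<le> c * \<epsilon>}"
    using assms(3,4) by (force intro: order_trans[OF _ mult_left_mono])
  then have "emeasure lborel {x. D' x \<le> \<epsilon>} \<le> emeasure lborel {x. D x \<le> c * \<epsilon>}"
    using assms(1) by (intro emeasure_mono) (auto intro: sublevel_sets)
  also have "\<dots> < \<infinity>" using assms(1) by (simp add: proper_gauge_def)
  finally show "emeasure lborel {x. D' x \<le> \<epsilon>} < \<infinity>" .
qed

text \<open>Multiplying the gauge amounts to dividing the radius; the normalising power then
  produces the factor \<open>c powr (\<delta> - d)\<close>. This factor is where the exponent of the density in the
  theorem comes from.\<close>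

lemma sublevel_integral_scale_gauge:
  fixes D :: "'a::euclidean_space \<Rightarrow> real"
  assumes "0 < c" "0 < \<epsilon>"
  shows "sublevel_integral \<delta> (\<lambda>x. c * D x) h \<epsilon> =
    c powr (\<delta> - real DIM('a)) * sublevel_integral \<delta> D h (1 / c * \<epsilon>)"
proof -
  have "{x. c * D x \<le> \<epsilon>} = {x. D x \<le> 1 / c * \<epsilon>}" using assms by (auto simp: field_simps)
  moreover have "c powr (\<delta> - real DIM('a)) * (1 / c * \<epsilon>) powr (\<delta> - real DIM('a)) = \<epsilon> powr (\<delta> - real DIM('a))"
    using assms by (simp add: powr_divide)
  ultimately show ?thesis by (simp add: sublevel_integral_def flip: mult.assoc)
qed

lemma proper_gauge_cmult: "proper_gauge D \<Longrightarrow> 0 < c \<Longrightarrow> proper_gauge (\<lambda>x. c * D x)"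
  by (rule proper_gauge_mono[of D _ "1 / c"]) (auto dest: proper_gauge_measurable)

abbreviation nbhd_integral :: "'a::euclidean_space set \<Rightarrow> real \<Rightarrow> ('a \<Rightarrow> real) \<Rightarrow> real \<Rightarrow> real" where
  "nbhd_integral Y \<delta> \<equiv> sublevel_integral \<delta> (\<lambda>x. infdist x Y)"

lemma parallel_nbhd_sets [measurable]: "parallel_nbhd (Y :: 'a::euclidean_space set) \<epsilon> \<in> sets borel"
  unfolding parallel_nbhd_def
  by (intro borel_closed closed_Collect_le continuous_intros)

text \<open>The measure is given by a set function on the Borel sets. Recognising it as the
  set function of a density shows that it is countably additive and makes integrals computable.\<close>

lemma rescaled_parallel_measure_eq_density:
  fixes Y :: "'a::euclidean_space set"
  shows "rescaled_parallel_measure Y \<delta> \<epsilon> =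
    density lborel (\<lambda>x. ennreal (\<epsilon> powr (\<delta> - real DIM('a)) * indicator {x. infdist x Y \<le> \<epsilon>} x))"
  unfolding rescaled_parallel_measure_def density_def space_lborel sets_lborel space_borel
proof (rule measure_of_eq)
  fix B :: "'a set" assume "B \<in> sigma_sets UNIV (sets borel)"
  then have [measurable]: "B \<in> sets borel"
    using sets.sigma_sets_eq[of "borel :: 'a measure"] by simp
  have "(\<integral>\<^sup>+ x. ennreal (\<epsilon> powr (\<delta> - real DIM('a)) * indicator {x. infdist x Y \<le> \<epsilon>} x) * indicator B x \<partial>lborel)
      = (\<integral>\<^sup>+ x. ennreal (\<epsilon> powr (\<delta> - real DIM('a))) * indicator (parallel_nbhd Y \<epsilon> \<inter> B) x \<partial>lborel)"
    by (intro nn_integral_cong) (auto simp: indicator_def parallel_nbhd_def)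
  also have "\<dots> = ennreal (\<epsilon> powr (\<delta> - real DIM('a))) * emeasure lborel (parallel_nbhd Y \<epsilon> \<inter> B)"
    by (subst nn_integral_cmult_indicator) auto
  finally show "ennreal (\<epsilon> powr (\<delta> - real DIM('a))) * emeasure lborel (parallel_nbhd Y \<epsilon> \<inter> B) =
    (\<integral>\<^sup>+ x. ennreal (\<epsilon> powr (\<delta> - real DIM('a)) * indicator {x. infdist x Y \<le> \<epsilon>} x) * indicator B x \<partial>lborel)"
    by simp
qed (use sets.space_closed[of "borel :: 'a measure"] in simp)

lemma integral_rescaled_parallel_measure:
  assumes "h \<in> borel_measurable borel"
  shows "integral\<^sup>L (rescaled_parallel_measure Y \<delta> \<epsilon>) h = nbhd_integral Y \<delta> h \<epsilon>"
proof -
  note [measurable] = assms parallel_nbhd_sets[unfolded parallel_nbhd_def]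
  show ?thesis
    unfolding rescaled_parallel_measure_eq_density sublevel_integral_def
    by (subst integral_density) (auto simp: mult.assoc)
qed

lemma finite_measure_density_integrable:
  assumes w: "integrable M w" "\<And>x. 0 \<le> w x"
  shows "finite_measure (density M (\<lambda>x. ennreal (w x)))" (is "finite_measure ?P")
proof (rule finite_measureI)
  have "emeasure ?P (space ?P) = (\<integral>\<^sup>+ z. 1 \<partial>?P)" by (simp only: nn_integral_const mult_1_left)
  also have "\<dots> = (\<integral>\<^sup>+ z. ennreal (w z) * 1 \<partial>M)"
    using w by (intro nn_integral_density) auto
  also have "\<dots> = ennreal (\<integral>z. w z \<partial>M)"
    unfolding mult_1_right by (rule nn_integral_eq_integral[OF w(1)]) (simp add: w(2))
  finally show "emeasure ?P (space ?P) \<noteq> \<infinity>" by simp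
qed

lemma finite_borel_measure_rescaled:
  fixes Y :: "'a::euclidean_space set"
  assumes "compact Y" "Y \<noteq> {}"
  shows "finite_borel_measure (rescaled_parallel_measure Y \<delta> \<epsilon>)"
proof -
  have "integrable lborel (\<lambda>x. \<epsilon> powr (\<delta> - real DIM('a)) * indicator {x. infdist x Y \<le> \<epsilon>} x)"
    using integrable_sublevel[OF proper_gauge_infdist[OF assms] bounded_borel_const[of 1]]
    by (intro integrable_mult_right) simp
  then have "finite_measure (rescaled_parallel_measure Y \<delta> \<epsilon>)"
    unfolding rescaled_parallel_measure_eq_density
    by (rule finite_measure_density_integrable) simp
  then show ?thesis
    by (simp add: finite_borel_measure_def rescaled_parallel_measure_eq_density)
qed

text \<open>The averaged measure is a marginal: put this density on pairs of a radius and a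
  point of the neighbourhood of that radius, and forget the radius.\<close>

definition parallel_graph_density ::
  "'a::euclidean_space set \<Rightarrow> real \<Rightarrow> real \<Rightarrow> real \<times> 'a \<Rightarrow> real" where
  "parallel_graph_density Y \<delta> T z =
     (if T \<le> fst z \<and> fst z \<le> 1 \<and> infdist (snd z) Y \<le> fst z
      then inverse \<bar>ln T\<bar> * fst z powr (\<delta> - real DIM('a) - 1) else 0)"

lemma parallel_graph_density_nonneg: "0 \<le> parallel_graph_density Y \<delta> T z"
  by (simp add: parallel_graph_density_def)

lemma parallel_graph_density_measurable [measurable]:
  fixes Y :: "'a::euclidean_space set"
  shows "parallel_graph_density Y \<delta> T \<in> borel_measurable (lborel \<Otimes>\<^sub>M lborel)"
proof -
  have sets_eq: "sets (lborel \<Otimes>\<^sub>M lborel) = sets (borel :: (real \<times> 'a) measure)"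
    by (simp flip: borel_prod cong: sets_pair_measure_cong)
  have "closed {z :: real \<times> 'a. T \<le> fst z \<and> fst z \<le> 1 \<and> infdist (snd z) Y \<le> fst z}"
    by (intro closed_Collect_conj closed_Collect_le continuous_intros)
  then have "{z \<in> space borel. T \<le> fst z \<and> fst z \<le> 1 \<and> infdist (snd z) Y \<le> fst z}
      \<in> sets (borel :: (real \<times> 'a) measure)"
    by simp
  moreover have "(\<lambda>z :: real \<times> 'a. inverse \<bar>ln T\<bar> * fst z powr (\<delta> - real DIM('a) - 1)) \<in> borel_measurable borel"
  proof (rule measurable_compose[of fst borel borel])
    show "fst \<in> borel_measurable (borel :: (real \<times> 'a) measure)"
      by (intro borel_measurable_continuous_onI continuous_intros)
  qed measurable
  ultimately show ?thesis
    unfolding measurable_cong_sets[OF sets_eq refl] parallel_graph_density_def[abs_def]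
    by (intro measurable_If) auto
qed

text \<open>Both set functions agree by Tonelli's theorem.\<close>

lemma averaged_parallel_measure_eq_distr:
  fixes Y :: "'a::euclidean_space set"
  shows "averaged_parallel_measure Y \<delta> T =
    distr (density (lborel \<Otimes>\<^sub>M lborel) (\<lambda>z. ennreal (parallel_graph_density Y \<delta> T z))) borel snd"
    (is "_ = distr ?P borel snd")
  unfolding averaged_parallel_measure_def distr_def space_borel
proof (rule measure_of_eq)
  fix B :: "'a set" assume "B \<in> sigma_sets UNIV (sets borel)"
  then have B [measurable]: "B \<in> sets borel"
    using sets.sigma_sets_eq[of "borel :: 'a measure"] by simp
  let ?w = "\<lambda>\<epsilon>. ennreal (inverse \<bar>ln T\<bar>) * (ennreal (\<epsilon> powr (\<delta> - real DIM('a) - 1)) * indicator {T..1} \<epsilon>)"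
  have [measurable]: "snd -` B \<in> sets (lborel \<Otimes>\<^sub>M lborel :: (real \<times> 'a) measure)"
    using measurable_sets[OF measurable_snd, of B lborel "lborel :: real measure"]
    by (simp add: space_pair_measure)
  have inner: "(\<integral>\<^sup>+ x. ennreal (parallel_graph_density Y \<delta> T (\<epsilon>, x)) * indicator (snd -` B) (\<epsilon>, x) \<partial>lborel)
    = ?w \<epsilon> * emeasure lborel (parallel_nbhd Y \<epsilon> \<inter> B)" for \<epsilon>
  proof -
    have "(\<integral>\<^sup>+ x. ennreal (parallel_graph_density Y \<delta> T (\<epsilon>, x)) * indicator (snd -` B) (\<epsilon>, x) \<partial>lborel)
      = (\<integral>\<^sup>+ x. ?w \<epsilon> * indicator (parallel_nbhd Y \<epsilon> \<inter> B) x \<partial>lborel)"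
      by (intro nn_integral_cong)
         (auto simp: parallel_graph_density_def parallel_nbhd_def ennreal_mult split: split_indicator)
    then show ?thesis by (simp add: nn_integral_cmult_indicator)
  qed
  have "emeasure ?P (snd -` B \<inter> space ?P)
      = (\<integral>\<^sup>+ z. ennreal (parallel_graph_density Y \<delta> T z) * indicator (snd -` B) z \<partial>(lborel \<Otimes>\<^sub>M lborel))"
    by (subst emeasure_density) (measurable, simp add: space_pair_measure)
  also have "\<dots> = (\<integral>\<^sup>+ \<epsilon>. ?w \<epsilon> * emeasure lborel (parallel_nbhd Y \<epsilon> \<inter> B) \<partial>lborel)"
    by (subst lborel.nn_integral_fst[symmetric]) (measurable, simp only: inner)
  also have "\<dots> = (\<integral>\<^sup>+ \<epsilon>. ennreal (inverse \<bar>ln T\<bar>) *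
      (ennreal (\<epsilon> powr (\<delta> - real DIM('a) - 1)) * emeasure lborel (parallel_nbhd Y \<epsilon> \<inter> B) * indicator {T..1} \<epsilon>) \<partial>lborel)"
    by (intro nn_integral_cong) (simp add: mult_ac)
  also have "\<dots> = ennreal (inverse \<bar>ln T\<bar>) *
      (\<integral>\<^sup>+ \<epsilon> \<in> {T..1}. ennreal (\<epsilon> powr (\<delta> - real DIM('a) - 1)) * emeasure lborel (parallel_nbhd Y \<epsilon> \<inter> B) \<partial>lborel)"
  proof (rule nn_integral_cmult)
    have [measurable]: "(\<lambda>x. infdist x Y) \<in> borel_measurable borel"
      by (intro borel_measurable_continuous_onI continuous_intros)
    have "(\<lambda>\<epsilon>. \<integral>\<^sup>+ x. (if infdist x Y \<le> \<epsilon> then 1 else 0) * indicator B x \<partial>lborel) \<in> borel_measurable (borel :: real measure)"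
      by measurable
    moreover have "(\<integral>\<^sup>+ x. (if infdist x Y \<le> \<epsilon> then 1 else 0) * indicator B x \<partial>lborel)
        = emeasure lborel (parallel_nbhd Y \<epsilon> \<inter> B)" for \<epsilon>
    proof -
      have "(\<integral>\<^sup>+ x. (if infdist x Y \<le> \<epsilon> then 1 else 0) * indicator B x \<partial>lborel)
        = (\<integral>\<^sup>+ x. indicator (parallel_nbhd Y \<epsilon> \<inter> B) x \<partial>lborel)"
        by (intro nn_integral_cong) (auto simp: parallel_nbhd_def split: split_indicator)
      then show ?thesis by simp
    qed
    ultimately have [measurable]: "(\<lambda>\<epsilon>. emeasure lborel (parallel_nbhd Y \<epsilon> \<inter> B)) \<in> borel_measurable borel"
      by simp
    show "(\<lambda>\<epsilon>. ennreal (\<epsilon> powr (\<delta> - real DIM('a) - 1)) * emeasure lborel (parallel_nbhd Y \<epsilon> \<inter> B) *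
        indicator {T..1} \<epsilon>) \<in> borel_measurable lborel" by measurable
  qed
  finally show "ennreal (inverse \<bar>ln T\<bar>) *
      (\<integral>\<^sup>+ \<epsilon> \<in> {T..1}. ennreal (\<epsilon> powr (\<delta> - real DIM('a) - 1)) * emeasure lborel (parallel_nbhd Y \<epsilon> \<inter> B) \<partial>lborel)
    = emeasure ?P (snd -` B \<inter> space ?P)" by simp
qed (use sets.space_closed[of "borel :: 'a measure"] in simp)

lemma integrable_parallel_graph_density:
  fixes Y :: "'a::euclidean_space set"
  assumes Y: "compact Y" "Y \<noteq> {}" and h: "bounded_borel h" and T: "0 < T"
  shows "integrable (lborel \<Otimes>\<^sub>M lborel) (\<lambda>z. parallel_graph_density Y \<delta> T z * h (snd z))"
proof -
  obtain B where B: "B > 0" "\<And>x. \<bar>h x\<bar> \<le> B" using h by (rule bounded_borelE) blast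
  note [measurable] = bounded_borel_measurable[OF h]
  define p where "p = \<delta> - real DIM('a) - 1"
  define R where "R = inverse \<bar>ln T\<bar> * max 1 (T powr p)"
  let ?S = "{T..1} \<times> {x. infdist x Y \<le> 1}"
  have sl [measurable]: "{x. infdist x Y \<le> 1} \<in> sets borel"
    using parallel_nbhd_sets[of Y 1] by (simp add: parallel_nbhd_def)
  have dens: "parallel_graph_density Y \<delta> T z \<le> R * indicator ?S z" for z
  proof -
    have "x powr p \<le> max 1 (T powr p)" if "T \<le> x" "x \<le> 1" for x
    proof (cases "p \<ge> 0")
      case True
      then have "x powr p \<le> 1 powr p" using that T by (intro powr_mono2) auto
      then show ?thesis by simp
    next
      case False
      then have "x powr p \<le> T powr p" using that T by (intro powr_mono2') auto
      then show ?thesis by simp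
    qed
    then have "inverse \<bar>ln T\<bar> * x powr p \<le> R" if "T \<le> x" "x \<le> 1" for x
      using that unfolding R_def by (intro mult_left_mono) auto
    then show ?thesis
      by (cases z) (auto simp: parallel_graph_density_def p_def[symmetric] indicator_def R_def)
  qed
  show ?thesis
  proof (rule Bochner_Integration.integrable_bound)
    have "emeasure (lborel \<Otimes>\<^sub>M lborel) ?S = emeasure lborel {T..1} * emeasure lborel {x. infdist x Y \<le> 1}"
      by (intro lborel.emeasure_pair_measure_Times) auto
    also have "\<dots> < \<infinity>"
      using proper_gauge_infdist[OF Y] by (auto simp: proper_gauge_def ennreal_mult_less_top emeasure_lborel_Icc_eq)
    finally show "integrable (lborel \<Otimes>\<^sub>M lborel) (\<lambda>z. indicator ?S z *\<^sub>R (R * B))"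
      by (intro integrable_scaleR_left) (auto simp: integrable_indicator_iff)
    show "(\<lambda>z. parallel_graph_density Y \<delta> T z * h (snd z)) \<in> borel_measurable (lborel \<Otimes>\<^sub>M lborel)"
      by measurable
    have "\<bar>parallel_graph_density Y \<delta> T z * h (snd z)\<bar> \<le> (R * indicator ?S z) * B" for z
      unfolding abs_mult using dens[of z] parallel_graph_density_nonneg[of Y \<delta> T z] B
      by (intro mult_mono) auto
    moreover have "0 \<le> R" unfolding R_def by auto
    ultimately show "AE z in lborel \<Otimes>\<^sub>M lborel. norm (parallel_graph_density Y \<delta> T z * h (snd z))
        \<le> norm (indicator ?S z *\<^sub>R (R * B))"
      using B(1) by (intro AE_I2) (auto simp: mult_ac)
  qed
qed

text \<open>Fubini's theorem for the graph density, integrating over the points of the neighbourhood first.\<close>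

lemma integral_averaged_parallel_measure:
  fixes Y :: "'a::euclidean_space set"
  assumes Y: "compact Y" "Y \<noteq> {}" and h: "bounded_borel h" and T: "0 < T"
    and tame: "tame (nbhd_integral Y \<delta> h)"
  shows "integral\<^sup>L (averaged_parallel_measure Y \<delta> T) h = log_mean (nbhd_integral Y \<delta> h) T"
proof -
  note [measurable] = bounded_borel_measurable[OF h]
  have "integral\<^sup>L (averaged_parallel_measure Y \<delta> T) h =
    (\<integral>z. parallel_graph_density Y \<delta> T z * h (snd z) \<partial>(lborel \<Otimes>\<^sub>M lborel))"
    unfolding averaged_parallel_measure_eq_distr
    by (subst integral_distr, measurable, subst integral_density)
       (auto simp: parallel_graph_density_nonneg)
  also have "\<dots> = (\<integral>\<epsilon>. (\<integral>x. parallel_graph_density Y \<delta> T (\<epsilon>, x) * h x \<partial>lborel) \<partial>lborel)"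
    using lborel_pair.integral_fst'[OF integrable_parallel_graph_density[OF Y h T]] by simp
  also have "\<dots> = (\<integral>\<epsilon>. inverse \<bar>ln T\<bar> * (indicator {T..1} \<epsilon> *\<^sub>R (nbhd_integral Y \<delta> h \<epsilon> / \<epsilon>)) \<partial>lborel)"
  proof (rule Bochner_Integration.integral_cong)
    fix \<epsilon> :: real
    show "(\<integral>x. parallel_graph_density Y \<delta> T (\<epsilon>, x) * h x \<partial>lborel)
      = inverse \<bar>ln T\<bar> * (indicator {T..1} \<epsilon> *\<^sub>R (nbhd_integral Y \<delta> h \<epsilon> / \<epsilon>))"
    proof (cases "\<epsilon> \<in> {T..1}")
      case True
      then have \<epsilon>: "0 < \<epsilon>" using T by auto
      have "(\<lambda>x. parallel_graph_density Y \<delta> T (\<epsilon>, x) * h x)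
        = (\<lambda>x. (inverse \<bar>ln T\<bar> * (\<epsilon> powr (\<delta> - real DIM('a)) / \<epsilon>)) * (indicator {x. infdist x Y \<le> \<epsilon>} x * h x))"
        using True \<epsilon> by (auto simp: fun_eq_iff parallel_graph_density_def powr_diff)
      then show ?thesis using True by (simp add: sublevel_integral_def)
    next
      case False
      then have "(\<lambda>x. parallel_graph_density Y \<delta> T (\<epsilon>, x) * h x) = (\<lambda>_. 0)"
        by (auto simp: fun_eq_iff parallel_graph_density_def)
      then show ?thesis using False by simp
    qed
  qed simp
  also have "\<dots> = log_mean (nbhd_integral Y \<delta> h) T"
    unfolding log_mean_def log_integral_eq_lebesgue[OF tame T] set_lebesgue_integral_def
    by (rule integral_mult_right_zero)
  finally show ?thesis .
qed

lemma finite_borel_measure_averaged: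
  fixes Y :: "'a::euclidean_space set"
  assumes Y: "compact Y" "Y \<noteq> {}" and T: "0 < T"
  shows "finite_borel_measure (averaged_parallel_measure Y \<delta> T)"
proof -
  let ?P = "density (lborel \<Otimes>\<^sub>M lborel) (\<lambda>z. ennreal (parallel_graph_density Y \<delta> T z))"
  have int: "integrable (lborel \<Otimes>\<^sub>M lborel) (parallel_graph_density Y \<delta> T)"
    using integrable_parallel_graph_density[OF Y bounded_borel_const[of 1] T] by simp
  have fin: "finite_measure ?P"
    by (rule finite_measure_density_integrable[OF int parallel_graph_density_nonneg])
  have "snd \<in> measurable ?P borel" by measurable
  then have "finite_measure (averaged_parallel_measure Y \<delta> T)"
    unfolding averaged_parallel_measure_eq_distr by (rule finite_measure.finite_measure_distr[OF fin])
  then show ?thesis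
    by (simp add: finite_borel_measure_def averaged_parallel_measure_eq_distr)
qed

section \<open>Exact volume order, dimension and weak limits\<close>

text \<open>The neighbourhood volume has exact order \<open>\<epsilon> powr (d - \<delta>)\<close>. This is stronger than having
  Minkowski dimension \<open>\<delta>\<close>, and it makes all neighbourhood integrals tame.\<close>

definition minkowski_regular :: "'a::euclidean_space set \<Rightarrow> real \<Rightarrow> bool" where
  "minkowski_regular Y \<delta> \<longleftrightarrow>
     (\<forall>b>0. \<exists>c C. 0 < c \<and> (\<forall>\<epsilon>\<in>{0<..b}. c \<le> nbhd_integral Y \<delta> (\<lambda>_. 1) \<epsilon> \<and> nbhd_integral Y \<delta> (\<lambda>_. 1) \<epsilon> \<le> C))"

lemma nbhd_integral_one:
  fixes Y :: "'a::euclidean_space set"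
  shows "nbhd_integral Y \<delta> (\<lambda>_. 1) \<epsilon> = \<epsilon> powr (\<delta> - real DIM('a)) * measure lborel (parallel_nbhd Y \<epsilon>)"
  by (simp add: sublevel_integral_def parallel_nbhd_def)

lemma emeasure_parallel_nbhd_finite:
  assumes "compact Y" "Y \<noteq> {}"
  shows "emeasure lborel (parallel_nbhd Y \<epsilon>) \<noteq> \<infinity>"
  using proper_gauge_infdist[OF assms] by (auto simp: proper_gauge_def parallel_nbhd_def less_top)

lemma measure_parallel_nbhd_mono:
  assumes "compact Y" "Y \<noteq> {}" "\<epsilon> \<le> \<epsilon>'"
  shows "measure lborel (parallel_nbhd Y \<epsilon>) \<le> measure lborel (parallel_nbhd Y \<epsilon>')"
proof (rule measure_mono_fmeasurable)
  show "parallel_nbhd Y \<epsilon> \<subseteq> parallel_nbhd Y \<epsilon>'" using assms(3) by (auto simp: parallel_nbhd_def)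
  show "parallel_nbhd Y \<epsilon>' \<in> fmeasurable lborel"
    using emeasure_parallel_nbhd_finite[OF assms(1,2), of \<epsilon>'] by (intro fmeasurableI) (auto simp: less_top)
qed simp

lemma measure_parallel_nbhd_pos:
  assumes "compact Y" "Y \<noteq> {}" "0 < \<epsilon>"
  shows "0 < measure lborel (parallel_nbhd Y \<epsilon>)"
proof -
  obtain y where y: "y \<in> Y" using assms by auto
  have "ball y \<epsilon> \<subseteq> parallel_nbhd Y \<epsilon>"
    using infdist_le[OF y] unfolding parallel_nbhd_def subset_iff mem_ball mem_Collect_eq
    by (metis dist_commute less_imp_le order_trans)
  then have "measure lborel (ball y \<epsilon>) \<le> measure lborel (parallel_nbhd Y \<epsilon>)"
    using emeasure_parallel_nbhd_finite[OF assms(1,2), of \<epsilon>]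
    by (intro measure_mono_fmeasurable fmeasurableI) (auto simp: less_top)
  moreover have "0 < measure lborel (ball y \<epsilon>)"
    using assms(3) content_ball_pos[of \<epsilon> y] by (simp add: measure_completion)
  ultimately show ?thesis by linarith
qed

text \<open>Away from zero the bounds hold for every compact set: the volume increases with
  the radius and the power is monotone.\<close>

lemma nbhd_integral_one_bounds:
  fixes Y :: "'a::euclidean_space set"
  assumes Y: "compact Y" "Y \<noteq> {}" and e: "0 < e"
  obtains c C where "0 < c" "\<And>\<epsilon>. e \<le> \<epsilon> \<Longrightarrow> \<epsilon> \<le> b \<Longrightarrow>
      c \<le> nbhd_integral Y \<delta> (\<lambda>_. 1) \<epsilon> \<and> nbhd_integral Y \<delta> (\<lambda>_. 1) \<epsilon> \<le> C"
proof (cases "e \<le> b")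
  case True
  define p where "p = \<delta> - real DIM('a)"
  have powr_between: "min (e powr p) (b powr p) \<le> \<epsilon> powr p \<and> \<epsilon> powr p \<le> max (e powr p) (b powr p)"
    if "e \<le> \<epsilon>" "\<epsilon> \<le> b" for \<epsilon>
  proof (cases "0 \<le> p")
    case True
    then have "e powr p \<le> \<epsilon> powr p" "\<epsilon> powr p \<le> b powr p" using e that by (auto intro: powr_mono2)
    then show ?thesis by auto
  next
    case False
    then have "\<epsilon> powr p \<le> e powr p" "b powr p \<le> \<epsilon> powr p" using e that by (auto intro: powr_mono2')
    then show ?thesis by auto
  qed
  show thesis
  proof (rule that)
    show "0 < min (e powr p) (b powr p) * measure lborel (parallel_nbhd Y e)"
      using e True measure_parallel_nbhd_pos[OF Y e] by auto
    fix \<epsilon> assume \<epsilon>: "e \<le> \<epsilon>" "\<epsilon> \<le> b"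
    have "min (e powr p) (b powr p) * measure lborel (parallel_nbhd Y e) \<le> \<epsilon> powr p * measure lborel (parallel_nbhd Y \<epsilon>)"
      using powr_between[OF \<epsilon>] measure_parallel_nbhd_mono[OF Y \<epsilon>(1)] by (intro mult_mono) auto
    moreover have "\<epsilon> powr p * measure lborel (parallel_nbhd Y \<epsilon>) \<le> max (e powr p) (b powr p) * measure lborel (parallel_nbhd Y b)"
      using powr_between[OF \<epsilon>] measure_parallel_nbhd_mono[OF Y \<epsilon>(2)]
      by (intro mult_mono) (auto simp: le_max_iff_disj)
    ultimately show "min (e powr p) (b powr p) * measure lborel (parallel_nbhd Y e) \<le> nbhd_integral Y \<delta> (\<lambda>_. 1) \<epsilon> \<and>
        nbhd_integral Y \<delta> (\<lambda>_. 1) \<epsilon> \<le> max (e powr p) (b powr p) * measure lborel (parallel_nbhd Y b)"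
      by (simp add: nbhd_integral_one p_def)
  qed
qed (use that[of 1] in force)

lemma minkowski_regularI:
  fixes Y :: "'a::euclidean_space set"
  assumes Y: "compact Y" "Y \<noteq> {}" and e: "0 < e" and c: "0 < c"
    and bounds: "\<And>\<epsilon>. 0 < \<epsilon> \<Longrightarrow> \<epsilon> \<le> e \<Longrightarrow>
      c \<le> nbhd_integral Y \<delta> (\<lambda>_. 1) \<epsilon> \<and> nbhd_integral Y \<delta> (\<lambda>_. 1) \<epsilon> \<le> C"
  shows "minkowski_regular Y \<delta>"
  unfolding minkowski_regular_def
proof (intro allI impI)
  fix b :: real assume b: "b > 0"
  obtain c' C' where *: "0 < c'" "\<And>\<epsilon>. e \<le> \<epsilon> \<Longrightarrow> \<epsilon> \<le> b \<Longrightarrow>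
      c' \<le> nbhd_integral Y \<delta> (\<lambda>_. 1) \<epsilon> \<and> nbhd_integral Y \<delta> (\<lambda>_. 1) \<epsilon> \<le> C'"
    using nbhd_integral_one_bounds[OF Y e] by metis
  show "\<exists>c C. 0 < c \<and> (\<forall>\<epsilon>\<in>{0<..b}. c \<le> nbhd_integral Y \<delta> (\<lambda>_. 1) \<epsilon> \<and> nbhd_integral Y \<delta> (\<lambda>_. 1) \<epsilon> \<le> C)"
  proof (rule exI[of _ "min c c'"], rule exI[of _ "max C C'"], intro conjI ballI)
    fix \<epsilon> assume "\<epsilon> \<in> {0<..b}"
    then show "min c c' \<le> nbhd_integral Y \<delta> (\<lambda>_. 1) \<epsilon>" "nbhd_integral Y \<delta> (\<lambda>_. 1) \<epsilon> \<le> max C C'"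
      using bounds[of \<epsilon>] *(2)[of \<epsilon>] by (cases "\<epsilon> \<le> e"; force simp: min_le_iff_disj le_max_iff_disj)+
  qed (use c * in auto)
qed

lemma minkowski_regular_tame:
  assumes "compact Y" "Y \<noteq> {}" "minkowski_regular Y \<delta>" "bounded_borel h"
  shows "tame (nbhd_integral Y \<delta> h)"
  using assms(3) unfolding minkowski_regular_def
  by (intro sublevel_integral_tame proper_gauge_infdist assms) blast

text \<open>The logarithm of the rescaled volume is bounded, so it disappears after division by \<open>ln \<epsilon>\<close>
  and only the exponent of the normalising power remains.\<close>

lemma minkowski_regular_has_dim:
  fixes Y :: "'a::euclidean_space set"
  assumes Y: "compact Y" "Y \<noteq> {}" and reg: "minkowski_regular Y \<delta>"
  shows "has_minkowski_dim Y \<delta>"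
proof -
  define d where "d = real DIM('a)"
  define v where "v = nbhd_integral Y \<delta> (\<lambda>_. 1)"
  obtain c C where cC: "0 < c" "\<And>\<epsilon>. 0 < \<epsilon> \<Longrightarrow> \<epsilon> \<le> 1 \<Longrightarrow> c \<le> v \<epsilon> \<and> v \<epsilon> \<le> C"
    using reg unfolding minkowski_regular_def v_def
    by (metis greaterThanAtMost_iff zero_less_one)
  have "((\<lambda>\<epsilon>. inverse \<bar>ln \<epsilon>\<bar> * - ln (v \<epsilon>)) \<longlongrightarrow> 0) (at_right 0)"
  proof (rule log_mean_bounded_remainder[where e=1 and C = "\<bar>ln c\<bar> + \<bar>ln C\<bar>"])
    fix \<epsilon> :: real assume "0 < \<epsilon>" "\<epsilon> < 1"
    then have v: "c \<le> v \<epsilon>" "v \<epsilon> \<le> C" using cC(2)[of \<epsilon>] by auto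
    then have "ln c \<le> ln (v \<epsilon>)" "ln (v \<epsilon>) \<le> ln C" using cC(1) by auto
    then show "\<bar>- ln (v \<epsilon>)\<bar> \<le> \<bar>ln c\<bar> + \<bar>ln C\<bar>" by linarith
  qed simp
  then have "((\<lambda>\<epsilon>. inverse \<bar>ln \<epsilon>\<bar> * - ln (v \<epsilon>) + (d - \<delta>)) \<longlongrightarrow> 0 + (d - \<delta>)) (at_right 0)"
    by (intro tendsto_intros)
  moreover have "\<forall>\<^sub>F \<epsilon> in at_right 0. inverse \<bar>ln \<epsilon>\<bar> * - ln (v \<epsilon>) + (d - \<delta>)
      = ln (measure lborel (parallel_nbhd Y \<epsilon>)) / ln \<epsilon>"
    using eventually_at_right_0_less[OF zero_less_one]
  proof eventually_elim
    case (elim \<epsilon>)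
    have "ln (v \<epsilon>) = (\<delta> - d) * ln \<epsilon> + ln (measure lborel (parallel_nbhd Y \<epsilon>))"
      using measure_parallel_nbhd_pos[OF Y, of \<epsilon>] elim
      by (simp add: v_def nbhd_integral_one ln_mult d_def)
    then show ?case using elim by (simp add: field_simps)
  qed
  ultimately have "((\<lambda>\<epsilon>. ln (measure lborel (parallel_nbhd Y \<epsilon>)) / ln \<epsilon>) \<longlongrightarrow> d - \<delta>) (at_right 0)"
    using Lim_transform_eventually by fastforce
  then have *: "((\<lambda>\<epsilon>. ereal (ln (measure lborel (parallel_nbhd Y \<epsilon>)) / ln \<epsilon>)) \<longlongrightarrow> ereal (d - \<delta>)) (at_right 0)"
    by simp
  show ?thesis
    unfolding has_minkowski_dim_def upper_minkowski_dim_def lower_minkowski_dim_def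
    using lim_imp_Liminf[OF _ *] lim_imp_Limsup[OF _ *] by (simp add: d_def)
qed

text \<open>In the two modes this says that \<open>\<nu>\<close> is the weak limit of the rescaled, respectively of
  the averaged, neighbourhood measures.\<close>

definition (in limit_mode) mode_content :: "'a::euclidean_space set \<Rightarrow> real \<Rightarrow> 'a measure \<Rightarrow> bool" where
  "mode_content Y \<delta> \<nu> \<longleftrightarrow> (\<forall>h. continuous_on UNIV h \<longrightarrow> bounded (range h) \<longrightarrow>
     (A (nbhd_integral Y \<delta> h) \<longlongrightarrow> integral\<^sup>L \<nu> h) (at_right 0))"

lemma weak_limit_rescaled_iff:
  assumes "compact Y" "Y \<noteq> {}" "finite_borel_measure \<nu>"
  shows "weak_limit (at_right 0) (rescaled_parallel_measure Y \<delta>) \<nu> \<longleftrightarrow> pointwise.mode_content Y \<delta> \<nu>"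
  unfolding weak_limit_def pointwise.mode_content_def
  using assms finite_borel_measure_rescaled[OF assms(1,2)]
  by (simp add: integral_rescaled_parallel_measure borel_measurable_continuous_onI)

lemma weak_limit_averaged_iff:
  assumes Y: "compact Y" "Y \<noteq> {}" "minkowski_regular Y \<delta>" and \<nu>: "finite_borel_measure \<nu>"
  shows "weak_limit (at_right 0) (averaged_parallel_measure Y \<delta>) \<nu> \<longleftrightarrow> logarithmic.mode_content Y \<delta> \<nu>"
proof -
  have pos: "\<forall>\<^sub>F T in at_right (0::real). 0 < T" by (simp add: eventually_at_right_less)
  have fin: "\<forall>\<^sub>F T in at_right 0. finite_borel_measure (averaged_parallel_measure Y \<delta> T)"
    using pos by eventually_elim (rule finite_borel_measure_averaged[OF Y(1,2)])
  have "((\<lambda>T. integral\<^sup>L (averaged_parallel_measure Y \<delta> T) h) \<longlongrightarrow> integral\<^sup>L \<nu> h) (at_right 0) \<longleftrightarrow>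
      (log_mean (nbhd_integral Y \<delta> h) \<longlongrightarrow> integral\<^sup>L \<nu> h) (at_right 0)"
    if "continuous_on UNIV h" "bounded (range h)" for h
  proof (rule tendsto_cong)
    have h: "bounded_borel h" using that by (rule bounded_borel_continuous)
    show "\<forall>\<^sub>F T in at_right 0. integral\<^sup>L (averaged_parallel_measure Y \<delta> T) h = log_mean (nbhd_integral Y \<delta> h) T"
      using pos
      by eventually_elim
         (rule integral_averaged_parallel_measure[OF Y(1,2) h _ minkowski_regular_tame[OF Y h]])
  qed
  then show ?thesis
    unfolding weak_limit_def logarithmic.mode_content_def using \<nu> fin by auto
qed

lemma mode_content_cesaro:
  assumes Y: "compact Y" "Y \<noteq> {}" "minkowski_regular Y \<delta>" and "pointwise.mode_content Y \<delta> \<nu>"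
  shows "logarithmic.mode_content Y \<delta> \<nu>"
  using assms(4) unfolding pointwise.mode_content_def logarithmic.mode_content_def
  by (auto intro!: cesaro_log_mean minkowski_regular_tame Y bounded_borel_continuous)

text \<open>The exponent in the definition of the contents is quantified existentially, but it must be the
  Minkowski dimension, which regularity identifies as \<open>\<delta>\<close>.\<close>

lemma is_local_content_iff:
  assumes Y: "compact Y" "Y \<noteq> {}" "minkowski_regular Y \<delta>"
  shows "is_local_minkowski_content Y \<nu> \<longleftrightarrow> finite_borel_measure \<nu> \<and> pointwise.mode_content Y \<delta> \<nu>"
    and "is_local_average_minkowski_content Y \<nu> \<longleftrightarrow> finite_borel_measure \<nu> \<and> logarithmic.mode_content Y \<delta> \<nu>"
proof -
  note dim = minkowski_regular_has_dim[OF Y]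
  have fin: "weak_limit F \<mu> \<nu> \<Longrightarrow> finite_borel_measure \<nu>" for F :: "real filter" and \<mu>
    by (simp add: weak_limit_def)
  show "is_local_minkowski_content Y \<nu> \<longleftrightarrow> finite_borel_measure \<nu> \<and> pointwise.mode_content Y \<delta> \<nu>"
    unfolding is_local_minkowski_content_def
    using dim has_minkowski_dim_unique fin weak_limit_rescaled_iff[OF Y(1,2)] by metis
  show "is_local_average_minkowski_content Y \<nu> \<longleftrightarrow> finite_borel_measure \<nu> \<and> logarithmic.mode_content Y \<delta> \<nu>"
    unfolding is_local_average_minkowski_content_def
    using dim has_minkowski_dim_unique fin weak_limit_averaged_iff[OF Y] by metis
qed

section \<open>Change of variables for conformal maps\<close>

text \<open>The substitution rule for Lebesgue integrals is formulated for \<open>real^'m\<close> with a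
  well-ordered index type. The first \<open>CARD('n)\<close> natural numbers form such a type, and
  renaming coordinates carries the rule over to an arbitrary finite index type \<open>'n\<close>.\<close>

typedef (overloaded) ('n::finite) ordinal_of = "{..<CARD('n)}"
  by (rule exI[of _ 0]) simp

instantiation ordinal_of :: (finite) wellorder
begin
definition less_eq_ordinal_of :: "'a ordinal_of \<Rightarrow> 'a ordinal_of \<Rightarrow> bool" where
  "less_eq_ordinal_of i j \<longleftrightarrow> Rep_ordinal_of i \<le> Rep_ordinal_of j"
definition less_ordinal_of :: "'a ordinal_of \<Rightarrow> 'a ordinal_of \<Rightarrow> bool" where
  "less_ordinal_of i j \<longleftrightarrow> Rep_ordinal_of i < Rep_ordinal_of j"
instance
proof
  fix P :: "'a ordinal_of \<Rightarrow> bool" and i :: "'a ordinal_of"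
  assume step: "\<And>i. (\<And>j. j < i \<Longrightarrow> P j) \<Longrightarrow> P i"
  show "P i"
    by (induction i rule: measure_induct_rule[of Rep_ordinal_of])
       (use step in \<open>auto simp: less_ordinal_of_def\<close>)
qed (auto simp: less_eq_ordinal_of_def less_ordinal_of_def Rep_ordinal_of_inject)
end

lemma card_ordinal_of: "CARD('n::finite ordinal_of) = CARD('n)"
  using type_definition.card[OF type_definition_ordinal_of[where ?'n='n]] by simp

instance ordinal_of :: (finite) finite
proof
  show "finite (UNIV :: 'a ordinal_of set)"
    unfolding type_definition.univ[OF type_definition_ordinal_of] by simp
qed

definition reindex_vec :: "('m \<Rightarrow> 'n) \<Rightarrow> real^'n \<Rightarrow> real^'m" where
  "reindex_vec b x = (\<chi> j. x $ b j)"

lemma linear_reindex_vec: "linear (reindex_vec b)"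
  by (auto simp: linear_iff reindex_vec_def vec_eq_iff)

lemma norm_reindex_vec:
  fixes b :: "'m::finite \<Rightarrow> 'n::finite"
  assumes "bij b" shows "norm (reindex_vec b x) = norm x"
proof -
  have "(\<Sum>j\<in>UNIV. (norm (x $ b j))\<^sup>2) = (\<Sum>i\<in>UNIV. (norm (x $ i))\<^sup>2)"
    using assms by (intro sum.reindex_bij_betw) (simp add: bij_def bij_betw_def)
  then show ?thesis by (simp add: norm_vec_def L2_set_def reindex_vec_def)
qed

lemma reindex_vec_inverse:
  "bij b \<Longrightarrow> reindex_vec b (reindex_vec (inv b) y) = y"
  "bij b \<Longrightarrow> reindex_vec (inv b) (reindex_vec b x) = x"
  by (simp_all add: reindex_vec_def vec_eq_iff bij_is_inj bij_is_surj surj_f_inv_f)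

lemma reindex_vec_borel [measurable]: "reindex_vec b \<in> borel_measurable borel"
  by (intro borel_measurable_continuous_onI linear_continuous_on linear_conv_bounded_linear[THEN iffD1]
      linear_reindex_vec)

lemma prod_Basis_cart: "(\<Prod>b\<in>(Basis :: (real^'n) set). F b) = (\<Prod>i\<in>UNIV. F (axis i 1))"
proof -
  have Basis: "(Basis :: (real^'n) set) = range (\<lambda>i. axis i 1)" by (auto simp: Basis_vec_def)
  have "inj (\<lambda>i::'n. axis i (1::real))" by (auto simp: inj_def axis_eq_axis)
  then show ?thesis unfolding Basis by (simp add: prod.reindex)
qed

lemma lborel_distr_reindex_vec:
  fixes b :: "'m::finite \<Rightarrow> 'n::finite"
  assumes b: "bij b"
  shows "distr lborel borel (reindex_vec b) = lborel"
proof (rule lborel_eqI[symmetric])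
  fix l u :: "real^'m" assume lu: "\<And>i. i \<in> Basis \<Longrightarrow> l \<bullet> i \<le> u \<bullet> i"
  have lu': "l $ j \<le> u $ j" for j using lu[of "axis j 1"] by (simp add: inner_axis)
  have surj: "\<exists>j. i = b j" for i using bij_is_surj[OF b] by (auto simp: surj_def)
  have "reindex_vec b -` box l u = box (reindex_vec (inv b) l) (reindex_vec (inv b) u)"
    using b surj by (auto simp: mem_box_cart reindex_vec_def bij_is_inj) (metis b bij_inv_eq_iff)+
  then have "emeasure (distr lborel borel (reindex_vec b)) (box l u)
      = emeasure lborel (box (reindex_vec (inv b) l) (reindex_vec (inv b) u))"
    by (simp add: emeasure_distr)
  also have "\<dots> = (\<Prod>i\<in>Basis. (reindex_vec (inv b) u - reindex_vec (inv b) l) \<bullet> i)"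
  proof (rule emeasure_lborel_box)
    fix i :: "real^'n" assume "i \<in> Basis"
    then obtain k where "i = axis k 1" by (auto simp: Basis_vec_def)
    then show "reindex_vec (inv b) l \<bullet> i \<le> reindex_vec (inv b) u \<bullet> i"
      using lu' by (simp add: inner_axis reindex_vec_def)
  qed
  also have "(\<Prod>i\<in>Basis. (reindex_vec (inv b) u - reindex_vec (inv b) l) \<bullet> i) = (\<Prod>i\<in>UNIV. (u - l) $ inv b i)"
    by (simp add: prod_Basis_cart inner_axis reindex_vec_def)
  also have "\<dots> = (\<Prod>j\<in>UNIV. (u - l) $ j)"
    using bij_imp_bij_inv[OF b] by (intro prod.reindex_bij_betw) (simp add: bij_def bij_betw_def)
  also have "\<dots> = (\<Prod>i\<in>Basis. (u - l) \<bullet> i)"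
    by (simp add: prod_Basis_cart inner_axis)
  finally show "emeasure (distr lborel borel (reindex_vec b)) (box l u) = (\<Prod>i\<in>Basis. (u - l) \<bullet> i)" .
qed simp

lemma integral_reindex_vec:
  fixes b :: "'m::finite \<Rightarrow> 'n::finite" and F :: "real^'m \<Rightarrow> real"
  assumes "bij b" "F \<in> borel_measurable borel"
  shows "(\<integral>x. F (reindex_vec b x) \<partial>lborel) = (\<integral>y. F y \<partial>lborel)"
  using integral_distr[of "reindex_vec b" lborel borel F] assms
  by (simp add: lborel_distr_reindex_vec)

text \<open>Up to the factor \<open>s\<close> the map is orthogonal, and orthogonal matrices have determinant \<open>1\<close>
  or \<open>-1\<close>.\<close>

lemma det_scaled_isometry:
  fixes L :: "real^'n \<Rightarrow> real^'n"
  assumes L: "linear L" and s: "0 < s" and norm: "\<And>v. norm (L v) = s * norm v"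
  shows "\<bar>det (matrix L)\<bar> = s ^ CARD('n)"
proof -
  define R where "R v = (1 / s) *\<^sub>R L v" for v
  have "orthogonal_transformation R"
    unfolding orthogonal_transformation
    using linear_compose_scale_right[OF L, of "1 / s"] s norm by (auto simp: R_def[abs_def])
  then have "orthogonal_matrix (matrix R)" "linear R"
    by (auto simp: orthogonal_transformation_matrix)
  then have "\<bar>det (matrix R)\<bar> = 1"
    using det_orthogonal_matrix by fastforce
  moreover have "L = (*\<^sub>R) s \<circ> R" using s by (auto simp: R_def)
  then have "matrix L = matrix ((*\<^sub>R) s) ** matrix R"
    using matrix_compose[OF \<open>linear R\<close>, of "(*\<^sub>R) s"] by (simp add: linear_scale_self)
  ultimately show ?thesis using s by (simp add: det_mul abs_mult)
qed

text \<open>The substitution rule concerns integrands with values in a cartesian space, so \<open>h\<close> is regarded as a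
  function into \<open>real^1\<close>.\<close>

lemma conformal_change_of_variables_wellorder:
  fixes g :: "real^'m::{finite,wellorder} \<Rightarrow> real^'m::_" and h :: "real^'m::_ \<Rightarrow> real"
  assumes S: "S \<in> sets borel" and inj: "inj_on g S"
    and der: "\<And>x. x \<in> S \<Longrightarrow> (g has_derivative g' x) (at x)"
    and s: "\<And>x. x \<in> S \<Longrightarrow> 0 < s x"
    and norm: "\<And>x v. x \<in> S \<Longrightarrow> norm (g' x v) = s x * norm v"
    and h: "set_integrable lborel (g ` S) h"
    and meas: "set_borel_measurable borel S (\<lambda>x. s x ^ CARD('m) * h (g x))"
  shows "(LINT y:g ` S|lborel. h y) = (LINT x:S|lborel. s x ^ CARD('m) * h (g x))"
proof -
  let ?f = "\<lambda>y. h y *\<^sub>R (1 :: real^1)"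
  have det: "\<bar>det (matrix (g' x))\<bar> = s x ^ CARD('m)" if "x \<in> S" for x
    using has_derivative_linear[OF der[OF that]] s[OF that] norm[OF that] by (rule det_scaled_isometry)
  have "h absolutely_integrable_on g ` S"
    using h unfolding set_integrable_def
    by (subst integrable_completion) (auto dest: borel_measurable_integrable)
  then have f: "?f absolutely_integrable_on g ` S"
    using absolutely_integrable_linear[OF _ bounded_linear_scaleR_left[of "1::real^1"]]
    by (simp add: o_def)
  have S': "S \<in> sets lebesgue" using S by simp
  have der': "\<And>x. x \<in> S \<Longrightarrow> (g has_derivative g' x) (at x within S)"
    using der has_derivative_at_withinI by blast
  have cov: "(\<lambda>x. \<bar>det (matrix (g' x))\<bar> *\<^sub>R ?f (g x)) absolutely_integrable_on S"
      "integral S (\<lambda>x. \<bar>det (matrix (g' x))\<bar> *\<^sub>R ?f (g x)) = integral (g ` S) ?f"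
    using has_absolute_integral_change_of_variables[OF S' der' inj, of ?f "integral (g ` S) ?f"] f by auto
  have nth: "bounded_linear (\<lambda>v :: real^1. v $ 1)" by (rule bounded_linear_vec_nth)
  have c1: "(\<lambda>x. s x ^ CARD('m) * h (g x)) absolutely_integrable_on S"
    using absolutely_integrable_linear[OF cov(1) nth]
    by (rule set_integrable_cong[THEN iffD1, rotated -1]) (auto simp: det)
  have "integral (g ` S) h = integral (g ` S) ((\<lambda>v. v $ 1) \<circ> ?f)" by (simp add: o_def)
  also have "\<dots> = integral (g ` S) ?f $ 1"
    using f by (intro integral_linear nth) (auto intro: set_lebesgue_integral_eq_integral)
  also have "\<dots> = integral S (\<lambda>x. \<bar>det (matrix (g' x))\<bar> *\<^sub>R ?f (g x)) $ 1" using cov(2) by simp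
  also have "\<dots> = integral S ((\<lambda>v. v $ 1) \<circ> (\<lambda>x. \<bar>det (matrix (g' x))\<bar> *\<^sub>R ?f (g x)))"
    using cov(1) by (intro integral_linear[symmetric] nth) (auto intro: set_lebesgue_integral_eq_integral)
  also have "\<dots> = integral S (\<lambda>x. s x ^ CARD('m) * h (g x))"
    by (rule Henstock_Kurzweil_Integration.integral_cong) (simp add: det)
  finally have eq: "integral (g ` S) h = integral S (\<lambda>x. s x ^ CARD('m) * h (g x))" .
  have "set_integrable lborel S (\<lambda>x. s x ^ CARD('m) * h (g x))"
    using c1 meas unfolding set_integrable_def set_borel_measurable_def
    by (subst (asm) integrable_completion) auto
  then show ?thesis
    using eq h by (simp add: set_borel_integral_eq_integral)
qed

text \<open>Renaming coordinates is an isometry that preserves Lebesgue measure, so conjugating \<open>g\<close> with it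
  changes neither the length scaling ratio nor the integrals.\<close>

lemma conformal_change_of_variables:
  fixes g :: "real^'n \<Rightarrow> real^'n" and h :: "real^'n \<Rightarrow> real"
  assumes S: "S \<in> sets borel" and inj: "inj_on g S"
    and der: "\<And>x. x \<in> S \<Longrightarrow> (g has_derivative g' x) (at x)"
    and s: "\<And>x. x \<in> S \<Longrightarrow> 0 < s x"
    and norm: "\<And>x v. x \<in> S \<Longrightarrow> norm (g' x v) = s x * norm v"
    and h: "set_integrable lborel (g ` S) h"
    and meas: "set_borel_measurable borel S (\<lambda>x. s x ^ CARD('n) * h (g x))"
  shows "(LINT y:g ` S|lborel. h y) = (LINT x:S|lborel. s x ^ CARD('n) * h (g x))"
proof -
  obtain b :: "'n ordinal_of \<Rightarrow> 'n" where b: "bij b"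
    using finite_same_card_bij[of "UNIV :: 'n ordinal_of set" "UNIV :: 'n set"]
    by (auto simp: card_ordinal_of)
  define T where "T = reindex_vec b"
  define T' where "T' = reindex_vec (inv b)"
  have b': "bij (inv b)" using b by (rule bij_imp_bij_inv)
  have TT' [simp]: "T (T' y) = y" "T' (T x) = x" for x y
    using reindex_vec_inverse[OF b] by (auto simp: T_def T'_def)
  have lin: "bounded_linear T" "bounded_linear T'"
    by (simp_all add: T_def T'_def linear_reindex_vec linear_conv_bounded_linear[symmetric])
  have norms [simp]: "norm (T x) = norm x" "norm (T' y) = norm y" for x y
    by (simp_all add: T_def T'_def norm_reindex_vec b b')
  have meas' [measurable]: "T \<in> borel_measurable borel" "T' \<in> borel_measurable borel"
    by (simp_all add: T_def T'_def)
  have img: "T ` X = T' -` X" for X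
    by (auto simp: image_iff) (metis TT'(1))
  have img2: "(T \<circ> g \<circ> T') ` T ` S = T ` g ` S" by (auto simp: image_image)
  have int_T': "(\<integral>y. F (T' y) \<partial>lborel) = (\<integral>x. F x \<partial>lborel)" if "F \<in> borel_measurable borel" for F :: "real^'n \<Rightarrow> real"
    unfolding T'_def by (rule integral_reindex_vec[OF b' that])
  have ind: "indicator (T ` X) y = (indicator X (T' y) :: real)" for X y
    unfolding img by (simp add: indicator_def)
  have hm: "(\<lambda>x. indicator (g ` S) x *\<^sub>R h x) \<in> borel_measurable borel"
    using h by (auto simp: set_integrable_def dest: borel_measurable_integrable)
  have sm: "(\<lambda>x. indicator S x *\<^sub>R (s x ^ CARD('n) * h (g x))) \<in> borel_measurable borel"
    using meas by (simp add: set_borel_measurable_def)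
  have "(LINT y:(T \<circ> g \<circ> T') ` T ` S|lborel. h (T' y))
    = (LINT x:T ` S|lborel. s (T' x) ^ CARD('n ordinal_of) * h (T' ((T \<circ> g \<circ> T') x)))"
  proof (rule conformal_change_of_variables_wellorder[where g' = "\<lambda>x. T \<circ> g' (T' x) \<circ> T'"])
    show "T ` S \<in> sets borel" unfolding img using S by (metis measurable_sets_borel meas'(2))
    show "inj_on (T \<circ> g \<circ> T') (T ` S)"
      using inj by (auto simp: inj_on_def) (metis TT'(2))
    show "(T \<circ> g \<circ> T' has_derivative T \<circ> g' (T' x) \<circ> T') (at x)" if "x \<in> T ` S" for x
    proof -
      have "(g has_derivative g' (T' x)) (at (T' x))" using that der by auto
      then have "(g \<circ> T' has_derivative g' (T' x) \<circ> T') (at x)"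
        by (rule diff_chain_at[OF bounded_linear_imp_has_derivative[OF lin(2)]])
      then have "(T \<circ> (g \<circ> T') has_derivative T \<circ> (g' (T' x) \<circ> T')) (at x)"
        by (rule diff_chain_at[OF _ bounded_linear_imp_has_derivative[OF lin(1)]])
      then show ?thesis by (simp add: o_assoc)
    qed
    show "0 < s (T' x)" if "x \<in> T ` S" for x using s that by auto
    show "norm ((T \<circ> g' (T' x) \<circ> T') v) = s (T' x) * norm v" if "x \<in> T ` S" for x v
      using norm that by auto
    have "integrable (distr lborel borel T') (\<lambda>x. indicator (g ` S) x *\<^sub>R h x)"
      using h by (simp add: set_integrable_def T'_def lborel_distr_reindex_vec b')
    then have "integrable lborel (\<lambda>y. indicator (g ` S) (T' y) *\<^sub>R h (T' y))"
      by (rule integrable_distr[rotated]) simp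
    then show "set_integrable lborel ((T \<circ> g \<circ> T') ` T ` S) (\<lambda>y. h (T' y))"
      unfolding set_integrable_def img2 ind by simp
    show "set_borel_measurable borel (T ` S) (\<lambda>x. s (T' x) ^ CARD('n ordinal_of) * h (T' ((T \<circ> g \<circ> T') x)))"
      using measurable_compose[OF meas'(2) sm]
      by (simp add: set_borel_measurable_def ind card_ordinal_of)
  qed
  moreover have "(LINT y:(T \<circ> g \<circ> T') ` T ` S|lborel. h (T' y)) = (LINT y:g ` S|lborel. h y)"
    using int_T'[OF hm] unfolding set_lebesgue_integral_def img2 ind .
  moreover have "(LINT x:T ` S|lborel. s (T' x) ^ CARD('n ordinal_of) * h (T' ((T \<circ> g \<circ> T') x)))
      = (LINT x:S|lborel. s x ^ CARD('n) * h (g x))"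
    using int_T'[OF sm] unfolding set_lebesgue_integral_def ind card_ordinal_of by simp
  ultimately show ?thesis by simp
qed

section \<open>The renewal equation of a self-similar set\<close>

lemma infdist_le_iff_near_point:
  fixes K :: "'a::heine_borel set"
  assumes "compact K" "K \<noteq> {}"
  shows "infdist x K \<le> \<epsilon> \<longleftrightarrow> (\<exists>y\<in>K. dist x y \<le> \<epsilon>)"
proof
  assume *: "infdist x K \<le> \<epsilon>"
  obtain y where "y \<in> K" "infdist x K = dist x y"
    using infdist_attains_inf[OF compact_imp_closed[OF assms(1)] assms(2), of x] .
  with * show "\<exists>y\<in>K. dist x y \<le> \<epsilon>" by auto
qed (auto intro: infdist_le2)

text \<open>The sum is continuous in the exponent, at least \<open>2\<close> at zero, and at most \<open>1\<close> at the \<open>t\<close>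
  for which the largest ratio satisfies \<open>\<rho> powr t = 1 / N\<close>.\<close>

lemma moran_exponent_exists:
  fixes r :: "nat \<Rightarrow> real"
  assumes N: "N \<ge> 2" and r: "\<And>i. i \<in> {1..N} \<Longrightarrow> 0 < r i \<and> r i < 1"
  shows "\<exists>\<delta>. (\<Sum>i\<in>{1..N}. r i powr \<delta>) = 1"
proof -
  define \<rho> where "\<rho> = Max (r ` {1..N})"
  have ne: "r ` {1..N} \<noteq> {}" using N by simp
  have \<rho>: "0 < \<rho>" "\<rho> < 1" "\<And>i. i \<in> {1..N} \<Longrightarrow> r i \<le> \<rho>"
    using r Max_in[OF _ ne] by (auto simp: \<rho>_def)
  define t where "t = ln (real N) / - ln \<rho>"
  have "0 \<le> t" unfolding t_def using \<rho>(1,2) N by (intro divide_nonneg_pos) auto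
  have "\<rho> powr t = inverse (real N)"
    using \<rho> N by (simp add: powr_def t_def exp_minus)
  then have "(\<Sum>i\<in>{1..N}. r i powr t) \<le> (\<Sum>i\<in>{1..N}. inverse (real N))"
    using r \<rho> \<open>0 \<le> t\<close> by (intro sum_mono) (metis less_imp_le powr_mono2)
  also have "\<dots> = 1" using N by simp
  finally have "(\<Sum>i\<in>{1..N}. r i powr t) \<le> 1" .
  moreover have "1 \<le> (\<Sum>i\<in>{1..N}. r i powr 0)"
  proof -
    have "(\<Sum>i\<in>{1..N}. r i powr 0) = (\<Sum>i\<in>{1..N}. 1)"
      using r by (intro sum.cong refl) (metis less_irrefl powr_zero_eq_one)
    then show ?thesis using N by simp
  qed
  moreover have "continuous_on {0..t} (\<lambda>t. \<Sum>i\<in>{1..N}. r i powr t)"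
    using r by (intro continuous_intros) force
  ultimately show ?thesis
    using IVT2'[of "\<lambda>t. \<Sum>i\<in>{1..N}. r i powr t" t 1 0] \<open>0 \<le> t\<close> by blast
qed

text \<open>The numbers \<open>r i powr \<delta>\<close> are probability weights; everything below is averaging with respect
  to these weights.\<close>

locale self_similar_set =
  fixes N :: nat and \<phi> :: "nat \<Rightarrow> real^'n \<Rightarrow> real^'n" and r :: "nat \<Rightarrow> real"
    and K :: "(real^'n) set" and \<delta> :: real
  assumes two_maps: "N \<ge> 2"
    and similarity: "\<And>i. i \<in> {1..N} \<Longrightarrow> contracting_similarity (r i) (\<phi> i)"
    and invariant: "invariant_set N \<phi> K"
    and separated: "strong_separation N \<phi> K"
    and moran: "(\<Sum>i\<in>{1..N}. r i powr \<delta>) = 1"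
begin

lemma ratio_pos: "i \<in> {1..N} \<Longrightarrow> 0 < r i"
  and ratio_less_1: "i \<in> {1..N} \<Longrightarrow> r i < 1"
  and dist_similarity: "i \<in> {1..N} \<Longrightarrow> dist (\<phi> i x) (\<phi> i y) = r i * dist x y"
  using similarity by (auto simp: contracting_similarity_def)

lemmas invariantD = invariant[unfolded invariant_set_def]
lemmas K_nonempty = conjunct1[OF invariantD]
lemmas compact_K = conjunct1[OF conjunct2[OF invariantD]]
lemmas K_union = conjunct2[OF conjunct2[OF invariantD]]

lemma image_K_subset: "i \<in> {1..N} \<Longrightarrow> x \<in> K \<Longrightarrow> \<phi> i x \<in> K"
  by (subst K_union) (rule UN_I, assumption, rule imageI)

lemma continuous_similarity: "i \<in> {1..N} \<Longrightarrow> continuous_on S (\<phi> i)"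
  using dist_similarity ratio_pos by (intro lipschitz_on_continuous_on[of "r i"] lipschitz_onI) (auto simp: less_imp_le)

lemma inj_similarity: "i \<in> {1..N} \<Longrightarrow> inj (\<phi> i)"
proof (rule injI)
  fix x y assume i: "i \<in> {1..N}" and "\<phi> i x = \<phi> i y"
  then have "r i * dist x y = 0" using dist_similarity[OF i, of x y] by simp
  then show "x = y" using ratio_pos[OF i] by simp
qed

text \<open>Removing the translation and the ratio leaves an isometry fixing the origin, and such a map is
  orthogonal. This makes the similarities differentiable and surjective.\<close>

lemma similarity_affine:
  assumes i: "i \<in> {1..N}"
  obtains R where "orthogonal_transformation R" "\<And>x. \<phi> i x = \<phi> i 0 + r i *\<^sub>R R x"
proof -
  define R where "R x = (1 / r i) *\<^sub>R (\<phi> i x - \<phi> i 0)" for x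
  have "dist (R x) (R y) = dist x y" for x y
  proof -
    have "R x - R y = (1 / r i) *\<^sub>R (\<phi> i x - \<phi> i y)" by (simp add: R_def scaleR_diff_right)
    then have "dist (R x) (R y) = (1 / r i) * dist (\<phi> i x) (\<phi> i y)"
      using ratio_pos[OF i] by (simp add: dist_norm)
    then show ?thesis using dist_similarity[OF i] ratio_pos[OF i] by simp
  qed
  then have "orthogonal_transformation R"
    unfolding orthogonal_transformation_isometry by (simp add: R_def)
  moreover have "\<phi> i x = \<phi> i 0 + r i *\<^sub>R R x" for x
    using ratio_pos[OF i] by (simp add: R_def)
  ultimately show thesis by (rule that)
qed

lemma surj_similarity:
  assumes i: "i \<in> {1..N}" shows "surj (\<phi> i)"
proof -
  obtain R where R: "orthogonal_transformation R" "\<And>x. \<phi> i x = \<phi> i 0 + r i *\<^sub>R R x"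
    using similarity_affine[OF i] by blast
  show ?thesis
  proof (rule surjI)
    fix y
    obtain x where "R x = (1 / r i) *\<^sub>R (y - \<phi> i 0)"
      using orthogonal_transformation_surj[OF R(1)] by (metis surjD)
    then have "\<phi> i x = y" using R(2)[of x] ratio_pos[OF i] by simp
    then show "\<phi> i (SOME x. \<phi> i x = y) = y" by (rule someI)
  qed
qed

lemma integral_similarity_image:
  assumes i: "i \<in> {1..N}" and S: "S \<in> sets borel" "\<phi> i ` S \<in> sets borel" "emeasure lborel (\<phi> i ` S) < \<infinity>"
    and h: "bounded_borel h"
  shows "(LINT y:\<phi> i ` S|lborel. h y) = (LINT x:S|lborel. r i ^ CARD('n) * h (\<phi> i x))"
proof -
  obtain R where R: "orthogonal_transformation R" "\<And>x. \<phi> i x = \<phi> i 0 + r i *\<^sub>R R x"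
    using similarity_affine[OF i] by blast
  have lin: "bounded_linear R" using R(1) by (simp add: orthogonal_transformation_linear linear_conv_bounded_linear[symmetric])
  have \<phi>_eq: "\<phi> i = (\<lambda>x. \<phi> i 0 + r i *\<^sub>R R x)" using R(2) by (rule ext)
  obtain B where B: "B > 0" "\<And>x. \<bar>h x\<bar> \<le> B" using h by (rule bounded_borelE) blast
  note [measurable] = bounded_borel_measurable[OF h] S(1,2)
  have [measurable]: "\<phi> i \<in> borel_measurable borel"
    by (rule borel_measurable_continuous_onI[OF continuous_similarity[OF i]])
  show ?thesis
  proof (rule conformal_change_of_variables[where g' = "\<lambda>x v. r i *\<^sub>R R v"])
    show "(\<phi> i has_derivative (\<lambda>v. r i *\<^sub>R R v)) (at x)" for x
      by (subst \<phi>_eq) (auto intro!: derivative_eq_intros bounded_linear_imp_has_derivative lin)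
    show "inj_on (\<phi> i) S" using inj_similarity[OF i] by (rule inj_on_subset) simp
    show "norm (r i *\<^sub>R R v) = r i * norm v" for v
      using R(1) ratio_pos[OF i] by (simp add: orthogonal_transformation_norm)
    show "set_integrable lborel (\<phi> i ` S) h"
      unfolding set_integrable_def
    proof (rule Bochner_Integration.integrable_bound)
      show "integrable lborel (\<lambda>x. indicator (\<phi> i ` S) x *\<^sub>R B)"
        using S by (intro integrable_scaleR_left) (auto simp: integrable_indicator_iff)
      show "AE x in lborel. norm (indicator (\<phi> i ` S) x *\<^sub>R h x) \<le> norm (indicator (\<phi> i ` S) x *\<^sub>R B)"
        using B by (intro AE_I2) (auto simp: indicator_def)
    qed measurable
    show "set_borel_measurable borel S (\<lambda>x. r i ^ CARD('n) * h (\<phi> i x))"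
      unfolding set_borel_measurable_def by measurable
  qed (use S ratio_pos[OF i] in auto)
qed

lemma infdist_similarity_image:
  assumes i: "i \<in> {1..N}"
  shows "infdist (\<phi> i x) (\<phi> i ` K) \<le> \<epsilon> \<longleftrightarrow> infdist x K \<le> \<epsilon> / r i"
proof -
  have "compact (\<phi> i ` K)" by (intro compact_continuous_image continuous_similarity i compact_K)
  then have "infdist (\<phi> i x) (\<phi> i ` K) \<le> \<epsilon> \<longleftrightarrow> (\<exists>y\<in>K. r i * dist x y \<le> \<epsilon>)"
    using K_nonempty by (simp add: infdist_le_iff_near_point dist_similarity[OF i])
  also have "\<dots> \<longleftrightarrow> (\<exists>y\<in>K. dist x y \<le> \<epsilon> / r i)"
    using ratio_pos[OF i] by (simp add: pos_le_divide_eq mult.commute)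
  finally show ?thesis unfolding infdist_le_iff_near_point[OF compact_K K_nonempty] .
qed

lemma sublevel_similarity_image:
  assumes i: "i \<in> {1..N}"
  shows "{y. infdist y (\<phi> i ` K) \<le> \<epsilon>} = \<phi> i ` {x. infdist x K \<le> \<epsilon> / r i}"
proof (intro subset_antisym subsetI)
  fix y assume y: "y \<in> {y. infdist y (\<phi> i ` K) \<le> \<epsilon>}"
  obtain x where "y = \<phi> i x" using surj_similarity[OF i] by (rule surjE)
  then show "y \<in> \<phi> i ` {x. infdist x K \<le> \<epsilon> / r i}"
    using y infdist_similarity_image[OF i] by auto
qed (use infdist_similarity_image[OF i] in auto)

lemma compact_image_K: "i \<in> {1..N} \<Longrightarrow> compact (\<phi> i ` K)"
  by (intro compact_continuous_image continuous_similarity compact_K)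

lemma separation_distance:
  obtains e where "0 < e" "e \<le> 1" 
    "\<And>i j x. i \<in> {1..N} \<Longrightarrow> j \<in> {1..N} \<Longrightarrow> infdist x (\<phi> i ` K) \<le> e \<Longrightarrow> infdist x (\<phi> j ` K) \<le> e \<Longrightarrow> i = j"
proof -
  have "\<exists>d>0. \<forall>x\<in>\<phi> i ` K. \<forall>y\<in>\<phi> j ` K. d \<le> dist x y" if "i \<in> {1..N}" "j \<in> {1..N}" "i \<noteq> j" for i j
    using that separated unfolding strong_separation_def
    by (intro separate_compact_closed compact_image_K compact_imp_closed) auto
  then obtain d where d: "\<And>i j. i \<in> {1..N} \<Longrightarrow> j \<in> {1..N} \<Longrightarrow> i \<noteq> j \<Longrightarrow> 0 < d i j"
      "\<And>i j x y. i \<in> {1..N} \<Longrightarrow> j \<in> {1..N} \<Longrightarrow> i \<noteq> j \<Longrightarrow> x \<in> \<phi> i ` K \<Longrightarrow> y \<in> \<phi> j ` K \<Longrightarrow> d i j \<le> dist x y"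
    by metis
  \<comment> \<open>the element 1 keeps the minimum at most one, so that the separation radius can serve as a radius in \<open>(0, 1]\<close>\<close>
  define D where "D = insert 1 ((\<lambda>(i, j). d i j) ` {(i, j). i \<in> {1..N} \<and> j \<in> {1..N} \<and> i \<noteq> j})"
  have fin: "finite D" unfolding D_def
    by (intro finite.insertI finite_imageI, rule finite_subset[of _ "{1..N} \<times> {1..N}"]) auto
  have pos: "0 < Min D" using fin d(1) by (subst Min_gr_iff) (auto simp: D_def)
  show thesis
  proof (rule that)
    \<comment> \<open>two points within a third of the minimal distance of a common point would be too close\<close>
    show "0 < Min D / 3" using pos by simp
    have "Min D \<le> 1" using fin by (intro Min_le) (auto simp: D_def)
    then show "Min D / 3 \<le> 1" by simp
    fix i j x assume ij: "i \<in> {1..N}" "j \<in> {1..N}"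
      and le: "infdist x (\<phi> i ` K) \<le> Min D / 3" "infdist x (\<phi> j ` K) \<le> Min D / 3"
    have ne: "\<phi> k ` K \<noteq> {}" for k using K_nonempty by simp
    obtain y z where yz: "y \<in> \<phi> i ` K" "dist x y \<le> Min D / 3" "z \<in> \<phi> j ` K" "dist x z \<le> Min D / 3"
      using le infdist_le_iff_near_point[OF compact_image_K[OF ij(1)] ne]
        infdist_le_iff_near_point[OF compact_image_K[OF ij(2)] ne] by metis
    show "i = j"
    proof (rule ccontr)
      assume "i \<noteq> j"
      then have "Min D \<le> d i j" using ij fin by (intro Min_le) (auto simp: D_def)
      also have "d i j \<le> dist y z" using d(2) ij yz \<open>i \<noteq> j\<close> by blast
      also have "\<dots> \<le> dist x y + dist x z" by (metis dist_commute dist_triangle)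
      finally show False using yz pos by linarith
    qed
  qed
qed

definition sep :: real where
  "sep = (SOME e. 0 < e \<and> e \<le> 1 \<and> (\<forall>i\<in>{1..N}. \<forall>j\<in>{1..N}. \<forall>x. infdist x (\<phi> i ` K) \<le> e \<longrightarrow>
     infdist x (\<phi> j ` K) \<le> e \<longrightarrow> i = j))"

lemma sep: "0 < sep" "sep \<le> 1"
  "\<And>i j x. i \<in> {1..N} \<Longrightarrow> j \<in> {1..N} \<Longrightarrow> infdist x (\<phi> i ` K) \<le> sep \<Longrightarrow> infdist x (\<phi> j ` K) \<le> sep \<Longrightarrow> i = j"
proof -
  have "\<exists>e. 0 < e \<and> e \<le> 1 \<and> (\<forall>i\<in>{1..N}. \<forall>j\<in>{1..N}. \<forall>x. infdist x (\<phi> i ` K) \<le> e \<longrightarrow>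
     infdist x (\<phi> j ` K) \<le> e \<longrightarrow> i = j)"
    using separation_distance by metis
  from someI_ex[OF this, folded sep_def]
  show "0 < sep" "sep \<le> 1"
    "\<And>i j x. i \<in> {1..N} \<Longrightarrow> j \<in> {1..N} \<Longrightarrow> infdist x (\<phi> i ` K) \<le> sep \<Longrightarrow> infdist x (\<phi> j ` K) \<le> sep \<Longrightarrow> i = j"
    by blast+
qed

lemma indicator_sublevel_decompose:
  assumes "\<epsilon> \<le> sep"
  shows "indicator {x. infdist x K \<le> \<epsilon>} x = (\<Sum>i\<in>{1..N}. indicator {x. infdist x (\<phi> i ` K) \<le> \<epsilon>} x :: real)"
proof (cases "infdist x K \<le> \<epsilon>")
  case True
  then obtain y where "y \<in> K" "dist x y \<le> \<epsilon>" using compact_K K_nonempty by (auto simp: infdist_le_iff_near_point)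
  then obtain i where i: "i \<in> {1..N}" "infdist x (\<phi> i ` K) \<le> \<epsilon>"
    using K_union infdist_le2 by (metis UN_E)
  have "indicator {x. infdist x (\<phi> j ` K) \<le> \<epsilon>} x = (if j = i then 1 else 0 :: real)" if "j \<in> {1..N}" for j
  proof (cases "j = i")
    case False
    then have "\<not> infdist x (\<phi> j ` K) \<le> \<epsilon>"
      using sep(3)[OF that i(1)] i(2) assms by (meson order_trans)
    then show ?thesis using False by simp
  qed (use i(2) in simp)
  then have "(\<Sum>j\<in>{1..N}. indicator {x. infdist x (\<phi> j ` K) \<le> \<epsilon>} x :: real) = (\<Sum>j\<in>{1..N}. if j = i then 1 else 0)"
    by (rule sum.cong[OF refl])
  then show ?thesis using True i(1) by simp
next
  case False
  have "infdist x K \<le> infdist x (\<phi> i ` K)" if "i \<in> {1..N}" for i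
    using that image_K_subset K_nonempty by (intro infdist_mono) auto
  then have "\<not> infdist x (\<phi> i ` K) \<le> \<epsilon>" if "i \<in> {1..N}" for i using that False by force
  then show ?thesis using False by simp
qed

lemma bounded_borel_comp_similarity: "i \<in> {1..N} \<Longrightarrow> bounded_borel h \<Longrightarrow> bounded_borel (\<lambda>x. h (\<phi> i x))"
proof -
  assume i: "i \<in> {1..N}" and h: "bounded_borel h"
  obtain B where B: "B > 0" "\<And>x. \<bar>h x\<bar> \<le> B" using h by (rule bounded_borelE) blast
  have "(\<lambda>x. h (\<phi> i x)) \<in> borel_measurable borel"
    by (rule measurable_compose[OF borel_measurable_continuous_onI[OF continuous_similarity[OF i]]
          bounded_borel_measurable[OF h]])
  then show "bounded_borel (\<lambda>x. h (\<phi> i x))" using B(2) by (rule bounded_borelI)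
qed

text \<open>Below the separation radius the neighbourhood of \<open>K\<close> is the disjoint union of those of the
  pieces, and the neighbourhood of the piece \<open>\<phi> i ` K\<close> is the image under \<open>\<phi> i\<close> of the
  neighbourhood of \<open>K\<close> with radius \<open>\<epsilon> / r i\<close>. The factor \<open>r i ^ d\<close> from the substitution and
  the normalising power combine to \<open>r i powr \<delta>\<close>.\<close>

lemma nbhd_integral_functional_equation:
  assumes h: "bounded_borel h" and \<epsilon>: "0 < \<epsilon>" "\<epsilon> \<le> sep"
  shows "nbhd_integral K \<delta> h \<epsilon> = (\<Sum>i\<in>{1..N}. r i powr \<delta> * nbhd_integral K \<delta> (\<lambda>x. h (\<phi> i x)) (\<epsilon> / r i))"
proof -
  have part: "(\<integral>x. indicator {x. infdist x (\<phi> i ` K) \<le> \<epsilon>} x * h x \<partial>lborel)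
      = r i ^ CARD('n) * (\<integral>x. indicator {x. infdist x K \<le> \<epsilon> / r i} x * h (\<phi> i x) \<partial>lborel)" if i: "i \<in> {1..N}" for i
  proof -
    let ?S = "{x. infdist x K \<le> \<epsilon> / r i}"
    have "proper_gauge (\<lambda>x. infdist x (\<phi> i ` K))"
      using compact_image_K[OF i] K_nonempty by (intro proper_gauge_infdist) auto
    then have "\<phi> i ` ?S \<in> sets borel" "emeasure lborel (\<phi> i ` ?S) < \<infinity>"
      unfolding sublevel_similarity_image[OF i, symmetric] by (auto simp: proper_gauge_def intro: sublevel_sets)
    moreover have "?S \<in> sets borel"
      by (rule sublevel_sets[OF proper_gauge_infdist[OF compact_K K_nonempty]])
    ultimately have "(LINT y:\<phi> i ` ?S|lborel. h y) = (LINT x:?S|lborel. r i ^ CARD('n) * h (\<phi> i x))"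
      using i h by (intro integral_similarity_image)
    then show ?thesis
      unfolding sublevel_similarity_image[OF i] set_lebesgue_integral_def
      by (simp add: mult.left_commute[of _ "r i ^ CARD('n)"])
  qed
  have int: "integrable lborel (\<lambda>x. indicator {x. infdist x (\<phi> i ` K) \<le> \<epsilon>} x * h x)" if "i \<in> {1..N}" for i
    using compact_image_K[OF that] K_nonempty by (intro integrable_sublevel proper_gauge_infdist h) auto
  have scale: "\<epsilon> powr (\<delta> - real CARD('n)) * r i ^ CARD('n) = r i powr \<delta> * (\<epsilon> / r i) powr (\<delta> - real CARD('n))"
    if "i \<in> {1..N}" for i
    using ratio_pos[OF that] \<epsilon> by (simp add: powr_divide powr_diff powr_realpow field_simps)
  have "nbhd_integral K \<delta> h \<epsilon>
      = \<epsilon> powr (\<delta> - real CARD('n)) * (\<integral>x. (\<Sum>i\<in>{1..N}. indicator {x. infdist x (\<phi> i ` K) \<le> \<epsilon>} x * h x) \<partial>lborel)"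
    unfolding sublevel_integral_def indicator_sublevel_decompose[OF \<epsilon>(2)] by (simp add: sum_distrib_right)
  also have "\<dots> = \<epsilon> powr (\<delta> - real CARD('n)) *
      (\<Sum>i\<in>{1..N}. r i ^ CARD('n) * (\<integral>x. indicator {x. infdist x K \<le> \<epsilon> / r i} x * h (\<phi> i x) \<partial>lborel))"
    by (subst Bochner_Integration.integral_sum) (simp_all only: int part cong: sum.cong)
  also have "\<dots> = (\<Sum>i\<in>{1..N}. r i powr \<delta> * nbhd_integral K \<delta> (\<lambda>x. h (\<phi> i x)) (\<epsilon> / r i))"
    unfolding sum_distrib_left mult.assoc[symmetric] sublevel_integral_def
    by (intro sum.cong refl) (simp add: scale mult.assoc)
  finally show ?thesis .
qed

lemma max_ratio:
  obtains \<rho> where "0 < \<rho>" "\<rho> < 1" "\<And>i. i \<in> {1..N} \<Longrightarrow> r i \<le> \<rho>"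
proof
  have ne: "r ` {1..N} \<noteq> {}" using two_maps by simp
  show "0 < Max (r ` {1..N})" "Max (r ` {1..N}) < 1" "\<And>i. i \<in> {1..N} \<Longrightarrow> r i \<le> Max (r ` {1..N})"
    using ratio_pos ratio_less_1 Max_in[OF _ ne] by auto
qed

text \<open>The equation expresses a value at \<open>\<epsilon>\<close> as a convex combination of values at the larger radii
  \<open>\<epsilon> / r i\<close>, so bounds propagate downwards, each step reaching radii smaller by the factor of the
  largest ratio. Used for the rescaled volume and again for its logarithmic integral.\<close>

lemma renewal_bounds:
  assumes J: "\<And>\<epsilon>. 0 < \<epsilon> \<Longrightarrow> \<epsilon> \<le> sep \<Longrightarrow> J \<epsilon> = (\<Sum>i\<in>{1..N}. r i powr \<delta> * J (\<epsilon> / r i))"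
    and b: "\<And>i. i \<in> {1..N} \<Longrightarrow> sep / r i \<le> b"
    and bounds: "\<And>\<epsilon>. sep \<le> \<epsilon> \<Longrightarrow> \<epsilon> \<le> b \<Longrightarrow> L \<le> J \<epsilon> \<and> J \<epsilon> \<le> (B :: real)"
    and \<epsilon>: "0 < \<epsilon>" "\<epsilon> \<le> b"
  shows "L \<le> J \<epsilon> \<and> J \<epsilon> \<le> B"
proof -
  obtain \<rho> where \<rho>: "0 < \<rho>" "\<rho> < 1" "\<And>i. i \<in> {1..N} \<Longrightarrow> r i \<le> \<rho>" by (rule max_ratio) blast
  have "L \<le> J \<epsilon> \<and> J \<epsilon> \<le> B" if "sep * \<rho> ^ n \<le> \<epsilon>" "\<epsilon> \<le> b" for n \<epsilon>
    using that
  proof (induction n arbitrary: \<epsilon>)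
    case 0
    then show ?case using bounds by simp
  next
    case (Suc n)
    show ?case
    proof (cases "sep \<le> \<epsilon>")
      case True
      then show ?thesis using bounds Suc.prems by simp
    next
      case False
      have pos: "0 < \<epsilon>" using Suc.prems(1) \<rho>(1) sep(1) by (meson less_le_trans mult_pos_pos zero_less_power)
      have J_i: "L \<le> J (\<epsilon> / r i) \<and> J (\<epsilon> / r i) \<le> B" if i: "i \<in> {1..N}" for i
      proof (rule Suc.IH)
        have "sep * \<rho> ^ n * \<rho> \<le> \<epsilon>" using Suc.prems(1) by (simp add: mult_ac)
        then have "sep * \<rho> ^ n \<le> \<epsilon> / \<rho>" using \<rho>(1) by (simp add: pos_le_divide_eq)
        also have "\<dots> \<le> \<epsilon> / r i" using \<rho>(3)[OF i] ratio_pos[OF i] pos by (intro divide_left_mono) auto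
        finally show "sep * \<rho> ^ n \<le> \<epsilon> / r i" .
        have "\<epsilon> / r i \<le> sep / r i" using False ratio_pos[OF i] by (intro divide_right_mono) auto
        then show "\<epsilon> / r i \<le> b" using b[OF i] by linarith
      qed
      have Jeq: "J \<epsilon> = (\<Sum>i\<in>{1..N}. r i powr \<delta> * J (\<epsilon> / r i))" using J pos False by simp
      have "(\<Sum>i\<in>{1..N}. r i powr \<delta> * L) \<le> J \<epsilon>" "J \<epsilon> \<le> (\<Sum>i\<in>{1..N}. r i powr \<delta> * B)"
        unfolding Jeq using J_i by (auto intro!: sum_mono mult_left_mono)
      then show ?thesis using moran by (simp add: sum_distrib_right[symmetric])
    qed
  qed
  moreover obtain n where "\<rho> ^ n < \<epsilon> / sep"
    using real_arch_pow_inv[of "\<epsilon> / sep" \<rho>] \<epsilon> sep(1) \<rho> by auto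
  then have "sep * \<rho> ^ n \<le> \<epsilon>" using sep(1) by (simp add: field_simps)
  ultimately show ?thesis using \<epsilon>(2) by blast
qed

text \<open>One application of the functional equation at a radius up to \<open>sep\<close> only looks at radii up to
  \<open>outer\<close>.\<close>

definition outer :: real where "outer = Max (insert 1 ((\<lambda>i. sep / r i) ` {1..N}))"

lemma outer: "1 \<le> outer" "i \<in> {1..N} \<Longrightarrow> sep / r i \<le> outer"
proof -
  show "1 \<le> outer" unfolding outer_def by (rule Max_ge) auto
  show "sep / r i \<le> outer" if "i \<in> {1..N}"
    unfolding outer_def by (rule Max_ge) (use that in \<open>auto simp del: atLeastAtMost_iff\<close>)
qed

lemma regular: "minkowski_regular K \<delta>"
proof -
  obtain c C where cC: "0 < c" "\<And>\<epsilon>. sep \<le> \<epsilon> \<Longrightarrow> \<epsilon> \<le> outer \<Longrightarrow>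
      c \<le> nbhd_integral K \<delta> (\<lambda>_. 1) \<epsilon> \<and> nbhd_integral K \<delta> (\<lambda>_. 1) \<epsilon> \<le> C"
    using nbhd_integral_one_bounds[OF compact_K K_nonempty sep(1)] by metis
  have "c \<le> nbhd_integral K \<delta> (\<lambda>_. 1) \<epsilon> \<and> nbhd_integral K \<delta> (\<lambda>_. 1) \<epsilon> \<le> C" if "0 < \<epsilon>" "\<epsilon> \<le> outer" for \<epsilon>
    by (rule renewal_bounds[OF _ _ cC(2) that])
       (use nbhd_integral_functional_equation[OF bounded_borel_const] outer(2) in auto)
  then show ?thesis
    using cC(1) outer(1) by (intro minkowski_regularI[OF compact_K K_nonempty, of outer]) auto
qed

lemma tame_nbhd_integral: "bounded_borel h \<Longrightarrow> tame (nbhd_integral K \<delta> h)"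
  by (rule minkowski_regular_tame[OF compact_K K_nonempty regular])

text \<open>Integrating the functional equation of the rescaled volume \<open>v\<close> shows that \<open>I T\<close>, the
  logarithmic integral of \<open>v\<close> from \<open>T\<close> upwards, satisfies the same equation up to an additive
  constant \<open>c\<close>. Adding \<open>\<beta> * ln T\<close> with \<open>\<beta> = c / H\<close> removes the constant, where \<open>H\<close> is
  the weighted mean of \<open>- ln (r i)\<close>. The corrected function \<open>J\<close> is then bounded, so
  \<open>I T = - \<beta> * ln T + O(1)\<close>, which says that the logarithmic means converge to \<open>\<beta>\<close>. Only means
  are asserted to converge, which is why this works for all ratios, commensurable or not.\<close>

lemma log_mean_volume_converges:
  obtains M where "0 \<le> M" "(log_mean (nbhd_integral K \<delta> (\<lambda>_. 1)) \<longlongrightarrow> M) (at_right 0)"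
proof -
  define v where "v = nbhd_integral K \<delta> (\<lambda>_. 1)"
  have tame: "tame v" unfolding v_def by (intro tame_nbhd_integral bounded_borel_const)
  define I where "I T = log_integral v T outer" for T
  define c where "c = I sep - (\<Sum>i\<in>{1..N}. r i powr \<delta> * I (sep / r i))"
  define H where "H = - (\<Sum>i\<in>{1..N}. r i powr \<delta> * ln (r i))"
  have Hpos: "0 < H"
    unfolding H_def sum_negf[symmetric]
  proof (intro sum_pos)
    fix i assume i: "i \<in> {1..N}"
    show "0 < - (r i powr \<delta> * ln (r i))"
      using ratio_pos[OF i] ratio_less_1[OF i] by (simp add: mult_less_0_iff)
  qed (use two_maps in auto)
  define \<beta> where "\<beta> = c / H"
  define J where "J T = I T + \<beta> * ln T" for T
  have combine: "log_integral v a b + I b = I a" if "0 < a" "a \<le> b" "b \<le> outer" for a b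
    unfolding I_def using that by (intro log_integral_combine tame)
  have I_renewal: "I T = (\<Sum>i\<in>{1..N}. r i powr \<delta> * I (T / r i)) + c" if T: "0 < T" "T \<le> sep" for T
  proof -
    have "log_integral v T sep = log_integral (\<lambda>\<epsilon>. \<Sum>i\<in>{1..N}. r i powr \<delta> * v (1 / r i * \<epsilon>)) T sep"
      using nbhd_integral_functional_equation[OF bounded_borel_const[of 1]] T
      by (intro log_integral_cong) (simp add: v_def)
    also have "\<dots> = (\<Sum>i\<in>{1..N}. r i powr \<delta> * log_integral v (T / r i) (sep / r i))"
      using T ratio_pos
      by (subst log_integral_sum)
         (auto intro!: tame_cmult tame_scale[of _ "1 / r _", simplified] tame sum.cong
           simp: log_integral_cmult log_integral_scale[of "1 / r _", simplified])
    also have "\<dots> = (\<Sum>i\<in>{1..N}. r i powr \<delta> * (I (T / r i) - I (sep / r i)))"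
    proof (intro sum.cong refl)
      fix i assume i: "i \<in> {1..N}"
      have "log_integral v (T / r i) (sep / r i) + I (sep / r i) = I (T / r i)"
        using T ratio_pos[OF i] outer(2)[OF i] by (intro combine divide_right_mono) auto
      then show "r i powr \<delta> * log_integral v (T / r i) (sep / r i) = r i powr \<delta> * (I (T / r i) - I (sep / r i))"
        by simp
    qed
    finally show ?thesis
      using combine[of T sep] T sep(2) outer(1)
      by (simp add: c_def right_diff_distrib sum_subtractf)
  qed
  have J_renewal: "J T = (\<Sum>i\<in>{1..N}. r i powr \<delta> * J (T / r i))" if T: "0 < T" "T \<le> sep" for T
  proof -
    have "(\<Sum>i\<in>{1..N}. r i powr \<delta> * J (T / r i))
      = (\<Sum>i\<in>{1..N}. r i powr \<delta> * I (T / r i) + \<beta> * (r i powr \<delta> * ln T) - \<beta> * (r i powr \<delta> * ln (r i)))"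
      using T ratio_pos by (intro sum.cong refl) (auto simp: J_def ln_div algebra_simps)
    also have "\<dots> = (\<Sum>i\<in>{1..N}. r i powr \<delta> * I (T / r i)) + \<beta> * ((\<Sum>i\<in>{1..N}. r i powr \<delta>) * ln T) + \<beta> * H"
      by (simp add: sum_subtractf sum.distrib sum_distrib_left[symmetric] sum_distrib_right[symmetric] H_def)
    also have "\<dots> = J T" using I_renewal[OF T] moran Hpos by (simp add: J_def \<beta>_def)
    finally show ?thesis by simp
  qed
  obtain C where C: "C > 0" "\<And>\<epsilon>. 0 < \<epsilon> \<Longrightarrow> \<epsilon> \<le> outer \<Longrightarrow> \<bar>v \<epsilon>\<bar> \<le> C"
    using tame_bounded[OF tame, of outer] outer(1) by auto
  define B where "B = C * (ln outer - ln sep) + \<bar>\<beta>\<bar> * (\<bar>ln sep\<bar> + \<bar>ln outer\<bar>)"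
  have J_base: "- B \<le> J T \<and> J T \<le> B" if T: "sep \<le> T" "T \<le> outer" for T
  proof -
    have T0: "0 < T" using T sep(1) by linarith
    have "\<bar>I T\<bar> \<le> C * (ln outer - ln T)"
      unfolding I_def using T T0 C(2) by (intro log_integral_abs_le tame) auto
    also have "\<dots> \<le> C * (ln outer - ln sep)" using T T0 sep(1) C(1) by (intro mult_left_mono) auto
    finally have "\<bar>I T\<bar> \<le> C * (ln outer - ln sep)" .
    moreover have "ln sep \<le> ln T" "ln T \<le> ln outer" using T T0 sep(1) by auto
    then have "\<bar>ln T\<bar> \<le> \<bar>ln sep\<bar> + \<bar>ln outer\<bar>" by linarith
    then have "\<bar>\<beta> * ln T\<bar> \<le> \<bar>\<beta>\<bar> * (\<bar>ln sep\<bar> + \<bar>ln outer\<bar>)"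
      unfolding abs_mult by (rule mult_left_mono) simp
    ultimately show ?thesis unfolding J_def B_def by linarith
  qed
  have J_bound: "\<bar>J T\<bar> \<le> B" if "0 < T" "T \<le> outer" for T
    using renewal_bounds[OF J_renewal outer(2) J_base that] by (auto simp: abs_le_iff)
  have "((\<lambda>T. inverse \<bar>ln T\<bar> * (J T - I 1) + \<beta>) \<longlongrightarrow> 0 + \<beta>) (at_right 0)"
    by (intro tendsto_add tendsto_const log_mean_bounded_remainder[where e=1 and C = "B + \<bar>I 1\<bar>"])
       (use J_bound outer(1) in \<open>force+\<close>)
  moreover have "\<forall>\<^sub>F T in at_right 0. inverse \<bar>ln T\<bar> * (J T - I 1) + \<beta> = log_mean v T"
    using eventually_at_right_0_less[OF zero_less_one]
  proof eventually_elim
    case (elim T)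
    have "log_integral v T 1 = J T - I 1 - \<beta> * ln T"
      using combine[of T 1] outer(1) elim by (simp add: J_def)
    moreover have "inverse \<bar>ln T\<bar> * (\<beta> * ln T) = - \<beta>" using elim by simp
    ultimately show ?case by (simp add: log_mean_def right_diff_distrib)
  qed
  ultimately have lim: "(log_mean v \<longlongrightarrow> \<beta>) (at_right 0)"
    using Lim_transform_eventually by fastforce
  \<comment> \<open>\<open>\<beta>\<close> is a limit of means of a nonnegative function\<close>
  have "0 \<le> \<beta>"
  proof (rule tendsto_lowerbound[OF lim])
    show "\<forall>\<^sub>F T in at_right 0. 0 \<le> log_mean v T"
      using eventually_at_right_0_less[OF zero_less_one]
    proof eventually_elim
      case (elim T)
      have "log_integral (\<lambda>_. 0) T 1 \<le> log_integral v T 1"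
        using elim by (intro log_integral_mono tame tame_const) (auto simp: v_def sublevel_integral_def)
      then show ?case by (simp add: log_mean_def log_integral_def)
    qed
  qed simp
  then show thesis using that lim by (simp add: v_def)
qed

end

section \<open>The invariant measure and the average content\<close>

context self_similar_set
begin

definition letters :: "nat measure" where
  "letters = point_measure {1..N} (\<lambda>i. ennreal (r i powr \<delta>))"

definition base_point :: "real^'n" where "base_point = (SOME x. x \<in> K)"

text \<open>A sequence of indices is the address of a point of \<open>K\<close>: compose the similarities along the first
  \<open>n\<close> indices and let \<open>n\<close> tend to infinity.\<close>

primrec approximant :: "nat \<Rightarrow> nat stream \<Rightarrow> real^'n" where
  "approximant 0 s = base_point"
| "approximant (Suc n) s = \<phi> (shd s) (approximant n (stl s))"

definition coding :: "nat stream \<Rightarrow> real^'n" where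
  "coding s = lim (\<lambda>n. approximant n s)"

lemma base_point: "base_point \<in> K"
  using K_nonempty by (simp add: base_point_def some_in_eq)

lemma prob_space_letters: "prob_space letters"
proof
  have "emeasure letters (space letters) = (\<Sum>i\<in>{1..N}. ennreal (r i powr \<delta>))"
    by (simp add: letters_def space_point_measure emeasure_point_measure_finite)
  also have "\<dots> = ennreal (\<Sum>i\<in>{1..N}. r i powr \<delta>)" by (rule sum_ennreal) simp
  finally show "emeasure letters (space letters) = 1" using moran by simp
qed

lemma space_letters [simp]: "space letters = {1..N}"
  by (simp add: letters_def space_point_measure)

lemma sets_letters: "sets letters = sets (count_space {1..N})"
  by (simp add: letters_def sets_point_measure)

lemma streams_step: "s \<in> streams {1..N} \<Longrightarrow> shd s \<in> {1..N} \<and> stl s \<in> streams {1..N}"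
  by (metis stream.collapse streams_Stream)

lemma approximant_in_K: "s \<in> streams {1..N} \<Longrightarrow> approximant n s \<in> K"
proof (induction n arbitrary: s)
  case (Suc n)
  then show ?case using streams_step[OF Suc.prems] by (auto intro!: image_K_subset simp del: atLeastAtMost_iff)
qed (simp add: base_point)

lemma approximant_converges:
  assumes s: "s \<in> streams {1..N}"
  shows "(\<lambda>n. approximant n s) \<longlonglongrightarrow> coding s"
proof -
  obtain \<rho> where \<rho>: "0 < \<rho>" "\<rho> < 1" "\<And>i. i \<in> {1..N} \<Longrightarrow> r i \<le> \<rho>" by (rule max_ratio) blast
  have step: "dist (approximant n s) (approximant (Suc n) s) \<le> diameter K * \<rho> ^ n" if "s \<in> streams {1..N}" for n s
    using that
  proof (induction n arbitrary: s)
    case 0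
    then show ?case
      using diameter_bounded_bound[OF compact_imp_bounded[OF compact_K] approximant_in_K approximant_in_K, of s s 0 1]
      by simp
  next
    case (Suc n)
    have s: "shd s \<in> {1..N}" "stl s \<in> streams {1..N}" using streams_step[OF Suc.prems] by auto
    have "dist (approximant (Suc n) s) (approximant (Suc (Suc n)) s)
        = r (shd s) * dist (approximant n (stl s)) (approximant (Suc n) (stl s))"
      using dist_similarity[OF s(1)] by simp
    also have "\<dots> \<le> \<rho> * (diameter K * \<rho> ^ n)"
      using \<rho>(1) \<rho>(3)[OF s(1)] Suc.IH[OF s(2)] by (intro mult_mono) auto
    finally show ?case by (simp add: mult_ac)
  qed
  have "summable (\<lambda>n. diameter K * \<rho> ^ n)"
    using \<rho> by (intro summable_mult summable_geometric) auto
  then have "summable (\<lambda>n. approximant (Suc n) s - approximant n s)"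
    by (rule summable_comparison_test') (use step[OF s] in \<open>auto simp: dist_norm norm_minus_commute\<close>)
  then have "convergent (\<lambda>n. \<Sum>i<n. approximant (Suc i) s - approximant i s)"
    by (simp add: summable_iff_convergent)
  then have "convergent (\<lambda>n. (\<Sum>i<n. approximant (Suc i) s - approximant i s) + approximant 0 s)"
    by (intro convergent_add convergent_const)
  then have "convergent (\<lambda>n. approximant n s)"
    unfolding sum_lessThan_telescope[of "\<lambda>n. approximant n s"] by (simp only: diff_add_cancel)
  then show ?thesis unfolding coding_def by (simp add: convergent_LIMSEQ_iff)
qed

lemma coding_in_K: "s \<in> streams {1..N} \<Longrightarrow> coding s \<in> K"
  using closed_sequentially[OF compact_imp_closed[OF compact_K]] approximant_in_K approximant_converges
  by metis

lemma coding_Stream: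
  assumes "i \<in> {1..N}" "s \<in> streams {1..N}"
  shows "coding (i ## s) = \<phi> i (coding s)"
proof -
  have "i ## s \<in> streams {1..N}" using assms by (simp add: streams_Stream)
  then have "(\<lambda>n. approximant (Suc n) (i ## s)) \<longlonglongrightarrow> coding (i ## s)"
    by (intro LIMSEQ_Suc approximant_converges)
  moreover have "(\<lambda>n. \<phi> i (approximant n s)) \<longlonglongrightarrow> \<phi> i (coding s)"
    by (rule continuous_on_tendsto_compose[OF continuous_similarity[OF assms(1), of UNIV]
          approximant_converges[OF assms(2)]]) auto
  ultimately show ?thesis by (simp add: LIMSEQ_unique)
qed

lemma approximant_measurable: "approximant n \<in> borel_measurable (stream_space letters)"
proof (induction n)
  case 0
  have "approximant 0 = (\<lambda>_. base_point)" by (rule ext) simp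
  then show ?case by simp
next
  case (Suc n)
  have eq: "approximant (Suc n) = (\<lambda>s. \<phi> (shd s) (approximant n (stl s)))" by (rule ext) simp
  have "shd \<in> measurable (stream_space letters) (count_space {1..N})"
    using measurable_shd[of letters] unfolding measurable_cong_sets[OF refl sets_letters] .
  then show ?case
    unfolding eq
  proof (rule measurable_compose_countable'[rotated])
    fix i assume i: "i \<in> {1..N}"
    show "(\<lambda>s. \<phi> i (approximant n (stl s))) \<in> borel_measurable (stream_space letters)"
      by (rule measurable_compose[OF measurable_compose[OF measurable_stl Suc.IH]
            borel_measurable_continuous_onI[OF continuous_similarity[OF i]]])
  qed simp
qed

lemma coding_measurable [measurable]: "coding \<in> borel_measurable (stream_space letters)"
  by (rule borel_measurable_LIMSEQ_metric[where f = approximant, OF approximant_measurable])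
     (simp add: approximant_converges space_stream_space)

text \<open>The law of the point whose address consists of independent indices, the index \<open>i\<close> being drawn
  with probability \<open>r i powr \<delta>\<close>.\<close>

definition invariant_measure :: "(real^'n) measure" where
  "invariant_measure = distr (stream_space letters) borel coding"

text \<open>The functional equation says that neighbourhood integrals of \<open>h\<close> at small radii are
  neighbourhood integrals of the transferred function at larger radii, piece by piece.\<close>

definition transfer :: "(real^'n \<Rightarrow> real) \<Rightarrow> real^'n \<Rightarrow> real" where
  "transfer h x = (\<Sum>i\<in>{1..N}. r i powr \<delta> * h (\<phi> i x))"

lemma prob_space_invariant_measure: "prob_space invariant_measure"
  unfolding invariant_measure_def
  by (intro prob_space.prob_space_distr prob_space.prob_space_stream_space[OF prob_space_letters] coding_measurable)

lemma sets_invariant_measure [simp]: "sets invariant_measure = sets borel"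
  by (simp add: invariant_measure_def)

lemma AE_invariant_measure: "AE x in invariant_measure. x \<in> K"
  unfolding invariant_measure_def
proof (subst AE_distr_iff)
  show "{x \<in> space borel. x \<in> K} \<in> sets borel"
    using borel_closed[OF compact_imp_closed[OF compact_K]] by simp
  show "AE s in stream_space letters. coding s \<in> K"
    by (rule AE_I2) (simp add: coding_in_K space_stream_space)
qed simp

lemma integrable_bounded_borel_prob:
  assumes "prob_space M" "h \<in> borel_measurable M" "\<And>x. \<bar>h x\<bar> \<le> (B::real)"
  shows "integrable M h"
proof -
  interpret prob_space M by fact
  show ?thesis using assms(2,3) by (intro integrable_const_bound[of _ B]) auto
qed

text \<open>Condition on the first index of the address. The function is shifted by a constant \<open>B\<close> to be able
  to use nonnegative integrals.\<close>

lemma integral_invariant_measure: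
  assumes h: "bounded_borel h"
  shows "integral\<^sup>L invariant_measure h = integral\<^sup>L invariant_measure (transfer h)"
proof -
  interpret letters: prob_space letters by (rule prob_space_letters)
  let ?S = "stream_space letters"
  have S: "prob_space ?S" by (rule letters.prob_space_stream_space)
  interpret S: prob_space ?S by (rule S)
  define E where "E u = (\<integral>s. u (coding s) \<partial>?S)" for u :: "real^'n \<Rightarrow> real"
  obtain B where B: "B > 0" "\<And>x. \<bar>h x\<bar> \<le> B" using h by (rule bounded_borelE) blast
  define k where "k x = h x + B" for x
  have k0: "0 \<le> k x" for x using B(2)[of x] by (simp add: k_def)
  have meas: "(\<lambda>s. u (coding s)) \<in> borel_measurable ?S" if "bounded_borel u" for u :: "real^'n \<Rightarrow> real"
    using measurable_compose[OF coding_measurable bounded_borel_measurable[OF that]] .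
  have int: "integrable ?S (\<lambda>s. u (coding s))" if u: "bounded_borel u" for u :: "real^'n \<Rightarrow> real"
  proof -
    obtain C where "\<And>x. \<bar>u x\<bar> \<le> C" using u by (rule bounded_borelE) blast
    then show ?thesis by (intro integrable_bounded_borel_prob[OF S meas[OF u], of C])
  qed
  have k: "bounded_borel k" unfolding k_def using h by (intro bounded_borel_add bounded_borel_const)
  have k\<phi>: "bounded_borel (\<lambda>x. k (\<phi> i x))" if "i \<in> {1..N}" for i
    using that k by (rule bounded_borel_comp_similarity)
  have nn: "(\<integral>\<^sup>+ s. ennreal (u (coding s)) \<partial>?S) = ennreal (E u)"
    if "bounded_borel u" "\<And>x. 0 \<le> u x" for u
    unfolding E_def using that by (intro nn_integral_eq_integral int) auto
  have E0: "0 \<le> E (\<lambda>x. k (\<phi> i x))" for i unfolding E_def by (rule Bochner_Integration.integral_nonneg) (rule k0)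
  have "ennreal (E k) = (\<integral>\<^sup>+ s. ennreal (k (coding s)) \<partial>?S)" using nn[OF k k0] by simp
  also have "\<dots> = (\<integral>\<^sup>+ i. (\<integral>\<^sup>+ s. ennreal (k (coding (i ## s))) \<partial>?S) \<partial>letters)"
    using meas[OF k] by (intro letters.nn_integral_stream_space) simp
  also have "\<dots> = (\<Sum>i\<in>{1..N}. ennreal (r i powr \<delta>) * (\<integral>\<^sup>+ s. ennreal (k (coding (i ## s))) \<partial>?S))"
    unfolding letters_def by (subst nn_integral_point_measure_finite) (auto simp: mult.commute)
  also have "\<dots> = (\<Sum>i\<in>{1..N}. ennreal (r i powr \<delta> * E (\<lambda>x. k (\<phi> i x))))"
  proof (intro sum.cong refl)
    fix i assume i: "i \<in> {1..N}"
    have "(\<integral>\<^sup>+ s. ennreal (k (coding (i ## s))) \<partial>?S) = (\<integral>\<^sup>+ s. ennreal (k (\<phi> i (coding s))) \<partial>?S)"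
      using coding_Stream[OF i] by (intro nn_integral_cong) (simp add: space_stream_space)
    also have "\<dots> = ennreal (E (\<lambda>x. k (\<phi> i x)))" by (rule nn[OF k\<phi>[OF i] k0])
    finally show "ennreal (r i powr \<delta>) * (\<integral>\<^sup>+ s. ennreal (k (coding (i ## s))) \<partial>?S)
      = ennreal (r i powr \<delta> * E (\<lambda>x. k (\<phi> i x)))" by (simp add: ennreal_mult E0)
  qed
  also have "\<dots> = ennreal (\<Sum>i\<in>{1..N}. r i powr \<delta> * E (\<lambda>x. k (\<phi> i x)))"
    by (rule sum_ennreal) (simp add: E0)
  finally have "E k = (\<Sum>i\<in>{1..N}. r i powr \<delta> * E (\<lambda>x. k (\<phi> i x)))"
    using E0 by (subst (asm) ennreal_inj) (auto simp: E_def k0 intro!: sum_nonneg)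
  also have "\<dots> = (\<Sum>i\<in>{1..N}. r i powr \<delta> * (E (\<lambda>x. h (\<phi> i x)) + B))"
  proof (intro sum.cong refl)
    fix i assume i: "i \<in> {1..N}"
    show "r i powr \<delta> * E (\<lambda>x. k (\<phi> i x)) = r i powr \<delta> * (E (\<lambda>x. h (\<phi> i x)) + B)"
      using int[OF bounded_borel_comp_similarity[OF i h]] by (simp add: E_def k_def S.prob_space)
  qed
  also have "\<dots> = (\<Sum>i\<in>{1..N}. r i powr \<delta> * E (\<lambda>x. h (\<phi> i x))) + B"
    using moran by (simp add: distrib_left sum.distrib sum_distrib_right[symmetric])
  also have "E k = E h + B"
    using int[OF h] by (simp add: E_def k_def S.prob_space)
  finally have "E h = (\<Sum>i\<in>{1..N}. r i powr \<delta> * E (\<lambda>x. h (\<phi> i x)))" by simp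
  also have "\<dots> = E (transfer h)"
    unfolding E_def transfer_def
    using int[OF bounded_borel_comp_similarity[OF _ h]]
    by (subst Bochner_Integration.integral_sum) auto
  finally have *: "E h = E (transfer h)" .
  have T: "bounded_borel (transfer h)"
    unfolding transfer_def[abs_def]
    using h by (intro bounded_borel_sum bounded_borel_mult bounded_borel_const bounded_borel_comp_similarity) auto
  show ?thesis
    unfolding invariant_measure_def
    using * integral_distr[OF coding_measurable bounded_borel_measurable[OF h]]
      integral_distr[OF coding_measurable bounded_borel_measurable[OF T]]
    by (simp add: E_def)
qed

lemma bounded_borel_transfer: "bounded_borel h \<Longrightarrow> bounded_borel (transfer h)"
  unfolding transfer_def[abs_def]
  by (intro bounded_borel_sum bounded_borel_mult bounded_borel_const bounded_borel_comp_similarity) auto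

lemma bounded_borel_transfer_iterate: "bounded_borel h \<Longrightarrow> bounded_borel ((transfer ^^ n) h)"
  by (induction n) (auto intro: bounded_borel_transfer)

lemma integral_transfer_iterate:
  "bounded_borel h \<Longrightarrow> integral\<^sup>L invariant_measure h = integral\<^sup>L invariant_measure ((transfer ^^ n) h)"
  by (induction n) (auto simp: integral_invariant_measure[OF bounded_borel_transfer_iterate])

definition unit_nbhd :: "(real^'n) set" where "unit_nbhd = {x. infdist x K \<le> 1}"

lemma compact_unit_nbhd: "compact unit_nbhd"
  unfolding unit_nbhd_def by (rule compact_infdist_le[OF K_nonempty compact_K]) simp

lemma similarity_unit_nbhd:
  assumes i: "i \<in> {1..N}" and x: "x \<in> unit_nbhd" shows "\<phi> i x \<in> unit_nbhd"
proof -
  have "\<phi> i ` K \<subseteq> K" using image_K_subset[OF i] by auto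
  then have "infdist (\<phi> i x) K \<le> infdist (\<phi> i x) (\<phi> i ` K)"
    using K_nonempty by (intro infdist_mono) auto
  also have "\<dots> \<le> 1"
    using x ratio_pos[OF i] ratio_less_1[OF i] order_trans[of "infdist x K" 1 "1 / r i"]
    by (simp add: infdist_similarity_image[OF i] unit_nbhd_def)
  finally show ?thesis by (simp add: unit_nbhd_def)
qed

text \<open>An iterate averages the values of \<open>h\<close> at images of the argument under compositions of \<open>n\<close>
  similarities, and these contract distances by \<open>\<rho> ^ n\<close>. Hence uniform continuity of \<open>h\<close> makes
  high iterates almost constant near \<open>K\<close>.\<close>

lemma transfer_iterate_oscillation:
  assumes h: "continuous_on UNIV h" and \<eta>: "0 < \<eta>"
  obtains n where "\<And>x y. x \<in> unit_nbhd \<Longrightarrow> y \<in> unit_nbhd \<Longrightarrow> \<bar>(transfer ^^ n) h x - (transfer ^^ n) h y\<bar> \<le> \<eta>"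
proof -
  obtain \<rho> where \<rho>: "0 < \<rho>" "\<rho> < 1" "\<And>i. i \<in> {1..N} \<Longrightarrow> r i \<le> \<rho>" by (rule max_ratio) blast
  have "uniformly_continuous_on unit_nbhd h"
    by (rule compact_uniformly_continuous[OF continuous_on_subset[OF h] compact_unit_nbhd]) simp
  then obtain s where s: "0 < s" "\<And>x y. x \<in> unit_nbhd \<Longrightarrow> y \<in> unit_nbhd \<Longrightarrow> dist x y < s \<Longrightarrow> dist (h x) (h y) < \<eta>"
    using \<eta> unfolding uniformly_continuous_on_def by metis
  have osc: "\<bar>(transfer ^^ n) h x - (transfer ^^ n) h y\<bar> \<le> \<eta>"
    if "x \<in> unit_nbhd" "y \<in> unit_nbhd" "\<rho> ^ n * dist x y < s" for n x y
    using that
  proof (induction n arbitrary: x y)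
    case 0
    then show ?case using s(2)[of x y] by (simp add: dist_real_def)
  next
    case (Suc n)
    have "\<bar>(transfer ^^ n) h (\<phi> i x) - (transfer ^^ n) h (\<phi> i y)\<bar> \<le> \<eta>" if i: "i \<in> {1..N}" for i
    proof (rule Suc.IH)
      have "dist (\<phi> i x) (\<phi> i y) \<le> \<rho> * dist x y"
        using \<rho>(3)[OF i] by (simp add: dist_similarity[OF i] mult_right_mono)
      then have "\<rho> ^ n * dist (\<phi> i x) (\<phi> i y) \<le> \<rho> ^ n * (\<rho> * dist x y)"
        using \<rho>(1) by (intro mult_left_mono) auto
      also have "\<dots> < s" using Suc.prems(3) by (simp add: mult_ac)
      finally show "\<rho> ^ n * dist (\<phi> i x) (\<phi> i y) < s" .
    qed (use Suc.prems similarity_unit_nbhd[OF i] in auto)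
    then have "(\<Sum>i\<in>{1..N}. \<bar>r i powr \<delta> * ((transfer ^^ n) h (\<phi> i x) - (transfer ^^ n) h (\<phi> i y))\<bar>)
        \<le> (\<Sum>i\<in>{1..N}. r i powr \<delta> * \<eta>)"
      by (intro sum_mono) (simp add: abs_mult mult_left_mono)
    also have "\<dots> = \<eta>" using moran by (simp add: sum_distrib_right[symmetric])
    finally have "\<bar>\<Sum>i\<in>{1..N}. r i powr \<delta> * ((transfer ^^ n) h (\<phi> i x) - (transfer ^^ n) h (\<phi> i y))\<bar> \<le> \<eta>"
      by (rule order_trans[OF sum_abs])
    then show ?case
      by (simp add: transfer_def[of "(transfer ^^ n) h"] right_diff_distrib sum_subtractf)
  qed
  have pos: "0 < s / (diameter unit_nbhd + 1)"
    using s(1) diameter_ge_0[OF compact_imp_bounded[OF compact_unit_nbhd]] by auto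
  obtain n where n: "\<rho> ^ n < s / (diameter unit_nbhd + 1)"
    using real_arch_pow_inv[OF pos \<rho>(2)] by blast
  show thesis
  proof (rule that[of n], rule osc)
    fix x y assume xy: "x \<in> unit_nbhd" "y \<in> unit_nbhd"
    have "\<rho> ^ n * dist x y \<le> \<rho> ^ n * (diameter unit_nbhd + 1)"
      using diameter_bounded_bound[OF compact_imp_bounded[OF compact_unit_nbhd] xy] \<rho>(1)
      by (intro mult_left_mono) auto
    also have "\<dots> < s"
      using n diameter_ge_0[OF compact_imp_bounded[OF compact_unit_nbhd]] by (simp add: pos_less_divide_eq)
    finally show "\<rho> ^ n * dist x y < s" .
  qed
qed

text \<open>The functional equation replaces \<open>h\<close> by its transfer at the price of rescaling the radius
  in each summand, and logarithmic means do not notice such a rescaling in the limit.\<close>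

lemma log_mean_transfer:
  assumes h: "bounded_borel h"
  shows "((\<lambda>T. log_mean (nbhd_integral K \<delta> h) T - log_mean (nbhd_integral K \<delta> (transfer h)) T) \<longlongrightarrow> 0) (at_right 0)"
proof -
  define V where "V i = nbhd_integral K \<delta> (\<lambda>x. h (\<phi> i x))" for i
  have tameV: "tame (V i)" if "i \<in> {1..N}" for i
    unfolding V_def by (intro tame_nbhd_integral bounded_borel_comp_similarity that h)
  define W where "W \<epsilon> = (\<Sum>i\<in>{1..N}. r i powr \<delta> * V i (1 / r i * \<epsilon>))" for \<epsilon>
  have tameV': "tame (\<lambda>\<epsilon>. V i (1 / r i * \<epsilon>))" if "i \<in> {1..N}" for i
    using ratio_pos[OF that] by (intro tame_scale tameV that) simp
  have tameW: "tame W" unfolding W_def[abs_def] by (intro tame_sum tame_cmult tameV') auto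
  have tameh: "tame (nbhd_integral K \<delta> h)" by (rule tame_nbhd_integral[OF h])
  have "((\<lambda>\<epsilon>. nbhd_integral K \<delta> h \<epsilon> - W \<epsilon>) \<longlongrightarrow> 0) (at_right 0)"
  proof (rule tendsto_eventually)
    show "\<forall>\<^sub>F \<epsilon> in at_right 0. nbhd_integral K \<delta> h \<epsilon> - W \<epsilon> = 0"
      using eventually_at_right_0_less[OF sep(1)]
      by eventually_elim (simp add: nbhd_integral_functional_equation[OF h] W_def V_def)
  qed
  then have "(log_mean (\<lambda>\<epsilon>. nbhd_integral K \<delta> h \<epsilon> - W \<epsilon>) \<longlongrightarrow> 0) (at_right 0)"
    by (intro cesaro_log_mean tame_diff tameh tameW)
  moreover have "((\<lambda>T. \<Sum>i\<in>{1..N}. r i powr \<delta> * (log_mean (\<lambda>\<epsilon>. V i (1 / r i * \<epsilon>)) T - log_mean (V i) T))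
      \<longlongrightarrow> (\<Sum>i\<in>{1..N}. r i powr \<delta> * 0)) (at_right 0)"
    using ratio_pos by (intro tendsto_sum tendsto_mult tendsto_const log_mean_scale_diff tameV) auto
  ultimately have "((\<lambda>T. log_mean (\<lambda>\<epsilon>. nbhd_integral K \<delta> h \<epsilon> - W \<epsilon>) T +
      (\<Sum>i\<in>{1..N}. r i powr \<delta> * (log_mean (\<lambda>\<epsilon>. V i (1 / r i * \<epsilon>)) T - log_mean (V i) T))) \<longlongrightarrow> 0) (at_right 0)"
    using tendsto_add by fastforce
  moreover have "\<forall>\<^sub>F T in at_right 0. log_mean (\<lambda>\<epsilon>. nbhd_integral K \<delta> h \<epsilon> - W \<epsilon>) T +
      (\<Sum>i\<in>{1..N}. r i powr \<delta> * (log_mean (\<lambda>\<epsilon>. V i (1 / r i * \<epsilon>)) T - log_mean (V i) T))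
      = log_mean (nbhd_integral K \<delta> h) T - log_mean (nbhd_integral K \<delta> (transfer h)) T"
    using eventually_at_right_0_less[OF zero_less_one]
  proof eventually_elim
    case (elim T)
    have sum: "log_mean (\<lambda>\<epsilon>. \<Sum>i\<in>{1..N}. r i powr \<delta> * U i \<epsilon>) T = (\<Sum>i\<in>{1..N}. r i powr \<delta> * log_mean (U i) T)"
      if "\<And>i. i \<in> {1..N} \<Longrightarrow> tame (U i)" for U
    proof -
      have "log_integral (\<lambda>\<epsilon>. \<Sum>i\<in>{1..N}. r i powr \<delta> * U i \<epsilon>) T 1
          = (\<Sum>i\<in>{1..N}. log_integral (\<lambda>\<epsilon>. r i powr \<delta> * U i \<epsilon>) T 1)"
        using elim that by (intro log_integral_sum tame_cmult) auto
      then show ?thesis by (simp only: log_mean_def log_integral_cmult sum_distrib_left mult.left_commute)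
    qed
    have "nbhd_integral K \<delta> (transfer h) = (\<lambda>\<epsilon>. \<Sum>i\<in>{1..N}. r i powr \<delta> * V i \<epsilon>)"
      unfolding transfer_def[abs_def] V_def sublevel_integral_cmult[symmetric]
      by (intro ext sublevel_integral_sum proper_gauge_infdist compact_K K_nonempty
          bounded_borel_mult bounded_borel_const bounded_borel_comp_similarity h) auto
    then have "log_mean (nbhd_integral K \<delta> (transfer h)) T = (\<Sum>i\<in>{1..N}. r i powr \<delta> * log_mean (V i) T)"
      using sum[of V] tameV by simp
    moreover have "log_mean W T = (\<Sum>i\<in>{1..N}. r i powr \<delta> * log_mean (\<lambda>\<epsilon>. V i (1 / r i * \<epsilon>)) T)"
      unfolding W_def[abs_def] by (rule sum[OF tameV'])
    moreover have "log_mean (\<lambda>\<epsilon>. nbhd_integral K \<delta> h \<epsilon> - W \<epsilon>) T = log_mean (nbhd_integral K \<delta> h) T - log_mean W T"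
      using logarithmic.diff[OF tameh tameW] elim by simp
    ultimately show ?case by (simp add: right_diff_distrib sum_subtractf)
  qed
  ultimately show ?thesis by (rule Lim_transform_eventually)
qed

lemma log_mean_transfer_iterate:
  assumes h: "bounded_borel h"
  shows "((\<lambda>T. log_mean (nbhd_integral K \<delta> h) T - log_mean (nbhd_integral K \<delta> ((transfer ^^ n) h)) T) \<longlongrightarrow> 0) (at_right 0)"
proof (induction n)
  case (Suc n)
  have "((\<lambda>T. (log_mean (nbhd_integral K \<delta> h) T - log_mean (nbhd_integral K \<delta> ((transfer ^^ n) h)) T)
      + (log_mean (nbhd_integral K \<delta> ((transfer ^^ n) h)) T - log_mean (nbhd_integral K \<delta> (transfer ((transfer ^^ n) h))) T))
      \<longlongrightarrow> 0 + 0) (at_right 0)"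
    by (intro tendsto_add Suc.IH log_mean_transfer bounded_borel_transfer_iterate h)
  then show ?case by simp
qed simp

text \<open>Replace \<open>h\<close> by an iterate \<open>k\<close> of the transfer that is almost constant near \<open>K\<close>. By
  invariance the constant is the integral of \<open>h\<close>, so the neighbourhood integrals of \<open>k\<close> are
  almost that constant times the rescaled volume, whose means converge to \<open>M\<close>.\<close>

lemma log_mean_nbhd_integral_converges:
  assumes M: "(log_mean (nbhd_integral K \<delta> (\<lambda>_. 1)) \<longlongrightarrow> M) (at_right 0)" "0 \<le> M"
    and h: "continuous_on UNIV h" "bounded (range h)"
  shows "(log_mean (nbhd_integral K \<delta> h) \<longlongrightarrow> M * integral\<^sup>L invariant_measure h) (at_right 0)"
proof -
  interpret \<mu>: prob_space invariant_measure by (rule prob_space_invariant_measure)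
  have bb: "bounded_borel h" using h by (rule bounded_borel_continuous)
  define c where "c = integral\<^sup>L invariant_measure h"
  define v where "v = nbhd_integral K \<delta> (\<lambda>_. 1)"
  have tamev: "tame v" unfolding v_def by (intro tame_nbhd_integral bounded_borel_const)
  show ?thesis
  proof (rule tendstoI)
    fix \<theta> :: real assume \<theta>: "0 < \<theta>"
    \<comment> \<open>the oscillation enters the limit multiplied by \<open>M\<close>\<close>
    define \<eta> where "\<eta> = \<theta> / (4 * (M + 1))"
    have \<eta>: "0 < \<eta>" using \<theta> M(2) by (simp add: \<eta>_def)
    obtain n where n: "\<And>x y. x \<in> unit_nbhd \<Longrightarrow> y \<in> unit_nbhd \<Longrightarrow> \<bar>(transfer ^^ n) h x - (transfer ^^ n) h y\<bar> \<le> \<eta>"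
      using transfer_iterate_oscillation[OF h(1) \<eta>] by blast
    define k where "k = (transfer ^^ n) h"
    have bk: "bounded_borel k" unfolding k_def by (rule bounded_borel_transfer_iterate[OF bb])
    have ck: "c = integral\<^sup>L invariant_measure k" unfolding c_def k_def by (rule integral_transfer_iterate[OF bb])
    have intk: "integrable invariant_measure k"
    proof -
      obtain B where "\<And>x. \<bar>k x\<bar> \<le> B" using bk by (rule bounded_borelE) blast
      then show ?thesis
        by (intro integrable_bounded_borel_prob[OF prob_space_invariant_measure, of k B])
           (simp_all add: measurable_cong_sets[OF sets_invariant_measure refl] bounded_borel_measurable[OF bk])
    qed
    have near: "\<bar>k x - c\<bar> \<le> \<eta>" if x: "x \<in> unit_nbhd" for x
    proof -
      have "AE y in invariant_measure. \<bar>k x - k y\<bar> \<le> \<eta>"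
        using AE_invariant_measure by eventually_elim (use n x in \<open>auto simp: unit_nbhd_def k_def\<close>)
      then have "AE y in invariant_measure. k y \<le> k x + \<eta>" "AE y in invariant_measure. k x - \<eta> \<le> k y"
        by (eventually_elim, linarith)+
      then have "c \<le> k x + \<eta>" "k x - \<eta> \<le> c"
        unfolding ck using \<mu>.integral_le_const[OF intk] \<mu>.integral_ge_const[OF intk] by auto
      then show ?thesis by linarith
    qed
    have V: "\<bar>nbhd_integral K \<delta> k \<epsilon> - c * v \<epsilon>\<bar> \<le> \<eta> * v \<epsilon>" if "0 < \<epsilon>" "\<epsilon> \<le> 1" for \<epsilon>
    proof -
      have "nbhd_integral K \<delta> (\<lambda>x. k x + (- c) * 1) \<epsilon> = nbhd_integral K \<delta> k \<epsilon> + (- c) * v \<epsilon>"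
        unfolding v_def sublevel_integral_cmult[symmetric]
        by (intro sublevel_integral_add proper_gauge_infdist compact_K K_nonempty bk bounded_borel_const)
      moreover have "\<bar>nbhd_integral K \<delta> (\<lambda>x. k x + (- c) * 1) \<epsilon>\<bar> \<le> \<eta> * v \<epsilon>"
        unfolding v_def
      proof (rule sublevel_integral_abs_le)
        show "\<bar>k x + (- c) * 1\<bar> \<le> \<eta>" if "infdist x K \<le> \<epsilon>" for x
          using near[of x] that \<open>\<epsilon> \<le> 1\<close> by (simp add: unit_nbhd_def)
      qed (intro proper_gauge_infdist compact_K K_nonempty bounded_borel_add bk bounded_borel_const)+
      ultimately show ?thesis by simp
    qed
    have tamek: "tame (nbhd_integral K \<delta> k)" by (rule tame_nbhd_integral[OF bk])
    have V1: "nbhd_integral K \<delta> k \<epsilon> \<le> (c + \<eta>) * v \<epsilon>" "(c - \<eta>) * v \<epsilon> \<le> nbhd_integral K \<delta> k \<epsilon>"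
      if "0 < \<epsilon>" "\<epsilon> \<le> 1" for \<epsilon>
      using V[OF that] by (auto simp: abs_le_iff algebra_simps)
    have small: "\<eta> * M \<le> \<theta> / 4"
      using M(2) \<theta> by (simp add: \<eta>_def field_simps)
    have "\<forall>\<^sub>F T in at_right 0. log_mean (nbhd_integral K \<delta> k) T \<le> log_mean (\<lambda>\<epsilon>. (c + \<eta>) * v \<epsilon>) T + \<theta> / 8"
      by (rule log_mean_asymptotic_mono[OF tamek tame_cmult[OF tamev] zero_less_one V1(1)]) (use \<theta> in auto)
    moreover have "\<forall>\<^sub>F T in at_right 0. log_mean (\<lambda>\<epsilon>. (c - \<eta>) * v \<epsilon>) T \<le> log_mean (nbhd_integral K \<delta> k) T + \<theta> / 8"
      by (rule log_mean_asymptotic_mono[OF tame_cmult[OF tamev] tamek zero_less_one V1(2)]) (use \<theta> in auto)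
    moreover have "((\<lambda>T. (c + \<eta>) * log_mean v T) \<longlongrightarrow> (c + \<eta>) * M) (at_right 0)"
        "((\<lambda>T. (c - \<eta>) * log_mean v T) \<longlongrightarrow> (c - \<eta>) * M) (at_right 0)"
      using M(1) unfolding v_def by (auto intro: tendsto_mult)
    then have "\<forall>\<^sub>F T in at_right 0. (c + \<eta>) * log_mean v T < (c + \<eta>) * M + \<theta> / 8"
        "\<forall>\<^sub>F T in at_right 0. (c - \<eta>) * M - \<theta> / 8 < (c - \<eta>) * log_mean v T"
      using \<theta> by (auto intro: order_tendstoD)
    moreover have "\<forall>\<^sub>F T in at_right 0. dist (log_mean (nbhd_integral K \<delta> h) T - log_mean (nbhd_integral K \<delta> k) T) 0 < \<theta> / 4"
      unfolding k_def by (rule tendstoD[OF log_mean_transfer_iterate[OF bb]]) (use \<theta> in simp)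
    ultimately show "\<forall>\<^sub>F T in at_right 0. dist (log_mean (nbhd_integral K \<delta> h) T) (M * integral\<^sup>L invariant_measure h) < \<theta>"
    proof eventually_elim
      case (elim T)
      define a b x where "a = log_mean (nbhd_integral K \<delta> h) T" "b = log_mean (nbhd_integral K \<delta> k) T" "x = log_mean v T"
      have *: "b \<le> (c + \<eta>) * x + \<theta> / 8" "(c - \<eta>) * x \<le> b + \<theta> / 8"
          "(c + \<eta>) * x < (c + \<eta>) * M + \<theta> / 8" "(c - \<eta>) * M - \<theta> / 8 < (c - \<eta>) * x" "\<bar>a - b\<bar> < \<theta> / 4"
        using elim by (simp_all add: a_b_x_def log_mean_cmult dist_real_def)
      have "b < c * M + \<eta> * M + \<theta> / 4" "c * M - \<eta> * M - \<theta> / 4 < b"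
        using *(1-4) unfolding distrib_right left_diff_distrib by linarith+
      then have "\<bar>a - c * M\<bar> < \<theta>" using *(5) small \<theta> by linarith
      then show ?case by (simp add: a_b_x_def dist_real_def c_def mult.commute)
    qed
  qed
qed

lemma average_content:
  obtains \<nu> where "finite_borel_measure \<nu>" "AE x in \<nu>. x \<in> K" "logarithmic.mode_content K \<delta> \<nu>"
proof -
  interpret \<mu>: prob_space invariant_measure by (rule prob_space_invariant_measure)
  obtain M where M: "0 \<le> M" "(log_mean (nbhd_integral K \<delta> (\<lambda>_. 1)) \<longlongrightarrow> M) (at_right 0)"
    by (rule log_mean_volume_converges)
  define \<nu> where "\<nu> = density invariant_measure (\<lambda>_. ennreal M)"
  have "finite_measure \<nu>"
    unfolding \<nu>_def by (rule finite_measure_density_integrable) (use M(1) in auto)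
  then have "finite_borel_measure \<nu>" by (simp add: finite_borel_measure_def \<nu>_def)
  moreover have "AE x in \<nu>. x \<in> K"
    unfolding \<nu>_def by (subst AE_density) (use AE_invariant_measure in auto)
  moreover have "logarithmic.mode_content K \<delta> \<nu>"
    unfolding logarithmic.mode_content_def
  proof (intro allI impI)
    fix h :: "real^'n \<Rightarrow> real" assume h: "continuous_on UNIV h" "bounded (range h)"
    have "h \<in> borel_measurable invariant_measure"
      unfolding measurable_cong_sets[OF sets_invariant_measure refl]
      by (rule borel_measurable_continuous_onI[OF h(1)])
    then have "integral\<^sup>L \<nu> h = M * integral\<^sup>L invariant_measure h"
      unfolding \<nu>_def using M(1) by (subst integral_density) auto
    then show "(log_mean (nbhd_integral K \<delta> h) \<longlongrightarrow> integral\<^sup>L \<nu> h) (at_right 0)"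
      using log_mean_nbhd_integral_converges[OF M(2,1) h] by simp
  qed
  ultimately show thesis by (rule that)
qed

end

section \<open>Neighbourhoods of variable radius\<close>

lemma powr_bounds:
  fixes t c p :: real
  assumes "1 \<le> c" "1 / c \<le> t" "t \<le> c"
  shows "t powr p \<le> c powr \<bar>p\<bar>" "c powr (- \<bar>p\<bar>) \<le> t powr p"
proof -
  have pos: "0 < c" using assms(1) by simp
  then have t: "0 < t" using assms(2) by (meson less_le_trans zero_less_divide_1_iff)
  have "ln t \<le> ln c" using assms(3) t pos by simp
  moreover have "- ln c \<le> ln t"
    using ln_mono[OF assms(2)] pos t by (simp add: ln_div)
  ultimately have "\<bar>ln t\<bar> \<le> ln c" by linarith
  then have "\<bar>p * ln t\<bar> \<le> \<bar>p\<bar> * ln c" unfolding abs_mult by (rule mult_left_mono) simp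
  then have "p * ln t \<le> \<bar>p\<bar> * ln c" "- \<bar>p\<bar> * ln c \<le> p * ln t" by linarith+
  then show "t powr p \<le> c powr \<bar>p\<bar>" "c powr (- \<bar>p\<bar>) \<le> t powr p"
    using t pos by (simp_all add: powr_def)
qed

text \<open>Supplies the distortion that is affordable for a prescribed error \<open>\<eta>\<close> in a limit \<open>G\<close>.\<close>

lemma factor_near_one:
  fixes G p \<eta> :: real
  assumes "0 < \<eta>"
  obtains c where "1 < c" "c powr p * G \<le> G + \<eta>" "G - \<eta> \<le> c powr (- p) * G"
proof -
  have lim: "((\<lambda>c. c powr q * G) \<longlongrightarrow> 1 powr q * G) (at_right 1)" for q
    by (intro tendsto_intros) auto
  have "\<forall>\<^sub>F c in at_right 1. c powr p * G < G + \<eta>" "\<forall>\<^sub>F c in at_right 1. G - \<eta> < c powr (- p) * G"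
    using order_tendstoD(2)[OF lim, of p "G + \<eta>"] order_tendstoD(1)[OF lim, of "G - \<eta>" "- p"] assms by auto
  moreover have "\<forall>\<^sub>F c in at_right (1::real). 1 < c" by (simp add: eventually_at_right_less)
  ultimately have "\<forall>\<^sub>F c in at_right (1::real). 1 < c \<and> c powr p * G \<le> G + \<eta> \<and> G - \<eta> \<le> c powr (- p) * G"
    by eventually_elim auto
  then obtain c where "1 < c \<and> c powr p * G \<le> G + \<eta> \<and> G - \<eta> \<le> c powr (- p) * G"
    using eventually_happens'[OF trivial_limit_at_right_real] by blast
  then show thesis by (intro that) auto
qed

text \<open>Near zero the bound is inherited from the gauge \<open>a * infdist x K\<close>, whose sublevel sets
  are neighbourhoods of \<open>K\<close> and contain those of \<open>D\<close>.\<close>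

lemma tame_comparable_gauge:
  fixes K :: "'a::euclidean_space set"
  assumes K: "compact K" "K \<noteq> {}" "minkowski_regular K \<delta>"
    and D: "D \<in> borel_measurable borel" "0 < a" "\<And>x. a * infdist x K \<le> D x"
    and H: "bounded_borel H"
  shows "proper_gauge D" "tame (sublevel_integral \<delta> D H)"
proof -
  note gauge = proper_gauge_infdist[OF K(1,2)]
  show proper: "proper_gauge D"
    by (rule proper_gauge_mono[OF gauge D(1), of "1 / a"]) (use D in \<open>auto simp: field_simps\<close>)
  show "tame (sublevel_integral \<delta> D H)"
  proof (rule sublevel_integral_tame[OF proper H])
    fix b :: real assume b: "b > 0"
    obtain c C where cC: "0 < c" "\<forall>\<epsilon>\<in>{0<..1 / a * b}. c \<le> nbhd_integral K \<delta> (\<lambda>_. 1) \<epsilon> \<and> nbhd_integral K \<delta> (\<lambda>_. 1) \<epsilon> \<le> C"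
      using K(3) b D(2) unfolding minkowski_regular_def by (metis mult_pos_pos zero_less_divide_1_iff)
    have "sublevel_integral \<delta> D (\<lambda>_. 1) \<epsilon> \<le> a powr (\<delta> - real DIM('a)) * C" if \<epsilon>: "\<epsilon> \<in> {0<..b}" for \<epsilon>
    proof -
      have "sublevel_integral \<delta> D (\<lambda>_. 1) \<epsilon> \<le> sublevel_integral \<delta> (\<lambda>x. a * infdist x K) (\<lambda>_. 1) \<epsilon>"
        using D(3) by (intro sublevel_integral_mono proper proper_gauge_cmult gauge D(2) bounded_borel_const)
          (auto intro: order_trans)
      also have "\<dots> = a powr (\<delta> - real DIM('a)) * nbhd_integral K \<delta> (\<lambda>_. 1) (1 / a * \<epsilon>)"
        using \<epsilon> D(2) by (intro sublevel_integral_scale_gauge) auto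
      also have "\<dots> \<le> a powr (\<delta> - real DIM('a)) * C"
        using cC(2) \<epsilon> D(2) by (intro mult_left_mono) (auto simp: divide_right_mono)
      finally show ?thesis .
    qed
    then show "\<exists>C. \<forall>\<epsilon>\<in>{0<..b}. sublevel_integral \<delta> D (\<lambda>_. 1) \<epsilon> \<le> C" by blast
  qed
qed

lemma tame_scaled_gauge:
  fixes K :: "'a::euclidean_space set"
  assumes K: "compact K" "K \<noteq> {}" "minkowski_regular K \<delta>"
    and w: "continuous_on UNIV w" "0 < a" "\<And>x. a \<le> w x" and k: "0 < k" and H: "bounded_borel H"
  shows "proper_gauge (\<lambda>x. k * w x * infdist x K)"
    and "tame (sublevel_integral \<delta> (\<lambda>x. k * w x * infdist x K) H)"
proof -
  have "(\<lambda>x. k * w x * infdist x K) \<in> borel_measurable borel"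
    by (intro borel_measurable_continuous_onI continuous_intros w(1))
  moreover have "0 < k * a" using k w(2) by simp
  moreover have "k * a * infdist x K \<le> k * w x * infdist x K" for x
    using k w(3)[of x] by (intro mult_right_mono mult_left_mono infdist_nonneg) auto
  ultimately show "proper_gauge (\<lambda>x. k * w x * infdist x K)"
    "tame (sublevel_integral \<delta> (\<lambda>x. k * w x * infdist x K) H)"
    using tame_comparable_gauge[OF K _ _ _ H] by blast+
qed

lemma sublevel_integral_lower_bound:
  fixes K :: "'a::euclidean_space set"
  assumes K: "compact K" "K \<noteq> {}" "minkowski_regular K \<delta>"
    and D: "proper_gauge D" "0 < b" "\<And>x. D x \<le> b * infdist x K"
    and H: "bounded_borel H" "0 < m" "\<And>x. m \<le> H x" and e: "0 < e"
  shows "\<exists>c>0. \<forall>\<epsilon>\<in>{0<..e}. c \<le> sublevel_integral \<delta> D H \<epsilon>"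
proof -
  note gauge = proper_gauge_infdist[OF K(1,2)]
  have "0 < 1 / b * e" using D(2) e by simp
  then obtain c C where c: "0 < c" "\<forall>\<epsilon>\<in>{0<..1 / b * e}. c \<le> nbhd_integral K \<delta> (\<lambda>_. 1) \<epsilon> \<and> nbhd_integral K \<delta> (\<lambda>_. 1) \<epsilon> \<le> C"
    using K(3) unfolding minkowski_regular_def by blast
  have "m * (b powr (\<delta> - real DIM('a)) * c) \<le> sublevel_integral \<delta> D H \<epsilon>" if \<epsilon>: "\<epsilon> \<in> {0<..e}" for \<epsilon>
  proof -
    have "1 / b * \<epsilon> \<in> {0<..1 / b * e}" using \<epsilon> D(2) by (auto simp: divide_right_mono)
    then have "m * (b powr (\<delta> - real DIM('a)) * c) \<le> m * (b powr (\<delta> - real DIM('a)) * nbhd_integral K \<delta> (\<lambda>_. 1) (1 / b * \<epsilon>))"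
      using H(2) c(2) by (intro mult_left_mono) auto
    also have "\<dots> = sublevel_integral \<delta> (\<lambda>x. b * infdist x K) (\<lambda>x. m * 1) \<epsilon>"
      unfolding sublevel_integral_cmult using \<epsilon> D(2) by (subst sublevel_integral_scale_gauge) auto
    also have "\<dots> \<le> sublevel_integral \<delta> D H \<epsilon>"
    proof (rule sublevel_integral_mono[OF proper_gauge_cmult[OF gauge D(2)] D(1) _ H(1)])
      show "0 \<le> H x" for x using H(2) H(3)[of x] by linarith
      show "D x \<le> \<epsilon>" if "b * infdist x K \<le> \<epsilon>" for x using D(3)[of x] that by linarith
    qed (use H(3) in auto)
    finally show ?thesis .
  qed
  moreover have "0 < m * (b powr (\<delta> - real DIM('a)) * c)" using H(2) D(2) c(1) by simp
  ultimately show ?thesis by blast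
qed

definition ramp :: "real \<Rightarrow> real" where "ramp t = min 1 (max 0 t)"

lemma continuous_ramp: "continuous_on S f \<Longrightarrow> continuous_on S (\<lambda>x. ramp (f x))"
  unfolding ramp_def by (intro continuous_intros)

text \<open>Written as a difference of consecutive ramps, the tents telescope to a partition of unity.\<close>

definition tent :: "real \<Rightarrow> nat \<Rightarrow> real" where "tent t j = ramp (t - real j) - ramp (t - real (Suc j))"

lemma tent_nonneg: "0 \<le> tent t j" and tent_le_1: "tent t j \<le> 1"
  by (auto simp: tent_def ramp_def)

lemma tent_support: "tent t j \<noteq> 0 \<Longrightarrow> real j \<le> t \<and> t \<le> real j + 2"
  by (auto simp: tent_def ramp_def min_def max_def split: if_splits)

lemma tent_partition: "1 \<le> t \<Longrightarrow> t \<le> real n \<Longrightarrow> (\<Sum>j<n. tent t j) = 1"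
  unfolding tent_def using sum_lessThan_telescope'[of "\<lambda>j. ramp (t - real j)" n]
  by (simp add: ramp_def)

lemma finite_borel_integrable:
  assumes "finite_borel_measure \<nu>" "bounded_borel (h :: _ \<Rightarrow> real)"
  shows "integrable \<nu> h"
proof -
  interpret finite_measure \<nu> using assms(1) by (simp add: finite_borel_measure_def)
  have sets: "sets \<nu> = sets borel" using assms(1) by (simp add: finite_borel_measure_def)
  obtain B where "\<And>x. \<bar>h x\<bar> \<le> B" using assms(2) by (rule bounded_borelE) blast
  then show ?thesis
    using bounded_borel_measurable[OF assms(2)]
    by (intro integrable_const_bound[of _ B]) (auto simp: measurable_cong_sets[OF sets refl])
qed

text \<open>Where \<open>w\<close> is constant, the gauge is a multiple of the distance and
  \<open>sublevel_integral_scale_gauge\<close> applies. In general, cut \<open>H\<close> into pieces \<open>h j\<close> by tents in the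
  variable \<open>ln w\<close>. On the support of \<open>h j\<close> the values of \<open>w\<close> lie between \<open>c j\<close> and
  \<open>q * c j\<close>, so that replacing \<open>w\<close> by these two constants gives lower and upper bounds with limits
  that differ from the claim at most by the factor \<open>q powr \<bar>\<delta> - d\<bar>\<close>.\<close>

lemma (in limit_mode) variable_gauge_limit:
  fixes K :: "'a::euclidean_space set"
  assumes K: "compact K" "K \<noteq> {}" "minkowski_regular K \<delta>"
    and \<nu>: "finite_borel_measure \<nu>" "mode_content K \<delta> \<nu>"
    and w: "continuous_on UNIV w" "0 < a" "\<And>x. a \<le> w x" "\<And>x. w x \<le> b"
    and H: "continuous_on UNIV H" "bounded (range H)" "\<And>x. 0 \<le> H x"
  shows "(A (sublevel_integral \<delta> (\<lambda>x. w x * infdist x K) H) \<longlongrightarrow>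
    (\<integral>x. w x powr (\<delta> - real DIM('a)) * H x \<partial>\<nu>)) (at_right 0)"
proof -
  define p where "p = \<delta> - real DIM('a)"
  define G where "G = (\<integral>x. w x powr p * H x \<partial>\<nu>)"
  define D where "D x = infdist x K" for x
  note gauge = proper_gauge_infdist[OF K(1,2), folded D_def]
  have wpos: "0 < w x" for x using w(2) w(3)[of x] by linarith
  have bH: "bounded_borel H" using H(1,2) by (rule bounded_borel_continuous)
  have bw: "bounded_borel (\<lambda>x. w x powr p)" by (rule bounded_borel_powr[OF w])
  have Dmeas: "D \<in> borel_measurable borel" using gauge by (rule proper_gauge_measurable)
  have wD: "(\<lambda>x. w x * D x) \<in> borel_measurable borel"
    using borel_measurable_continuous_onI[OF w(1)] Dmeas by measurable
  have wD_le: "a * infdist x K \<le> w x * D x" for x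
    unfolding D_def by (intro mult_right_mono w(3) infdist_nonneg)
  note properW = tame_comparable_gauge(1)[OF K wD w(2) wD_le bH]
  note tameW = tame_comparable_gauge(2)[OF K wD w(2) wD_le]
  have tameV: "tame (sublevel_integral \<delta> D h)" if "bounded_borel h" for h
    unfolding D_def[abs_def] by (rule minkowski_regular_tame[OF K that])
  show ?thesis
    unfolding p_def[symmetric] G_def[symmetric] D_def[symmetric]
  proof (rule limit_sandwich[OF tameW[OF bH]])
    fix \<theta> :: real assume \<theta>: "0 < \<theta>"
    obtain q where q: "1 < q" "q powr \<bar>p\<bar> * G \<le> G + \<theta>" "G - \<theta> \<le> q powr (- \<bar>p\<bar>) * G"
      using factor_near_one[OF \<theta>] by blast
    \<comment> \<open>a tent spans two mesh widths, so that \<open>w\<close> varies by the factor \<open>exp (2 * \<eta>) = q\<close> on it\<close>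
    define \<eta> where "\<eta> = ln q / 2"
    have \<eta>: "0 < \<eta>" using q(1) by (simp add: \<eta>_def)
    \<comment> \<open>the shift by one puts all values of \<open>t\<close> where the tents sum to one\<close>
    define t where "t x = ln (w x / a) / \<eta> + 1" for x
    obtain n where n: "ln (b / a) / \<eta> + 1 \<le> real n" using real_arch_simple by blast
    have t: "1 \<le> t x" "t x \<le> real n" for x
    proof -
      have "1 \<le> w x / a" using w(2) w(3)[of x] by simp
      then show "1 \<le> t x" using \<eta> by (simp add: t_def)
      have "ln (w x / a) \<le> ln (b / a)"
        using w(2) w(4)[of x] wpos[of x] by (simp add: divide_right_mono)
      then have "t x \<le> ln (b / a) / \<eta> + 1" using \<eta> by (simp add: t_def divide_right_mono)
      then show "t x \<le> real n" using n by linarith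
    qed
    have contt: "continuous_on UNIV t"
      unfolding t_def[abs_def] using w(2) wpos \<eta>
      by (intro continuous_intros w(1)) (auto simp: less_imp_neq[symmetric])
    define c where "c j = a * exp ((real j - 1) * \<eta>)" for j
    have cpos: "0 < c j" for j using w(2) by (simp add: c_def)
    define h where "h j x = H x * tent (t x) j" for j x
    have h0: "0 \<le> h j x" for j x by (simp add: h_def H(3) tent_nonneg)
    have range_w: "c j \<le> w x" "w x \<le> q * c j" if "h j x \<noteq> 0" for j x
    proof -
      have "tent (t x) j \<noteq> 0" using that by (auto simp: h_def)
      then have "real j \<le> t x" "t x \<le> real j + 2" using tent_support by auto
      then have "(real j - 1) * \<eta> \<le> (t x - 1) * \<eta>" "(t x - 1) * \<eta> \<le> (real j + 1) * \<eta>"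
        using \<eta> by (auto intro!: mult_right_mono)
      moreover have "(t x - 1) * \<eta> = ln (w x / a)" using \<eta> by (simp add: t_def)
      ultimately have "exp ((real j - 1) * \<eta>) \<le> w x / a" "w x / a \<le> exp ((real j + 1) * \<eta>)"
        using w(2) wpos[of x] by (metis divide_pos_pos exp_le_cancel_iff exp_ln)+
      moreover have "exp ((real j + 1) * \<eta>) = q * exp ((real j - 1) * \<eta>)"
      proof -
        have "ln q = 2 * \<eta>" by (simp add: \<eta>_def)
        then have "(real j + 1) * \<eta> = ln q + (real j - 1) * \<eta>" by (simp add: algebra_simps)
        then show ?thesis using q(1) by (simp add: exp_add)
      qed
      ultimately show "c j \<le> w x" "w x \<le> q * c j"
        using w(2) by (simp_all add: c_def field_simps)
    qed
    have conth: "continuous_on UNIV (h j)" for j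
      unfolding h_def[abs_def] tent_def by (intro continuous_intros continuous_ramp contt H(1))
    have bddh: "bounded (range (h j))" for j
    proof -
      obtain B where B: "\<And>x. \<bar>H x\<bar> \<le> B" using bH by (rule bounded_borelE) blast
      have "\<bar>h j x\<bar> \<le> B" for x
        using mult_mono[OF B[of x] tent_le_1[of "t x" j]] tent_nonneg[of "t x" j] B[of x]
        by (auto simp: h_def abs_mult)
      then show ?thesis by (auto intro!: boundedI[where B=B])
    qed
    have bh: "bounded_borel (h j)" for j using conth bddh by (rule bounded_borel_continuous)
    have sum_h: "(\<Sum>j<n. h j x) = H x" for x
      using tent_partition[OF t, of x] by (simp add: h_def sum_distrib_left[symmetric])
    define W where "W s \<epsilon> = (\<Sum>j<n. (s * c j) powr p * sublevel_integral \<delta> D (h j) (1 / (s * c j) * \<epsilon>))" for s \<epsilon>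
    have tameWs: "tame (W s)" if "0 < s" for s
      unfolding W_def[abs_def] using that cpos by (intro tame_sum tame_cmult tame_scale tameV bh) auto
    have limW: "(A (W s) \<longlongrightarrow> (\<Sum>j<n. (s * c j) powr p * integral\<^sup>L \<nu> (h j))) (at_right 0)" if s: "0 < s" for s
      unfolding W_def[abs_def]
    proof (intro limit_sum limit_cmult tame_cmult tame_scale tameV bh scale)
      fix j
      show "(A (sublevel_integral \<delta> D (h j)) \<longlongrightarrow> integral\<^sup>L \<nu> (h j)) (at_right 0)"
        using \<nu>(2) conth bddh unfolding mode_content_def D_def[abs_def] by blast
    qed (use s cpos in auto)
    have W_eq: "W s \<epsilon> = (\<Sum>j<n. sublevel_integral \<delta> (\<lambda>x. s * c j * D x) (h j) \<epsilon>)" if "0 < s" "0 < \<epsilon>" for s \<epsilon>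
      unfolding W_def p_def using that cpos by (intro sum.cong refl sublevel_integral_scale_gauge[symmetric]) auto
    have V_eq: "sublevel_integral \<delta> (\<lambda>x. w x * D x) H \<epsilon> = (\<Sum>j<n. sublevel_integral \<delta> (\<lambda>x. w x * D x) (h j) \<epsilon>)" for \<epsilon>
      using sublevel_integral_sum[of "{..<n}" "\<lambda>x. w x * D x" h \<delta> \<epsilon>] properW bh by (simp add: sum_h)
    have below: "W q \<epsilon> \<le> sublevel_integral \<delta> (\<lambda>x. w x * D x) H \<epsilon>" if \<epsilon>: "0 < \<epsilon>" for \<epsilon>
      unfolding V_eq W_eq[OF less_trans[OF zero_less_one q(1)] \<epsilon>]
    proof (intro sum_mono sublevel_integral_mono properW proper_gauge_cmult gauge bh)
      fix j x
      assume "q * c j * D x \<le> \<epsilon>" "h j x \<noteq> 0"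
      then show "w x * D x \<le> \<epsilon>"
        using range_w(2)[of j x] mult_right_mono[of "w x" "q * c j" "D x"] by (simp add: D_def infdist_nonneg)
    qed (use q cpos h0 in auto)
    have above: "sublevel_integral \<delta> (\<lambda>x. w x * D x) H \<epsilon> \<le> W 1 \<epsilon>" if \<epsilon>: "0 < \<epsilon>" for \<epsilon>
      unfolding V_eq W_eq[OF zero_less_one \<epsilon>]
    proof (intro sum_mono sublevel_integral_mono properW proper_gauge_cmult gauge bh)
      fix j x
      assume "w x * D x \<le> \<epsilon>" "h j x \<noteq> 0"
      then show "1 * c j * D x \<le> \<epsilon>"
        using range_w(1)[of j x] mult_right_mono[of "c j" "w x" "D x"] by (simp add: D_def infdist_nonneg)
    qed (use cpos h0 in auto)
    have int_h: "integrable \<nu> (\<lambda>x. k * h j x)" for j k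
      by (intro integrable_mult_right finite_borel_integrable[OF \<nu>(1)] bh)
    have int_wH: "integrable \<nu> (\<lambda>x. w x powr p * H x)"
      by (intro finite_borel_integrable[OF \<nu>(1)] bounded_borel_mult bw bH)
    have sum_int: "(\<Sum>j<n. k j * integral\<^sup>L \<nu> (h j)) = (\<integral>x. (\<Sum>j<n. k j * h j x) \<partial>\<nu>)" for k
      using int_h by (simp add: Bochner_Integration.integral_sum)
    have "(\<Sum>j<n. (1 * c j) powr p * integral\<^sup>L \<nu> (h j)) \<le> (\<integral>x. q powr \<bar>p\<bar> * (w x powr p * H x) \<partial>\<nu>)"
      unfolding sum_int
    proof (intro integral_mono integrable_mult_right int_wH Bochner_Integration.integrable_sum int_h)
      fix x
      have "(1 * c j) powr p * h j x \<le> q powr \<bar>p\<bar> * w x powr p * h j x" for j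
      proof (cases "h j x = 0")
        case False
        have "(c j / w x) powr p \<le> q powr \<bar>p\<bar>"
          using range_w[OF False] wpos[of x] cpos[of j] q(1) by (intro powr_bounds) (auto simp: field_simps intro: order_trans)
        then have "c j powr p \<le> q powr \<bar>p\<bar> * w x powr p"
          using wpos[of x] cpos[of j] by (simp add: powr_divide field_simps)
        then show ?thesis using h0 by (intro mult_right_mono) auto
      qed simp
      then have "(\<Sum>j<n. (1 * c j) powr p * h j x) \<le> (\<Sum>j<n. q powr \<bar>p\<bar> * w x powr p * h j x)"
        by (intro sum_mono)
      also have "\<dots> = q powr \<bar>p\<bar> * (w x powr p * H x)" by (simp add: sum_distrib_left[symmetric] sum_h)
      finally show "(\<Sum>j<n. (1 * c j) powr p * h j x) \<le> q powr \<bar>p\<bar> * (w x powr p * H x)" .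
    qed (use finite_borel_integrable[OF \<nu>(1) bh] in auto)
    then have up: "(\<Sum>j<n. (1 * c j) powr p * integral\<^sup>L \<nu> (h j)) \<le> G + \<theta>"
      using q(2) by (simp add: G_def)
    have "(\<integral>x. q powr (- \<bar>p\<bar>) * (w x powr p * H x) \<partial>\<nu>) \<le> (\<Sum>j<n. (q * c j) powr p * integral\<^sup>L \<nu> (h j))"
      unfolding sum_int
    proof (intro integral_mono integrable_mult_right int_wH Bochner_Integration.integrable_sum int_h)
      fix x
      have "q powr (- \<bar>p\<bar>) * w x powr p * h j x \<le> (q * c j) powr p * h j x" for j
      proof (cases "h j x = 0")
        case False
        have "q powr (- \<bar>p\<bar>) \<le> (q * c j / w x) powr p"
        proof (rule powr_bounds(2))
          have "1 \<le> q * c j / w x" using range_w(2)[OF False] wpos[of x] by simp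
          then show "1 / q \<le> q * c j / w x" using q(1) by (meson divide_le_eq_1 less_imp_le less_trans order_trans zero_less_one)
          show "q * c j / w x \<le> q" using range_w(1)[OF False] wpos[of x] q(1) by (simp add: field_simps)
        qed (use q(1) in simp)
        then have "q powr (- \<bar>p\<bar>) * w x powr p \<le> (q * c j) powr p"
          using wpos[of x] cpos[of j] q(1) by (simp add: powr_divide field_simps)
        then show ?thesis using h0 by (intro mult_right_mono) auto
      qed simp
      then have "(\<Sum>j<n. q powr (- \<bar>p\<bar>) * w x powr p * h j x) \<le> (\<Sum>j<n. (q * c j) powr p * h j x)"
        by (intro sum_mono)
      moreover have "q powr (- \<bar>p\<bar>) * (w x powr p * H x) = (\<Sum>j<n. q powr (- \<bar>p\<bar>) * w x powr p * h j x)"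
        by (simp add: sum_distrib_left[symmetric] sum_h)
      ultimately show "q powr (- \<bar>p\<bar>) * (w x powr p * H x) \<le> (\<Sum>j<n. (q * c j) powr p * h j x)" by simp
    qed (use finite_borel_integrable[OF \<nu>(1) bh] in auto)
    then have low: "G - \<theta> \<le> (\<Sum>j<n. (q * c j) powr p * integral\<^sup>L \<nu> (h j))"
      using q(3) by (simp add: G_def)
    have q0: "0 < q" using q(1) by simp
    show "\<exists>W W' a' b' e. tame W \<and> tame W' \<and> 0 < e \<and>
      (\<forall>\<epsilon>. 0 < \<epsilon> \<longrightarrow> \<epsilon> \<le> e \<longrightarrow> W \<epsilon> \<le> sublevel_integral \<delta> (\<lambda>x. w x * D x) H \<epsilon> \<and>
         sublevel_integral \<delta> (\<lambda>x. w x * D x) H \<epsilon> \<le> W' \<epsilon>) \<and>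
      (A W \<longlongrightarrow> a') (at_right 0) \<and> (A W' \<longlongrightarrow> b') (at_right 0) \<and> G - \<theta> \<le> a' \<and> b' \<le> G + \<theta>"
    proof (intro exI conjI allI impI)
      show "tame (W q)" "tame (W 1)" using tameWs q0 by auto
      show "0 < (1::real)" by simp
      fix \<epsilon> :: real assume "0 < \<epsilon>"
      then show "W q \<epsilon> \<le> sublevel_integral \<delta> (\<lambda>x. w x * D x) H \<epsilon>"
        "sublevel_integral \<delta> (\<lambda>x. w x * D x) H \<epsilon> \<le> W 1 \<epsilon>" by (auto intro: below above)
    qed (rule limW[OF q0] limW[OF zero_less_one] low up)+
  qed
qed

section \<open>Neighbourhoods under a conformal map\<close>

locale conformal_image =
  fixes K U :: "(real^'n) set" and g :: "real^'n \<Rightarrow> real^'n" and f :: "real^'n \<Rightarrow> real" and \<delta> :: real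
  assumes compact_K: "compact K" and K_nonempty: "K \<noteq> {}"
    and regular: "minkowski_regular K \<delta>"
    and nbhd_subset: "parallel_nbhd K (1/2) \<subseteq> U"
    and diffeo: "C1_diffeomorphism_on U g"
    and conformal: "conformal_on U g f"
    and continuous_scale: "continuous_on U (\<lambda>x. \<bar>f x\<bar>)"
begin

lemma open_U: "open U" and open_image: "open (g ` U)" and inj_g: "inj_on g U"
  using diffeo by (auto simp: C1_diffeomorphism_on_def)

lemma derivative_g:
  obtains J where "continuous_on U J" "\<And>x. x \<in> U \<Longrightarrow> (g has_derivative (\<lambda>v. J x *v v)) (at x)"
  using diffeo by (auto simp: C1_diffeomorphism_on_def C1_on_def)

lemma continuous_g: "continuous_on U g"
proof -
  obtain J where "\<And>x. x \<in> U \<Longrightarrow> (g has_derivative (\<lambda>v. J x *v v)) (at x)" using derivative_g by blast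
  then show ?thesis by (meson continuous_at_imp_continuous_on has_derivative_continuous)
qed

lemma continuous_inverse: "continuous_on (g ` U) (inv_into U g)"
proof -
  obtain J where "\<And>y. y \<in> g ` U \<Longrightarrow> (inv_into U g has_derivative (\<lambda>v. J y *v v)) (at y)"
    using diffeo by (auto simp: C1_diffeomorphism_on_def C1_on_def)
  then show ?thesis by (meson continuous_at_imp_continuous_on has_derivative_continuous)
qed

text \<open>Orthogonal matrices preserve norms, and a derivative is unique.\<close>

lemma norm_derivative:
  assumes x: "x \<in> U" and der: "(g has_derivative g') (at x)"
  shows "norm (g' v) = \<bar>f x\<bar> * norm v"
proof -
  obtain Q :: "real^'n^'n" where Q: "orthogonal_matrix Q" "(g has_derivative (\<lambda>h. (f x *\<^sub>R Q) *v h)) (at x)"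
    using conformal x unfolding conformal_on_def by blast
  have "orthogonal_transformation (\<lambda>v. Q *v v)"
    using Q(1) by (simp add: orthogonal_transformation_matrix matrix_of_matrix_vector_mul)
  moreover have "g' = (\<lambda>h. (f x *\<^sub>R Q) *v h)" using has_derivative_unique[OF der Q(2)] .
  ultimately show ?thesis
    by (simp add: orthogonal_transformation_norm scaleR_matrix_vector_assoc[symmetric])
qed

text \<open>Since the inverse of \<open>g\<close> is differentiable, the chain rule shows that the derivative of \<open>g\<close> is
  injective; it is not zero because the space has positive dimension.\<close>

lemma scale_pos:
  assumes x: "x \<in> U" shows "0 < \<bar>f x\<bar>"
proof (rule ccontr)
  assume "\<not> 0 < \<bar>f x\<bar>"
  then have zero: "\<bar>f x\<bar> = 0" by simp
  obtain J where J: "\<And>x. x \<in> U \<Longrightarrow> (g has_derivative (\<lambda>v. J x *v v)) (at x)" using derivative_g by blast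
  obtain J' where J': "\<And>y. y \<in> g ` U \<Longrightarrow> (inv_into U g has_derivative (\<lambda>v. J' y *v v)) (at y)"
    using diffeo by (auto simp: C1_diffeomorphism_on_def C1_on_def)
  have "(inv_into U g \<circ> g has_derivative (\<lambda>v. J' (g x) *v v) \<circ> (\<lambda>v. J x *v v)) (at x)"
    using x by (intro diff_chain_at J J') auto
  then have "((\<lambda>x. x) has_derivative (\<lambda>v. J' (g x) *v v) \<circ> (\<lambda>v. J x *v v)) (at x)"
    by (rule has_derivative_transform_within_open[OF _ open_U x]) (simp add: inj_g)
  moreover have "((\<lambda>x. x) has_derivative (\<lambda>v. v)) (at x)" by (rule has_derivative_ident)
  ultimately have eq: "(\<lambda>v. J' (g x) *v v) \<circ> (\<lambda>v. J x *v v) = (\<lambda>v. v)"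
    by (rule has_derivative_unique)
  have "norm (J x *v axis undefined 1) = 0"
    using norm_derivative[OF x J[OF x]] zero by simp
  then have "J' (g x) *v (J x *v axis undefined 1) = 0" by simp
  moreover have "J' (g x) *v (J x *v axis undefined 1) = axis undefined 1"
    using fun_cong[OF eq, of "axis undefined 1"] by simp
  ultimately have "axis undefined 1 = (0 :: real^'n)" by simp
  then show False by (simp add: axis_eq_0_iff)
qed

text \<open>All geometry takes place in this compact neighbourhood of \<open>K\<close>, on which the scaling ratio is
  bounded away from zero and infinity.\<close>

definition collar :: "(real^'n) set" where "collar = parallel_nbhd K (1/2)"

lemma compact_collar: "compact collar" and collar_subset: "collar \<subseteq> U" and K_subset_collar: "K \<subseteq> collar"
proof -
  show "compact collar" unfolding collar_def parallel_nbhd_def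
    by (rule compact_infdist_le[OF K_nonempty compact_K]) simp
  show "collar \<subseteq> U" unfolding collar_def by (rule nbhd_subset)
  show "K \<subseteq> collar" by (auto simp: collar_def parallel_nbhd_def)
qed

lemma scale_bounds:
  obtains m b where "0 < m" "m \<le> b" "\<And>x. x \<in> collar \<Longrightarrow> m \<le> \<bar>f x\<bar>" "\<And>x. x \<in> collar \<Longrightarrow> \<bar>f x\<bar> \<le> b"
proof -
  have cont: "continuous_on collar (\<lambda>x. \<bar>f x\<bar>)" by (rule continuous_on_subset[OF continuous_scale collar_subset])
  have ne: "collar \<noteq> {}" using K_nonempty K_subset_collar by auto
  obtain x1 where x1: "x1 \<in> collar" "\<forall>y\<in>collar. \<bar>f x1\<bar> \<le> \<bar>f y\<bar>"
    using continuous_attains_inf[OF compact_collar ne cont] by auto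
  obtain x2 where x2: "x2 \<in> collar" "\<forall>y\<in>collar. \<bar>f y\<bar> \<le> \<bar>f x2\<bar>"
    using continuous_attains_sup[OF compact_collar ne cont] by auto
  show thesis
    by (rule that[of "\<bar>f x1\<bar>" "\<bar>f x2\<bar>"]) (use x1 x2 scale_pos collar_subset in auto)
qed

text \<open>The derivative is uniformly continuous on the compact collar, hence almost constant on small balls,
  where the mean value inequality compares \<open>g\<close> with its linearisation. The linear map multiplies
  norms by \<open>\<bar>f x\<bar>\<close>.\<close>

lemma uniform_linearization:
  assumes B: "0 < B"
  obtains s where "0 < s" "s \<le> 1/2" "\<And>x y. y \<in> K \<Longrightarrow> dist x y \<le> s \<Longrightarrow>
      \<bar>norm (g x - g y) - \<bar>f x\<bar> * norm (x - y)\<bar> \<le> B * norm (x - y)"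
proof -
  obtain J where J: "continuous_on U J" "\<And>x. x \<in> U \<Longrightarrow> (g has_derivative (\<lambda>v. J x *v v)) (at x)"
    by (rule derivative_g) blast
  define B' where "B' = B / (real CARD('n) * real CARD('n))"
  have B': "0 < B'" using B by (simp add: B'_def)
  have "uniformly_continuous_on collar J"
    by (rule compact_uniformly_continuous[OF continuous_on_subset[OF J(1) collar_subset] compact_collar])
  then obtain t where t: "0 < t" "\<And>x z. x \<in> collar \<Longrightarrow> z \<in> collar \<Longrightarrow> dist z x < t \<Longrightarrow> dist (J z) (J x) < B'"
    using B' unfolding uniformly_continuous_on_def by metis
  define s where "s = min (1/2) (t / 3)"
  show thesis
  proof (rule that[of s])
    show "0 < s" "s \<le> 1/2" using t(1) by (auto simp: s_def)
    fix x y assume y: "y \<in> K" and xy: "dist x y \<le> s"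
    let ?S = "cball y s"
    have S_collar: "?S \<subseteq> collar"
    proof
      fix z assume "z \<in> ?S"
      then have "dist z y \<le> 1/2" by (auto simp: s_def dist_commute)
      then show "z \<in> collar" using infdist_le2[OF y, of z "1/2"] by (simp add: collar_def parallel_nbhd_def)
    qed
    have x: "x \<in> ?S" using xy by (simp add: dist_commute)
    have "norm (g x - g y - J x *v (x - y)) \<le> norm (x - y) * B"
    proof (rule differentiable_bound_linearization[where S = ?S and f' = "\<lambda>x v. J x *v v"])
      show "y + u *\<^sub>R (x - y) \<in> ?S" if "u \<in> {0..1}" for u
      proof -
        have "u * norm (x - y) \<le> 1 * s" using that xy by (intro mult_mono) (auto simp: dist_norm)
        then show ?thesis using that by (simp add: dist_norm)
      qed
      show "(g has_derivative (*v) (J z)) (at z within ?S)" if "z \<in> ?S" for z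
        using J(2)[of z] that S_collar collar_subset by (blast intro: has_derivative_at_withinI)
      show "x \<in> ?S" by (rule x)
      show "onorm ((*v) (J z) - (*v) (J x)) \<le> B" if z: "z \<in> ?S" for z
      proof -
        have "dist z x \<le> dist z y + dist y x" by (rule dist_triangle)
        also have "\<dots> \<le> s + s" using z x by (intro add_mono) (auto simp: dist_commute)
        also have "\<dots> < t" using t(1) by (auto simp: s_def)
        finally have "dist (J z) (J x) < B'" using subsetD[OF S_collar z] subsetD[OF S_collar x] by (intro t(2))
        then have entries: "\<bar>(J z - J x) $ i $ j\<bar> \<le> B'" for i j
          using component_le_norm_cart[of "(J z - J x) $ i" j] Finite_Cartesian_Product.norm_nth_le[of "J z - J x" i]
          unfolding dist_norm by linarith
        have "(*v) (J z) - (*v) (J x) = (*v) (J z - J x)"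
          by (auto simp: fun_eq_iff matrix_vector_mult_diff_rdistrib)
        then have "onorm ((*v) (J z) - (*v) (J x)) \<le> real CARD('n) * real CARD('n) * B'"
          using onorm_le_matrix_component[OF entries] by simp
        then show ?thesis by (simp add: B'_def)
      qed
    qed
    moreover have "norm (J x *v (x - y)) = \<bar>f x\<bar> * norm (x - y)"
      using x S_collar collar_subset by (intro norm_derivative J(2)) auto
    moreover have "\<bar>norm (g x - g y) - norm (J x *v (x - y))\<bar> \<le> norm (g x - g y - J x *v (x - y))"
      by (rule norm_triangle_ineq3)
    ultimately show "\<bar>norm (g x - g y) - \<bar>f x\<bar> * norm (x - y)\<bar> \<le> B * norm (x - y)"
      by (simp add: mult.commute)
  qed
qed

lemma compact_image: "compact (g ` K)" and image_nonempty: "g ` K \<noteq> {}"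
  using K_nonempty compact_K K_subset_collar collar_subset
  by (auto intro!: compact_continuous_image continuous_on_subset[OF continuous_g])

text \<open>Close to the sets, the distance of \<open>g x\<close> to the image is \<open>\<bar>f x\<bar>\<close> times the distance of \<open>x\<close>
  to \<open>K\<close>, up to a factor \<open>c\<close> close to one. One estimate applies the linearisation to the point of
  \<open>K\<close> nearest to \<open>x\<close>, the other to the preimage of the point nearest to \<open>g x\<close>. That preimage
  is close to \<open>x\<close> because the inverse of \<open>g\<close> is uniformly continuous on the compact image
  of the collar.\<close>

lemma distance_comparison:
  assumes c: "1 < c"
  obtains \<rho> e where "0 < \<rho>" "\<rho> \<le> 1/2" "0 < e"
    "\<And>x. infdist x K \<le> \<rho> \<Longrightarrow> infdist (g x) (g ` K) \<le> c * (\<bar>f x\<bar> * infdist x K)"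
    "\<And>x. infdist x K \<le> \<rho> \<Longrightarrow> infdist (g x) (g ` K) \<le> e \<Longrightarrow> \<bar>f x\<bar> * infdist x K \<le> c * infdist (g x) (g ` K)"
    "{y. infdist y (g ` K) \<le> e} \<subseteq> g ` {x. infdist x K \<le> \<rho>}"
proof -
  obtain m b where mb: "0 < m" "m \<le> b" "\<And>x. x \<in> collar \<Longrightarrow> m \<le> \<bar>f x\<bar>" "\<And>x. x \<in> collar \<Longrightarrow> \<bar>f x\<bar> \<le> b"
    by (rule scale_bounds) blast
  \<comment> \<open>chosen so that \<open>\<bar>f x\<bar> + B \<le> c * \<bar>f x\<bar>\<close> and \<open>\<bar>f x\<bar> \<le> c * (\<bar>f x\<bar> - B)\<close>\<close>
  define B where "B = (1 - 1 / c) * m"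
  have B: "0 < B" using c mb(1) by (simp add: B_def)
  obtain s where s: "0 < s" "s \<le> 1/2" "\<And>x y. y \<in> K \<Longrightarrow> dist x y \<le> s \<Longrightarrow>
      \<bar>norm (g x - g y) - \<bar>f x\<bar> * norm (x - y)\<bar> \<le> B * norm (x - y)"
    using uniform_linearization[OF B] by blast
  have "uniformly_continuous_on (g ` collar) (inv_into U g)"
    using collar_subset
    by (intro compact_uniformly_continuous continuous_on_subset[OF continuous_inverse] compact_continuous_image
        continuous_on_subset[OF continuous_g] compact_collar) auto
  then obtain e0 where e0: "0 < e0" "\<And>u v. u \<in> g ` collar \<Longrightarrow> v \<in> g ` collar \<Longrightarrow> dist u v < e0 \<Longrightarrow>
      dist (inv_into U g u) (inv_into U g v) < s"
    using s(1) unfolding uniformly_continuous_on_def by metis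
  let ?O = "{x. infdist x K < s}"
  have O_collar: "?O \<subseteq> collar" using s(2) by (auto simp: collar_def parallel_nbhd_def)
  have "open ?O" by (intro open_Collect_less continuous_intros)
  then have "open (g ` U \<inter> inv_into U g -` ?O)"
    by (rule continuous_open_preimage[OF continuous_inverse open_image])
  moreover have "g ` U \<inter> inv_into U g -` ?O = g ` ?O"
    using O_collar collar_subset inj_g by (auto simp: subset_iff)
  ultimately have "open (g ` ?O)" by simp
  moreover have "g ` K \<subseteq> g ` ?O" using s(1) by auto
  ultimately obtain e1 where e1: "0 < e1" "{y. infdist y (g ` K) \<le> e1} \<subseteq> g ` ?O"
    using compact_in_open_separated[OF image_nonempty compact_image] by blast
  define e where "e = min (e0 / 2) e1"
  show thesis
  proof (rule that[of s e])
    show "0 < s" "s \<le> 1/2" "0 < e" using s e0 e1 by (auto simp: e_def)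
    have "{y. infdist y (g ` K) \<le> e} \<subseteq> {y. infdist y (g ` K) \<le> e1}" by (auto simp: e_def)
    also note e1(2)
    also have "g ` ?O \<subseteq> g ` {x. infdist x K \<le> s}" by (intro image_mono) auto
    finally show "{y. infdist y (g ` K) \<le> e} \<subseteq> g ` {x. infdist x K \<le> s}" .
    fix x assume x: "infdist x K \<le> s"
    then have xc: "x \<in> collar" using s(2) by (auto simp: collar_def parallel_nbhd_def)
    obtain y where y: "y \<in> K" "infdist x K = dist x y"
      using infdist_attains_inf[OF compact_imp_closed[OF compact_K] K_nonempty, of x] by blast
    have "infdist (g x) (g ` K) \<le> norm (g x - g y)"
      using infdist_le[of "g y" "g ` K" "g x"] y(1) by (simp add: dist_norm)
    also have "\<dots> \<le> (\<bar>f x\<bar> + B) * dist x y"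
      using s(3)[OF y(1), of x] x y(2) by (simp add: dist_norm distrib_right abs_le_iff)
    also have "\<dots> \<le> c * \<bar>f x\<bar> * dist x y"
    proof (rule mult_right_mono)
      have "(1 - 1 / c) * m \<le> (c - 1) * \<bar>f x\<bar>"
      proof (rule mult_mono)
        have "1 - 1 / c = (c - 1) / c" using c by (simp add: field_simps)
        also have "\<dots> \<le> c - 1" using c by (simp add: divide_le_eq)
        finally show "1 - 1 / c \<le> c - 1" .
      qed (use c mb(1) mb(3)[OF xc] in auto)
      then show "\<bar>f x\<bar> + B \<le> c * \<bar>f x\<bar>" by (simp add: B_def left_diff_distrib)
    qed simp
    finally show "infdist (g x) (g ` K) \<le> c * (\<bar>f x\<bar> * infdist x K)" using y(2) by (simp add: mult.assoc)
    assume le: "infdist (g x) (g ` K) \<le> e"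
    obtain z where "z \<in> g ` K" "infdist (g x) (g ` K) = dist (g x) z"
      using infdist_attains_inf[OF compact_imp_closed[OF compact_image] image_nonempty, of "g x"] by blast
    then obtain y' where y': "y' \<in> K" "infdist (g x) (g ` K) = dist (g x) (g y')" by auto
    have "dist (g x) (g y') < e0" using le y'(2) e0(1) by (simp add: e_def)
    then have "dist (inv_into U g (g x)) (inv_into U g (g y')) < s"
      using xc y'(1) K_subset_collar by (intro e0(2)) auto
    then have "dist x y' < s"
      using xc y'(1) K_subset_collar collar_subset inj_g by (auto simp: subset_iff)
    then have near: "\<bar>norm (g x - g y') - \<bar>f x\<bar> * norm (x - y')\<bar> \<le> B * norm (x - y')"
      using s(3)[OF y'(1), of x] by simp
    have "\<bar>f x\<bar> * infdist x K \<le> \<bar>f x\<bar> * dist x y'"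
      using infdist_le[OF y'(1), of x] by (intro mult_left_mono) auto
    also have "\<dots> \<le> (c * (\<bar>f x\<bar> - B)) * dist x y'"
    proof (rule mult_right_mono)
      have "c * B = (c - 1) * m" using c by (simp add: B_def field_simps)
      also have "\<dots> \<le> (c - 1) * \<bar>f x\<bar>" using c mb(3)[OF xc] by (intro mult_left_mono) auto
      finally show "\<bar>f x\<bar> \<le> c * (\<bar>f x\<bar> - B)" by (simp add: algebra_simps)
    qed simp
    also have "\<dots> = c * ((\<bar>f x\<bar> - B) * norm (x - y'))" by (simp add: dist_norm)
    also have "\<dots> \<le> c * norm (g x - g y')"
      using near c by (intro mult_left_mono) (auto simp: abs_le_iff left_diff_distrib)
    finally show "\<bar>f x\<bar> * infdist x K \<le> c * infdist (g x) (g ` K)"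
      using y'(2) by (simp add: dist_norm)
  qed
qed

text \<open>Substitution by \<open>g\<close>. The transformed integrand only makes sense on the collar; \<open>H\<close> is any
  extension of it to the whole space.\<close>

lemma nbhd_integral_image:
  assumes \<rho>: "\<rho> \<le> 1/2" and \<epsilon>: "{y. infdist y (g ` K) \<le> \<epsilon>} \<subseteq> g ` {x. infdist x K \<le> \<rho>}"
    and h: "bounded_borel h" and H: "H \<in> borel_measurable borel"
    and H_eq: "\<And>x. x \<in> collar \<Longrightarrow> H x = \<bar>f x\<bar> ^ CARD('n) * h (g x)"
  shows "{x. infdist x K \<le> \<rho> \<and> infdist (g x) (g ` K) \<le> \<epsilon>} \<in> sets borel"
    and "nbhd_integral (g ` K) \<delta> h \<epsilon> = \<epsilon> powr (\<delta> - real DIM(real^'n)) *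
      (\<integral>x. indicator {x. infdist x K \<le> \<rho> \<and> infdist (g x) (g ` K) \<le> \<epsilon>} x * H x \<partial>lborel)"
proof -
  let ?S = "{x. infdist x K \<le> \<rho> \<and> infdist (g x) (g ` K) \<le> \<epsilon>}"
  obtain J where J: "\<And>x. x \<in> U \<Longrightarrow> (g has_derivative (\<lambda>v. J x *v v)) (at x)" using derivative_g by blast
  have sub: "{x. infdist x K \<le> \<rho>} \<subseteq> collar" using \<rho> by (auto simp: collar_def parallel_nbhd_def)
  have "closed {x. infdist x K \<le> \<rho>}" by (intro closed_Collect_le continuous_intros)
  moreover have "continuous_on {x. infdist x K \<le> \<rho>} (\<lambda>x. infdist (g x) (g ` K))"
    using sub collar_subset by (intro continuous_intros continuous_on_subset[OF continuous_g]) auto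
  ultimately have "closed ({x. infdist x K \<le> \<rho>} \<inter> (\<lambda>x. infdist (g x) (g ` K)) -` {..\<epsilon>})"
    by (intro continuous_closed_preimage) auto
  moreover have "{x. infdist x K \<le> \<rho>} \<inter> (\<lambda>x. infdist (g x) (g ` K)) -` {..\<epsilon>} = ?S" by auto
  ultimately show S: "?S \<in> sets borel" by simp
  have S_collar: "?S \<subseteq> collar" using sub by auto
  have img: "g ` ?S = {y. infdist y (g ` K) \<le> \<epsilon>}" using \<epsilon> by auto
  have ind: "indicator ?S x *\<^sub>R (\<bar>f x\<bar> ^ CARD('n) * h (g x)) = indicator ?S x * H x" for x
    using S_collar H_eq[of x] by (auto simp: indicator_def)
  have "(LINT y:g ` ?S|lborel. h y) = (LINT x:?S|lborel. \<bar>f x\<bar> ^ CARD('n) * h (g x))"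
  proof (rule conformal_change_of_variables[OF S, where g' = "\<lambda>x v. J x *v v"])
    show "inj_on g ?S" using inj_g S_collar collar_subset by (meson inj_on_subset)
    show "(g has_derivative (*v) (J x)) (at x)" if "x \<in> ?S" for x
      using that S_collar collar_subset J by blast
    show "0 < \<bar>f x\<bar>" if "x \<in> ?S" for x using that S_collar collar_subset scale_pos by blast
    show "norm (J x *v v) = \<bar>f x\<bar> * norm v" if "x \<in> ?S" for x v
      using that S_collar collar_subset norm_derivative J by blast
    show "set_integrable lborel (g ` ?S) h"
      unfolding img set_integrable_def
      using integrable_sublevel[OF proper_gauge_infdist[OF compact_image image_nonempty] h] by simp
    show "set_borel_measurable borel ?S (\<lambda>x. \<bar>f x\<bar> ^ CARD('n) * h (g x))"
      unfolding set_borel_measurable_def ind using S H by measurable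
  qed
  then show "nbhd_integral (g ` K) \<delta> h \<epsilon> = \<epsilon> powr (\<delta> - real DIM(real^'n)) * (\<integral>x. indicator ?S x * H x \<partial>lborel)"
    unfolding sublevel_integral_def img set_lebesgue_integral_def ind by simp
qed

text \<open>Weak limits are tested against functions that are continuous on the whole space, so the
  scaling ratio and the transformed integrand are extended from the collar by Tietze's theorem.\<close>

lemma scale_extension:
  obtains w a b where "continuous_on UNIV w" "0 < a" "\<And>x. a \<le> w x" "\<And>x. w x \<le> b"
    "\<And>x. x \<in> collar \<Longrightarrow> w x = \<bar>f x\<bar>"
proof -
  obtain m b where mb: "0 < m" "m \<le> b" "\<And>x. x \<in> collar \<Longrightarrow> m \<le> \<bar>f x\<bar>" "\<And>x. x \<in> collar \<Longrightarrow> \<bar>f x\<bar> \<le> b"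
    by (rule scale_bounds) blast
  obtain w where "continuous_on UNIV w" "\<And>x. x \<in> collar \<Longrightarrow> w x = \<bar>f x\<bar>" "\<And>x. x \<in> UNIV \<Longrightarrow> w x \<in> cbox m b"
    by (rule Tietze_closed_interval_1[of collar "\<lambda>x. \<bar>f x\<bar>" UNIV m b])
       (use mb compact_imp_closed[OF compact_collar] continuous_on_subset[OF continuous_scale collar_subset] in auto)
  then show thesis using mb(1) by (intro that[of w m b]) auto
qed

lemma density_extension:
  assumes h: "continuous_on UNIV h" "bounded (range h)" "\<And>y. 0 \<le> h y"
  obtains H where "continuous_on UNIV H" "bounded (range H)" "\<And>x. (0::real) \<le> H x"
    "\<And>x. x \<in> collar \<Longrightarrow> H x = \<bar>f x\<bar> ^ CARD('n) * h (g x)"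
proof -
  let ?k = "\<lambda>x. \<bar>f x\<bar> ^ CARD('n) * h (g x)"
  have cont: "continuous_on collar ?k"
    by (intro continuous_intros continuous_on_subset[OF continuous_scale collar_subset]
        continuous_on_compose2[OF h(1) continuous_on_subset[OF continuous_g collar_subset]]) auto
  have "bounded (?k ` collar)"
    by (intro compact_imp_bounded compact_continuous_image cont compact_collar)
  then obtain B where B: "\<And>x. x \<in> collar \<Longrightarrow> \<bar>?k x\<bar> \<le> B"
    unfolding bounded_iff by auto
  have B': "x \<in> collar \<Longrightarrow> ?k x \<in> cbox 0 (max B 0)" for x
    using B[of x] h(3)[of "g x"] by (auto simp: abs_le_iff)
  obtain H where H: "continuous_on UNIV H" "\<And>x. x \<in> collar \<Longrightarrow> H x = ?k x" "\<And>x. x \<in> UNIV \<Longrightarrow> H x \<in> cbox 0 (max B 0)"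
    by (rule Tietze_closed_interval_1[of collar ?k UNIV 0 "max B 0"])
       (use cont compact_imp_closed[OF compact_collar] B' in auto)
  show thesis
    by (rule that[of H]) (use H in \<open>auto intro!: boundedI[where B = "max B 0"]\<close>)
qed

text \<open>In terms of \<open>K\<close>, a neighbourhood of the image is a neighbourhood whose radius
  is \<open>\<epsilon> / w x\<close>, up to the factor \<open>c\<close>.\<close>

lemma nbhd_integral_image_sandwich:
  assumes c: "1 < c"
    and w: "continuous_on UNIV w" "0 < a" "\<And>x. a \<le> w x" "\<And>x. x \<in> collar \<Longrightarrow> w x = \<bar>f x\<bar>"
    and h: "bounded_borel h"
    and H: "bounded_borel H" "\<And>x. 0 \<le> H x" "\<And>x. x \<in> collar \<Longrightarrow> H x = \<bar>f x\<bar> ^ CARD('n) * h (g x)"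
  shows "\<exists>e>0. \<forall>\<epsilon>\<in>{0<..e}.
      sublevel_integral \<delta> (\<lambda>x. c * w x * infdist x K) H \<epsilon> \<le> nbhd_integral (g ` K) \<delta> h \<epsilon> \<and>
      nbhd_integral (g ` K) \<delta> h \<epsilon> \<le> sublevel_integral \<delta> (\<lambda>x. 1 / c * w x * infdist x K) H \<epsilon>"
proof -
  obtain \<rho> e where \<rho>e: "0 < \<rho>" "\<rho> \<le> 1/2" "0 < e"
    "\<And>x. infdist x K \<le> \<rho> \<Longrightarrow> infdist (g x) (g ` K) \<le> c * (\<bar>f x\<bar> * infdist x K)"
    "\<And>x. infdist x K \<le> \<rho> \<Longrightarrow> infdist (g x) (g ` K) \<le> e \<Longrightarrow> \<bar>f x\<bar> * infdist x K \<le> c * infdist (g x) (g ` K)"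
    "{y. infdist y (g ` K) \<le> e} \<subseteq> g ` {x. infdist x K \<le> \<rho>}"
    using distance_comparison[OF c] by blast
  have collar: "infdist x K \<le> \<rho> \<Longrightarrow> x \<in> collar" for x using \<rho>e(2) by (auto simp: collar_def parallel_nbhd_def)
  have proper: "proper_gauge (\<lambda>x. k * w x * infdist x K)" if "0 < k" for k
    by (rule tame_scaled_gauge(1)[OF compact_K K_nonempty regular w(1-3) that H(1)])
  let ?S = "\<lambda>\<epsilon>. {x. infdist x K \<le> \<rho> \<and> infdist (g x) (g ` K) \<le> \<epsilon>}"
  \<comment> \<open>radii up to \<open>a * \<rho>\<close> keep the inner neighbourhood within distance \<open>\<rho>\<close> of \<open>K\<close>\<close>
  define e' where "e' = min e (a * \<rho>)"
  show ?thesis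
  proof (intro exI[of _ e'] conjI[of "0 < e'"] ballI)
    show "0 < e'" using \<rho>e w(2) by (simp add: e'_def)
    fix \<epsilon> :: real assume "\<epsilon> \<in> {0<..e'}"
    then have \<epsilon>: "0 < \<epsilon>" "\<epsilon> \<le> e'" by auto
    have "{y. infdist y (g ` K) \<le> \<epsilon>} \<subseteq> {y. infdist y (g ` K) \<le> e}" using \<epsilon>(2) by (auto simp: e'_def)
    then have sub: "{y. infdist y (g ` K) \<le> \<epsilon>} \<subseteq> g ` {x. infdist x K \<le> \<rho>}" using \<rho>e(6) by blast
    note img = nbhd_integral_image[OF \<rho>e(2) sub h bounded_borel_measurable[OF H(1)] H(3)]
    have lower: "x \<in> ?S \<epsilon>" if "c * w x * infdist x K \<le> \<epsilon>" for x
    proof -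
      have "a * infdist x K \<le> c * w x * infdist x K"
      proof (rule mult_right_mono[OF _ infdist_nonneg])
        have "1 * a \<le> c * w x" using c w(2) w(3)[of x] by (intro mult_mono) auto
        then show "a \<le> c * w x" by simp
      qed
      then have "a * infdist x K \<le> a * \<rho>" using that \<epsilon>(2) by (simp add: e'_def)
      then have x: "infdist x K \<le> \<rho>" using w(2) by simp
      then show ?thesis using \<rho>e(4)[OF x] that w(4)[OF collar[OF x]] by (simp add: mult.assoc)
    qed
    have upper: "1 / c * w x * infdist x K \<le> \<epsilon>" if "x \<in> ?S \<epsilon>" for x
    proof -
      have x: "infdist x K \<le> \<rho>" "infdist (g x) (g ` K) \<le> \<epsilon>" using that by auto
      then have "w x * infdist x K \<le> c * infdist (g x) (g ` K)"
        using \<rho>e(5)[OF x(1)] \<epsilon>(2) w(4)[OF collar[OF x(1)]] by (simp add: e'_def)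
      also have "\<dots> \<le> c * \<epsilon>" using x(2) c by (intro mult_left_mono) auto
      finally show ?thesis using c by (simp add: field_simps)
    qed
    have c0: "0 < c" "0 < 1 / c" using c by auto
    have int_up: "integrable lborel (\<lambda>x. indicator {x. 1 / c * w x * infdist x K \<le> \<epsilon>} x * H x)"
      by (rule integrable_sublevel[OF proper[OF c0(2)] H(1)])
    have int_S: "integrable lborel (\<lambda>x. indicator (?S \<epsilon>) x * H x)"
    proof (rule Bochner_Integration.integrable_bound[OF int_up])
      show "(\<lambda>x. indicator (?S \<epsilon>) x * H x) \<in> borel_measurable lborel"
        using img(1) bounded_borel_measurable[OF H(1)] by measurable
      show "AE x in lborel. norm (indicator (?S \<epsilon>) x * H x) \<le> norm (indicator {x. 1 / c * w x * infdist x K \<le> \<epsilon>} x * H x)"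
        using upper by (intro AE_I2) (auto simp: indicator_def)
    qed
    have "(\<integral>x. indicator {x. c * w x * infdist x K \<le> \<epsilon>} x * H x \<partial>lborel) \<le> (\<integral>x. indicator (?S \<epsilon>) x * H x \<partial>lborel)"
      using lower H(2) by (intro integral_mono integrable_sublevel[OF proper[OF c0(1)] H(1)] int_S) (auto simp: indicator_def)
    moreover have "(\<integral>x. indicator (?S \<epsilon>) x * H x \<partial>lborel) \<le> (\<integral>x. indicator {x. 1 / c * w x * infdist x K \<le> \<epsilon>} x * H x \<partial>lborel)"
      using upper H(2) by (intro integral_mono int_up int_S) (auto simp: indicator_def)
    moreover have "nbhd_integral (g ` K) \<delta> h \<epsilon> = \<epsilon> powr (\<delta> - real DIM(real^'n)) *
        (\<integral>x. indicator (?S \<epsilon>) x * H x \<partial>lborel)"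
      by (rule img(2))
    ultimately show "sublevel_integral \<delta> (\<lambda>x. c * w x * infdist x K) H \<epsilon> \<le> nbhd_integral (g ` K) \<delta> h \<epsilon> \<and>
      nbhd_integral (g ` K) \<delta> h \<epsilon> \<le> sublevel_integral \<delta> (\<lambda>x. 1 / c * w x * infdist x K) H \<epsilon>"
      by (simp only: sublevel_integral_def[of \<delta> _ H]) (intro conjI mult_left_mono; simp)
  qed
qed

end

section \<open>The content of the image\<close>

text \<open>The candidate for the content of the image. The indicator restricts the density to the
  open set \<open>g ` U\<close>, where it is continuous and which carries the push-forward.\<close>

definition image_content ::
  "(real^'n) set \<Rightarrow> (real^'n \<Rightarrow> real^'n) \<Rightarrow> (real^'n \<Rightarrow> real) \<Rightarrow> real \<Rightarrow> (real^'n) measure \<Rightarrow> (real^'n) measure" where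
  "image_content U g f \<delta> \<nu> = density (pushforward_on U g \<nu>)
     (\<lambda>y. ennreal (indicator (g ` U) y * \<bar>f (inv_into U g y)\<bar> powr \<delta>))"

context conformal_image
begin

lemma image_density_measurable [measurable]:
  "(\<lambda>y. indicator (g ` U) y * \<bar>f (inv_into U g y)\<bar> powr \<delta>) \<in> borel_measurable borel"
proof -
  have "continuous_on (g ` U) (\<lambda>y. \<bar>f (inv_into U g y)\<bar> powr \<delta>)"
  proof (rule continuous_on_powr)
    show "continuous_on (g ` U) (\<lambda>y. \<bar>f (inv_into U g y)\<bar>)"
      by (rule continuous_on_compose2[OF continuous_scale continuous_inverse]) (auto intro: inv_into_into)
    show "\<forall>y\<in>g ` U. \<bar>f (inv_into U g y)\<bar> \<noteq> 0"
      using scale_pos by (metis inv_into_into less_irrefl)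
  qed (rule continuous_on_const)
  then have "(\<lambda>y. indicator (g ` U) y *\<^sub>R (\<bar>f (inv_into U g y)\<bar> powr \<delta>)) \<in> borel_measurable borel"
    by (rule borel_measurable_continuous_on_indicator[rotated]) (use open_image in simp)
  then show ?thesis by simp
qed

text \<open>The map is only known to be continuous on \<open>U\<close>, so measurability holds for the restriction.\<close>

lemma measurable_g:
  assumes "sets \<nu> = sets borel"
  shows "g \<in> measurable (restrict_space \<nu> U) borel"
proof -
  have "g \<in> measurable (restrict_space borel U) borel"
    by (rule borel_measurable_continuous_on_restrict[OF continuous_g])
  moreover have "measurable (restrict_space \<nu> U) borel = measurable (restrict_space borel U) borel"
    by (rule measurable_cong_sets[OF sets_restrict_space_cong[OF assms] refl])
  ultimately show ?thesis by blast
qed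

text \<open>The exponents add up: the substitution contributes \<open>d\<close> and the variable radius \<open>\<delta> - d\<close>, which
  together give the power \<open>\<delta>\<close> of the scaling ratio in the density.\<close>

lemma
  fixes \<nu> :: "(real^'n) measure"
  assumes \<nu>: "finite_borel_measure \<nu>" and conc: "AE x in \<nu>. x \<in> K"
    and w: "continuous_on UNIV w" "0 < a" "\<And>x. a \<le> w x" "\<And>x. w x \<le> b" "\<And>x. x \<in> collar \<Longrightarrow> w x = \<bar>f x\<bar>"
    and h: "h \<in> borel_measurable borel"
    and H: "bounded_borel H" "\<And>x. x \<in> collar \<Longrightarrow> H x = \<bar>f x\<bar> ^ CARD('n) * h (g x)"
  shows integrable_image_content: "integrable (image_content U g f \<delta> \<nu>) h"
    and integral_image_content: "integral\<^sup>L (image_content U g f \<delta> \<nu>) h =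
      (\<integral>x. w x powr (\<delta> - real DIM(real^'n)) * H x \<partial>\<nu>)"
proof -
  let ?d = "\<lambda>y. indicator (g ` U) y * \<bar>f (inv_into U g y)\<bar> powr \<delta>"
  let ?k = "\<lambda>x. w x powr (\<delta> - real DIM(real^'n)) * H x"
  have sets: "sets \<nu> = sets borel" using \<nu> by (simp add: finite_borel_measure_def)
  have U: "U \<inter> space \<nu> \<in> sets \<nu>" using open_U sets sets_eq_imp_space_eq[OF sets] by simp
  have "bounded_borel (\<lambda>x. w x powr (\<delta> - real DIM(real^'n)))" by (rule bounded_borel_powr[OF w(1-4)])
  then have bk: "bounded_borel ?k" by (intro bounded_borel_mult H(1))
  have g: "g \<in> measurable (restrict_space \<nu> U) borel"
    by (rule measurable_g[OF sets])
  have dh: "(\<lambda>y. ?d y * h y) \<in> borel_measurable borel" using h by measurable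
  have meas: "(\<lambda>x. indicator U x *\<^sub>R (?d (g x) * h (g x))) \<in> borel_measurable \<nu>"
    using measurable_compose[OF g dh] borel_measurable_restrict_space_iff[OF U, of "\<lambda>x. ?d (g x) * h (g x)"] by simp
  have kmeas: "?k \<in> borel_measurable \<nu>"
    unfolding measurable_cong_sets[OF sets refl] by (rule bounded_borel_measurable[OF bk])
  have eq: "AE x in \<nu>. indicator U x *\<^sub>R (?d (g x) * h (g x)) = ?k x"
    using conc
  proof eventually_elim
    case (elim x)
    then have x: "x \<in> collar" "x \<in> U" using K_subset_collar collar_subset by auto
    have "\<bar>f x\<bar> powr (\<delta> - real DIM(real^'n)) * \<bar>f x\<bar> ^ CARD('n) = \<bar>f x\<bar> powr \<delta>"
      using scale_pos[OF x(2)] by (simp add: powr_diff powr_realpow)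
    then show ?case
      using x inj_g by (simp add: w(5) H(2) mult.assoc[symmetric])
  qed
  have push: "(\<lambda>y. ?d y * h y) \<in> borel_measurable (pushforward_on U g \<nu>)"
    using dh by (simp add: pushforward_on_def)
  have hpush: "h \<in> borel_measurable (pushforward_on U g \<nu>)" "?d \<in> borel_measurable (pushforward_on U g \<nu>)"
    using h image_density_measurable by (simp_all add: pushforward_on_def)
  have int_k: "integrable \<nu> ?k" by (rule finite_borel_integrable[OF \<nu> bk])
  then have "integrable \<nu> (\<lambda>x. indicator U x *\<^sub>R (?d (g x) * h (g x)))"
    using integrable_cong_AE[OF meas kmeas eq] by simp
  then have "integrable (restrict_space \<nu> U) (\<lambda>x. ?d (g x) * h (g x))"
    using integrable_restrict_space[OF U, of "\<lambda>x. ?d (g x) * h (g x)"] by simp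
  then have "integrable (pushforward_on U g \<nu>) (\<lambda>y. ?d y * h y)"
    unfolding pushforward_on_def using integrable_distr_eq[OF g dh] by simp
  then show "integrable (image_content U g f \<delta> \<nu>) h"
    unfolding image_content_def using integrable_density[OF hpush(1,2)] by simp
  have "integral\<^sup>L (image_content U g f \<delta> \<nu>) h = integral\<^sup>L (pushforward_on U g \<nu>) (\<lambda>y. ?d y * h y)"
    unfolding image_content_def using integral_density[OF hpush(1,2)] by simp
  also have "\<dots> = integral\<^sup>L (restrict_space \<nu> U) (\<lambda>x. ?d (g x) * h (g x))"
    unfolding pushforward_on_def by (rule integral_distr[OF g dh])
  also have "\<dots> = (\<integral>x. indicator U x *\<^sub>R (?d (g x) * h (g x)) \<partial>\<nu>)"
    by (rule integral_restrict_space[OF U])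
  also have "\<dots> = integral\<^sup>L \<nu> ?k" by (rule integral_cong_AE[OF meas kmeas eq])
  finally show "integral\<^sup>L (image_content U g f \<delta> \<nu>) h = integral\<^sup>L \<nu> ?k" .
qed

lemma finite_borel_image_content:
  assumes \<nu>: "finite_borel_measure \<nu>" and conc: "AE x in \<nu>. x \<in> K"
  shows "finite_borel_measure (image_content U g f \<delta> \<nu>)"
proof -
  obtain w a b where w: "continuous_on UNIV w" "0 < a" "\<And>x. a \<le> w x" "\<And>x. w x \<le> b" "\<And>x. x \<in> collar \<Longrightarrow> w x = \<bar>f x\<bar>"
    by (rule scale_extension) blast
  obtain H where H: "continuous_on UNIV H" "bounded (range H)" "\<And>x. (0::real) \<le> H x"
      "\<And>x. x \<in> collar \<Longrightarrow> H x = \<bar>f x\<bar> ^ CARD('n) * 1"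
    by (rule density_extension[of "\<lambda>_. 1"]) auto
  have "integrable (image_content U g f \<delta> \<nu>) (\<lambda>_. 1 :: real)"
    by (rule integrable_image_content[OF \<nu> conc w _ bounded_borel_continuous[OF H(1,2)]]) (use H(4) in auto)
  then have "finite_measure (image_content U g f \<delta> \<nu>)"
    by (intro finite_measureI) (simp add: integrable_iff_bounded less_top)
  then show ?thesis by (simp add: finite_borel_measure_def image_content_def pushforward_on_def)
qed

text \<open>A distortion by the factor \<open>2\<close> is good enough for bounds of the exact order.\<close>

lemma regular_image: "minkowski_regular (g ` K) \<delta>"
proof -
  obtain w a b where w: "continuous_on UNIV w" "0 < a" "\<And>x. a \<le> w x" "\<And>x. w x \<le> b" "\<And>x. x \<in> collar \<Longrightarrow> w x = \<bar>f x\<bar>"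
    by (rule scale_extension) blast
  have b: "0 < b" using w(2) w(3,4)[of undefined] by linarith
  define H where "H x = w x ^ CARD('n)" for x
  have H: "0 < a ^ CARD('n)" "a ^ CARD('n) \<le> H x" "H x \<le> b ^ CARD('n)" "0 \<le> H x" for x
    using w(2) w(3,4)[of x] by (auto simp: H_def intro!: power_mono)
  have "H \<in> borel_measurable borel"
    unfolding H_def[abs_def] by (intro borel_measurable_continuous_onI continuous_intros w(1))
  then have bH: "bounded_borel H" by (rule bounded_borelI[of _ "b ^ CARD('n)"]) (use H in simp)
  have "\<exists>e>0. \<forall>\<epsilon>\<in>{0<..e}.
      sublevel_integral \<delta> (\<lambda>x. 2 * w x * infdist x K) H \<epsilon> \<le> nbhd_integral (g ` K) \<delta> (\<lambda>_. 1) \<epsilon> \<and>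
      nbhd_integral (g ` K) \<delta> (\<lambda>_. 1) \<epsilon> \<le> sublevel_integral \<delta> (\<lambda>x. 1 / 2 * w x * infdist x K) H \<epsilon>"
    by (rule nbhd_integral_image_sandwich[OF _ w(1-3,5) bounded_borel_const[of 1] bH H(4)]) (use w(5) in \<open>auto simp: H_def\<close>)
  then obtain e where e: "0 < e" "\<forall>\<epsilon>\<in>{0<..e}.
      sublevel_integral \<delta> (\<lambda>x. 2 * w x * infdist x K) H \<epsilon> \<le> nbhd_integral (g ` K) \<delta> (\<lambda>_. 1) \<epsilon> \<and>
      nbhd_integral (g ` K) \<delta> (\<lambda>_. 1) \<epsilon> \<le> sublevel_integral \<delta> (\<lambda>x. 1 / 2 * w x * infdist x K) H \<epsilon>"
    by blast
  note K = compact_K K_nonempty regular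
  have "2 * w x * infdist x K \<le> 2 * b * infdist x K" for x
    using w(4)[of x] by (intro mult_right_mono mult_left_mono infdist_nonneg) auto
  then have "\<exists>c>0. \<forall>\<epsilon>\<in>{0<..e}. c \<le> sublevel_integral \<delta> (\<lambda>x. 2 * w x * infdist x K) H \<epsilon>"
    using b e(1)
    by (intro sublevel_integral_lower_bound[where b = "2 * b", OF K tame_scaled_gauge(1)[OF K w(1-3) _ bH] _ _ bH H(1,2)]) auto
  then obtain c where c: "0 < c" "\<forall>\<epsilon>\<in>{0<..e}. c \<le> sublevel_integral \<delta> (\<lambda>x. 2 * w x * infdist x K) H \<epsilon>" by blast
  have "tame (sublevel_integral \<delta> (\<lambda>x. 1 / 2 * w x * infdist x K) H)"
    by (rule tame_scaled_gauge(2)[OF K w(1-3) _ bH]) simp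
  then obtain C where C: "\<And>\<epsilon>. 0 < \<epsilon> \<Longrightarrow> \<epsilon> \<le> e \<Longrightarrow> \<bar>sublevel_integral \<delta> (\<lambda>x. 1 / 2 * w x * infdist x K) H \<epsilon>\<bar> \<le> C"
    using e(1) by (rule tame_bounded) blast
  show ?thesis
  proof (rule minkowski_regularI[OF compact_image image_nonempty e(1) c(1)])
    fix \<epsilon> assume \<epsilon>: "0 < \<epsilon>" "\<epsilon> \<le> e"
    then have "\<epsilon> \<in> {0<..e}" by simp
    then show "c \<le> nbhd_integral (g ` K) \<delta> (\<lambda>_. 1) \<epsilon> \<and> nbhd_integral (g ` K) \<delta> (\<lambda>_. 1) \<epsilon> \<le> C"
      using bspec[OF e(2), of \<epsilon>] bspec[OF c(2), of \<epsilon>] C[OF \<epsilon>] by linarith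
  qed
qed

end

text \<open>The squeeze between variable-radius neighbourhoods of \<open>K\<close> has, by
  \<open>variable_gauge_limit\<close>, bounds converging to \<open>c powr (\<delta> - d)\<close> and \<open>(1 / c) powr (\<delta> - d)\<close> times
  the integral against the candidate, and \<open>c\<close> is arbitrarily close to one. Monotonicity needs
  a nonnegative integrand; a bounded function is the difference of a nonnegative one and a constant.\<close>

lemma (in limit_mode) mode_content_image:
  fixes K U :: "(real^'n) set"
  assumes conf: "conformal_image K U g f \<delta>"
    and \<nu>: "finite_borel_measure \<nu>" "mode_content K \<delta> \<nu>" and conc: "AE x in \<nu>. x \<in> K"
  shows "mode_content (g ` K) \<delta> (image_content U g f \<delta> \<nu>)"
proof -
  interpret conformal_image K U g f \<delta> by (rule conf)
  note K = compact_K K_nonempty regular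
  obtain w a b where w: "continuous_on UNIV w" "0 < a" "\<And>x. a \<le> w x" "\<And>x. w x \<le> b" "\<And>x. x \<in> collar \<Longrightarrow> w x = \<bar>f x\<bar>"
    by (rule scale_extension) blast
  have wpos: "0 < w x" for x using w(2) w(3)[of x] by linarith
  let ?p = "\<delta> - real DIM(real^'n)"
  have tameF: "tame (nbhd_integral (g ` K) \<delta> h)" if "bounded_borel h" for h
    by (rule minkowski_regular_tame[OF compact_image image_nonempty regular_image that])
  have nonneg: "(A (nbhd_integral (g ` K) \<delta> h) \<longlongrightarrow> integral\<^sup>L (image_content U g f \<delta> \<nu>) h) (at_right 0)"
    if h: "continuous_on UNIV h" "bounded (range h)" "\<And>y. 0 \<le> h y" for h
  proof -
    obtain H where H: "continuous_on UNIV H" "bounded (range H)" "\<And>x. (0::real) \<le> H x"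
        "\<And>x. x \<in> collar \<Longrightarrow> H x = \<bar>f x\<bar> ^ CARD('n) * h (g x)"
      by (rule density_extension[OF h]) blast
    note bh = bounded_borel_continuous[OF h(1,2)]
    note bH = bounded_borel_continuous[OF H(1,2)]
    define G where "G = (\<integral>x. w x powr ?p * H x \<partial>\<nu>)"
    have G: "integral\<^sup>L (image_content U g f \<delta> \<nu>) h = G"
      unfolding G_def by (rule integral_image_content[OF \<nu>(1) conc w bounded_borel_measurable[OF bh] bH H(4)])
    have scaled: "tame (sublevel_integral \<delta> (\<lambda>x. c * w x * infdist x K) H)"
        "(A (sublevel_integral \<delta> (\<lambda>x. c * w x * infdist x K) H) \<longlongrightarrow> c powr ?p * G) (at_right 0)" if c: "0 < c" for c
    proof -
      have cw: "continuous_on UNIV (\<lambda>x. c * w x)" "0 < c * a" "\<And>x. c * a \<le> c * w x" "\<And>x. c * w x \<le> c * b"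
        using c w by (auto intro!: continuous_intros)
      show "tame (sublevel_integral \<delta> (\<lambda>x. c * w x * infdist x K) H)"
        by (rule tame_scaled_gauge(2)[OF K w(1-3) c bH])
      have "(\<integral>x. (c * w x) powr ?p * H x \<partial>\<nu>) = c powr ?p * G"
        unfolding G_def using c wpos by (simp add: powr_mult less_imp_le mult.assoc)
      then show "(A (sublevel_integral \<delta> (\<lambda>x. c * w x * infdist x K) H) \<longlongrightarrow> c powr ?p * G) (at_right 0)"
        using variable_gauge_limit[OF K \<nu> cw H(1-3)] by simp
    qed
    show ?thesis
      unfolding G
    proof (rule limit_sandwich[OF tameF[OF bh]])
      fix \<theta> :: real assume \<theta>: "0 < \<theta>"
      obtain c where c: "1 < c" "c powr \<bar>?p\<bar> * G \<le> G + \<theta>" "G - \<theta> \<le> c powr (- \<bar>?p\<bar>) * G"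
        using factor_near_one[OF \<theta>] by blast
      have c0: "0 < c" "0 < 1 / c" using c(1) by auto
      have G0: "0 \<le> G" unfolding G_def using H(3) by (intro Bochner_Integration.integral_nonneg) simp
      obtain e where e': "0 < e" "\<forall>\<epsilon>\<in>{0<..e}.
          sublevel_integral \<delta> (\<lambda>x. c * w x * infdist x K) H \<epsilon> \<le> nbhd_integral (g ` K) \<delta> h \<epsilon> \<and>
          nbhd_integral (g ` K) \<delta> h \<epsilon> \<le> sublevel_integral \<delta> (\<lambda>x. 1 / c * w x * infdist x K) H \<epsilon>"
        using nbhd_integral_image_sandwich[OF c(1) w(1-3,5) bh bH H(3,4)] by blast
      note e = e'(1) bspec[OF e'(2) greaterThanAtMost_iff[THEN iffD2, OF conjI]]
      show "\<exists>W W' a' b' e. tame W \<and> tame W' \<and> 0 < e \<and>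
        (\<forall>\<epsilon>. 0 < \<epsilon> \<longrightarrow> \<epsilon> \<le> e \<longrightarrow> W \<epsilon> \<le> nbhd_integral (g ` K) \<delta> h \<epsilon> \<and> nbhd_integral (g ` K) \<delta> h \<epsilon> \<le> W' \<epsilon>) \<and>
        (A W \<longlongrightarrow> a') (at_right 0) \<and> (A W' \<longlongrightarrow> b') (at_right 0) \<and> G - \<theta> \<le> a' \<and> b' \<le> G + \<theta>"
      proof (intro exI conjI allI impI)
        show "tame (sublevel_integral \<delta> (\<lambda>x. c * w x * infdist x K) H)" by (rule scaled(1)[OF c0(1)])
        show "tame (sublevel_integral \<delta> (\<lambda>x. 1 / c * w x * infdist x K) H)" by (rule scaled(1)[OF c0(2)])
        show "0 < e" by (rule e(1))
        fix \<epsilon> :: real assume \<epsilon>: "0 < \<epsilon>" "\<epsilon> \<le> e"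
        show "sublevel_integral \<delta> (\<lambda>x. c * w x * infdist x K) H \<epsilon> \<le> nbhd_integral (g ` K) \<delta> h \<epsilon>"
          "nbhd_integral (g ` K) \<delta> h \<epsilon> \<le> sublevel_integral \<delta> (\<lambda>x. 1 / c * w x * infdist x K) H \<epsilon>"
          using e(2)[OF \<epsilon>] by auto
      next
        have "c powr (- \<bar>?p\<bar>) * G \<le> c powr ?p * G"
          using powr_bounds(2)[of c c ?p] c(1) G0 by (intro mult_right_mono) (auto simp: divide_le_eq)
        then show "G - \<theta> \<le> c powr ?p * G" using c(3) by linarith
        have "(1 / c) powr ?p * G \<le> c powr \<bar>?p\<bar> * G"
        proof (intro mult_right_mono powr_bounds(1) G0)
          have "1 / c \<le> 1" using c(1) by simp
          then show "1 / c \<le> c" using c(1) by linarith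
        qed (use c(1) in auto)
        then show "(1 / c) powr ?p * G \<le> G + \<theta>" using c(2) by linarith
      qed (rule scaled(2)[OF c0(1)] scaled(2)[OF c0(2)])+
    qed
  qed
  note finF = finite_borel_image_content[OF \<nu>(1) conc]
  show ?thesis
    unfolding mode_content_def
  proof (intro allI impI)
    fix h :: "real^'n \<Rightarrow> real" assume h: "continuous_on UNIV h" "bounded (range h)"
    note bh = bounded_borel_continuous[OF h]
    obtain B where B: "B > 0" "\<And>x. \<bar>h x\<bar> \<le> B" using bh by (rule bounded_borelE) blast
    have k: "continuous_on UNIV (\<lambda>x. h x + B)" "bounded (range (\<lambda>x. h x + B))" "0 \<le> h x + B" for x
    proof -
      show "continuous_on UNIV (\<lambda>x. h x + B)" by (intro continuous_intros h(1))
      show "bounded (range (\<lambda>x. h x + B))"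
        using bounded_borel_add[OF bh bounded_borel_const[of B]] by (simp add: bounded_borel_def)
      show "0 \<le> h x + B" using B(2)[of x] by linarith
    qed
    have const: "(A (nbhd_integral (g ` K) \<delta> (\<lambda>_. B)) \<longlongrightarrow> integral\<^sup>L (image_content U g f \<delta> \<nu>) (\<lambda>_. B)) (at_right 0)"
      by (rule nonneg) (use B(1) in auto)
    have "(A (\<lambda>\<epsilon>. nbhd_integral (g ` K) \<delta> (\<lambda>x. h x + B) \<epsilon> - nbhd_integral (g ` K) \<delta> (\<lambda>_. B) \<epsilon>) \<longlongrightarrow>
        integral\<^sup>L (image_content U g f \<delta> \<nu>) (\<lambda>x. h x + B) - integral\<^sup>L (image_content U g f \<delta> \<nu>) (\<lambda>_. B)) (at_right 0)"
      by (intro limit_diff tameF nonneg k const bounded_borel_const bounded_borel_add bh)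
    moreover have "(\<lambda>\<epsilon>. nbhd_integral (g ` K) \<delta> (\<lambda>x. h x + B) \<epsilon> - nbhd_integral (g ` K) \<delta> (\<lambda>_. B) \<epsilon>) = nbhd_integral (g ` K) \<delta> h"
      using sublevel_integral_add[OF proper_gauge_infdist[OF compact_image image_nonempty] bh bounded_borel_const[of B]]
      by (auto simp: fun_eq_iff)
    moreover have "integral\<^sup>L (image_content U g f \<delta> \<nu>) (\<lambda>x. h x + B) - integral\<^sup>L (image_content U g f \<delta> \<nu>) (\<lambda>_. B)
        = integral\<^sup>L (image_content U g f \<delta> \<nu>) h"
      using finite_borel_integrable[OF finF bh] finite_borel_integrable[OF finF bounded_borel_const[of B]] by simp
    ultimately show "(A (nbhd_integral (g ` K) \<delta> h) \<longlongrightarrow> integral\<^sup>L (image_content U g f \<delta> \<nu>) h) (at_right 0)"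
      by simp
  qed
qed

lemma holder_continuous_imp_continuous:
  assumes "holder_continuous_on \<alpha> S h" "0 < \<alpha>"
  shows "continuous_on S h"
proof -
  obtain C where C: "\<And>x y. x \<in> S \<Longrightarrow> y \<in> S \<Longrightarrow> \<bar>h x - h y\<bar> \<le> C * dist x y powr \<alpha>"
    using assms(1) unfolding holder_continuous_on_def by blast
  show ?thesis
    unfolding continuous_on_def
  proof
    fix x assume x: "x \<in> S"
    have "((\<lambda>y. dist y x powr \<alpha>) \<longlongrightarrow> 0) (at x within S)"
      using assms(2) by (intro tendsto_zero_powrI[where b = \<alpha>] tendsto_const) (auto intro!: tendsto_eq_intros)
    then have "((\<lambda>y. C * dist y x powr \<alpha>) \<longlongrightarrow> 0) (at x within S)" by (rule tendsto_mult_right_zero)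
    moreover have "\<forall>\<^sub>F y in at x within S. norm (h y - h x) \<le> C * dist y x powr \<alpha>"
      using C x by (auto simp: eventually_at_filter)
    ultimately have "((\<lambda>y. h y - h x) \<longlongrightarrow> 0) (at x within S)" by (rule Lim_null_comparison[rotated])
    then show "(h \<longlongrightarrow> h x) (at x within S)" by (rule LIM_zero_cancel)
  qed
qed

theorem theorem1p7:
  fixes N :: nat
    and \<phi> :: "nat \<Rightarrow> real^'n \<Rightarrow> real^'n"
    and r :: "nat \<Rightarrow> real"
    and K F U :: "(real^'n) set"
    and g :: "real^'n \<Rightarrow> real^'n"
    and f :: "real^'n \<Rightarrow> real"
    and \<alpha> :: real
  assumes "N \<ge> 2"
    and "\<And>i. i \<in> {1..N} \<Longrightarrow> contracting_similarity (r i) (\<phi> i)"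
    and "invariant_set N \<phi> K"
    and "strong_separation N \<phi> K"
    and "parallel_nbhd K (1/2) \<subseteq> U"
    and "C1_diffeomorphism_on U g"
    and "conformal_on U g f"
    and "\<alpha> > 0"
    and "holder_continuous_on \<alpha> U (\<lambda>x. \<bar>f x\<bar>)"
    and "F = g ` K"
  shows
    "(local_average_minkowski_content_exists K \<and>
      local_average_minkowski_content_exists F \<and>
      absolutely_continuous
        (pushforward_on U g (local_average_minkowski_content K))
        (local_average_minkowski_content F) \<and>
      (AE y in pushforward_on U g (local_average_minkowski_content K).
         RN_deriv (pushforward_on U g (local_average_minkowski_content K))
                  (local_average_minkowski_content F) y =
         ennreal (\<bar>f (inv_into U g y)\<bar> powr minkowski_dim K)))
     \<and>
     (local_minkowski_content_exists K \<longrightarrow>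
      local_minkowski_content_exists F \<and>
      local_minkowski_content K = local_average_minkowski_content K \<and>
      local_minkowski_content F = local_average_minkowski_content F)"
proof -
  have "0 < r i \<and> r i < 1" if "i \<in> {1..N}" for i
    using assms(2)[OF that] by (simp add: contracting_similarity_def)
  then obtain \<delta> where \<delta>: "(\<Sum>i\<in>{1..N}. r i powr \<delta>) = 1"
    using moran_exponent_exists[OF assms(1)] by blast
  interpret ifs: self_similar_set N \<phi> r K \<delta>
    using assms(1-4) \<delta> by unfold_locales
  note K = ifs.compact_K ifs.K_nonempty ifs.regular
  interpret conf: conformal_image K U g f \<delta>
    using K assms(5-7) holder_continuous_imp_continuous[OF assms(9,8)] by unfold_locales
  note F = conf.compact_image conf.image_nonempty conf.regular_image
  obtain \<nu> where \<nu>: "finite_borel_measure \<nu>" "AE x in \<nu>. x \<in> K" "logarithmic.mode_content K \<delta> \<nu>"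
    by (rule ifs.average_content)
  define \<kappa> where "\<kappa> = image_content U g f \<delta> \<nu>"
  have avgK: "is_local_average_minkowski_content K \<nu>"
    using \<nu> by (simp add: is_local_content_iff(2)[OF K])
  have fin\<kappa>: "finite_borel_measure \<kappa>"
    unfolding \<kappa>_def by (rule conf.finite_borel_image_content[OF \<nu>(1,2)])
  have avgF: "is_local_average_minkowski_content F \<kappa>"
    unfolding assms(10) is_local_content_iff(2)[OF F]
    using fin\<kappa> logarithmic.mode_content_image[OF conf.conformal_image_axioms \<nu>(1,3,2)] by (simp add: \<kappa>_def)
  note eqK = local_average_minkowski_content_eqI[OF avgK]
  note eqF = local_average_minkowski_content_eqI[OF avgF]
  have dim: "minkowski_dim K = \<delta>"
    by (rule minkowski_dim_eqI[OF minkowski_regular_has_dim[OF K]])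
  define P where "P = pushforward_on U g \<nu>"
  let ?d = "\<lambda>y. ennreal (indicator (g ` U) y * \<bar>f (inv_into U g y)\<bar> powr \<delta>)"
  have d: "?d \<in> borel_measurable P"
    using conf.image_density_measurable by (simp add: P_def pushforward_on_def)
  have \<kappa>: "\<kappa> = density P ?d" by (simp add: \<kappa>_def image_content_def P_def)
  have sets: "sets \<nu> = sets borel" using \<nu>(1) by (simp add: finite_borel_measure_def)
  have g: "g \<in> measurable (restrict_space \<nu> U) borel"
    by (rule conf.measurable_g[OF sets])
  have fin\<nu>: "finite_measure \<nu>" using \<nu>(1) by (simp add: finite_borel_measure_def)
  have "U \<in> sets \<nu>" unfolding sets using conf.open_U by simp
  then have "finite_measure (restrict_space \<nu> U)" by (rule finite_measure_restrict_space[OF fin\<nu>])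
  then have "finite_measure P"
    unfolding P_def pushforward_on_def by (rule finite_measure.finite_measure_distr[OF _ g])
  then interpret P: finite_measure P .
  have inU: "AE y in P. y \<in> g ` U"
    unfolding P_def pushforward_on_def
  proof (subst AE_distr_iff[OF g])
    show "{y \<in> space borel. y \<in> g ` U} \<in> sets borel" using conf.open_image by simp
    show "AE x in restrict_space \<nu> U. g x \<in> g ` U"
      by (rule AE_I2) (simp add: space_restrict_space)
  qed
  have "AE y in P. ?d y = RN_deriv P \<kappa> y"
    by (rule P.RN_deriv_unique[OF d \<kappa>[symmetric]])
  then have rn: "AE y in P. RN_deriv P \<kappa> y = ennreal (\<bar>f (inv_into U g y)\<bar> powr \<delta>)"
    using inU by eventually_elim simp
  have ac: "absolutely_continuous P \<kappa>" unfolding \<kappa> by (rule absolutely_continuousI_density[OF d])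
  have part1: "local_average_minkowski_content_exists K \<and> local_average_minkowski_content_exists F"
    using avgK avgF by (auto simp: local_average_minkowski_content_exists_def)
  have part2: "local_minkowski_content_exists F \<and>
      local_minkowski_content K = local_average_minkowski_content K \<and>
      local_minkowski_content F = local_average_minkowski_content F"
    if exists: "local_minkowski_content_exists K"
  proof -
    obtain \<mu> where \<mu>: "is_local_minkowski_content K \<mu>"
      using exists by (auto simp: local_minkowski_content_exists_def)
    then have \<mu>': "finite_borel_measure \<mu>" "pointwise.mode_content K \<delta> \<mu>"
      by (auto simp: is_local_content_iff(1)[OF K])
    then have "is_local_average_minkowski_content K \<mu>"
      using mode_content_cesaro[OF K] by (simp add: is_local_content_iff(2)[OF K])
    then have "\<mu> = \<nu>" using local_average_minkowski_content_eqI eqK by metis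
    then have contF: "is_local_minkowski_content F \<kappa>"
      unfolding assms(10) is_local_content_iff(1)[OF F]
      using fin\<kappa> \<mu>' pointwise.mode_content_image[OF conf.conformal_image_axioms \<nu>(1) _ \<nu>(2)] by (simp add: \<kappa>_def)
    then show ?thesis
      using local_minkowski_content_eqI[OF \<mu>] local_minkowski_content_eqI[OF contF] eqK eqF \<open>\<mu> = \<nu>\<close>
      by (auto simp: local_minkowski_content_exists_def)
  qed
  show ?thesis
    using part1 part2 ac[unfolded P_def] rn[unfolded P_def] unfolding eqK eqF dim by blast
qed

end
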